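(* Let $k\in\mathbb{N}=\{1,2,\ldots\}$, $c>1$, and $p,q,r\ge0$ with $p+q+r=1$. Assume $0<r<p$. Then $\mu^{(k)}$ is infinitely divisible if and only if one of the following holds: (a) $r\le pq$; (b) $c^l=2$ for some $l\in\{1,2,\ldots,k\}$ and $r^2\le p^2q$.
   Context: For $k\in\mathbb{Z}$ let $\{(N_t^{(k)},L_t^{(k)}),t\ge0\}$ be the bivariate compound Poisson process (pure jump, no drift) with $E[e^{i(z_1N_t^{(k)}+z_2L_t^{(k)})}]=\exp[t\int_{\mathbb{R}^2}(e^{i(z_1x_1+z_2x_2)}-1)\nu^{(k)}(dx)]$, where $\nu^{(k)}$ is concentrated on the points $(1,0)$, $(0,1)$, $(1,c^{-k})$ with masses $u,v,w\ge0$ respectively, and $p=u/(u+v+w)$, $q=v/(u+v+w)$, $r=w/(u+v+w)$. Define $\mu^{(k)}$ as the distribution of $\int_0^{\infty-}c^{-N^{(k)}_{s-}}\,dL_s^{(k)}$ (the almost sure limit of $\int_0^t$ as $t\to\infty$, which exists). It depends on $u,v,w$ only through $p,q,r$. *)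

theory Defs
  imports "HOL-Probability.Probability"
begin

definition cadlag :: "(real \<Rightarrow> 'b::topological_space) \<Rightarrow> bool" where
  "cadlag f \<longleftrightarrow> (\<forall>t\<ge>0. continuous (at_right t) f) \<and> (\<forall>t>0. \<exists>l. (f \<longlongrightarrow> l) (at_left t))"

text \<open>A process is indexed by \<open>real\<close>, but only its values at times \<open>t \<ge> 0\<close> are constrained or used.\<close>

definition levy_process ::
    "'a measure \<Rightarrow> (real \<Rightarrow> 'a \<Rightarrow> 'b::euclidean_space) \<Rightarrow> bool" where
  "levy_process M Z \<longleftrightarrow>
     prob_space M \<and>
     (\<forall>t\<ge>0. Z t \<in> borel_measurable M) \<and>
     (AE \<omega> in M. Z 0 \<omega> = 0) \<and>
     (\<forall>(n::nat) \<tau>. 0 \<le> \<tau> 0 \<and> (\<forall>i<n. \<tau> i \<le> \<tau> (Suc i)) \<longrightarrow>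
        prob_space.indep_vars M (\<lambda>_. borel) (\<lambda>i \<omega>. Z (\<tau> (Suc i)) \<omega> - Z (\<tau> i) \<omega>) {..<n}) \<and>
     (\<forall>s\<ge>0. \<forall>t\<ge>0. distr M borel (\<lambda>\<omega>. Z (s + t) \<omega> - Z s \<omega>) = distr M borel (Z t)) \<and>
     (\<forall>t\<ge>0. \<forall>\<epsilon>>0.
        ((\<lambda>s. measure M {\<omega> \<in> space M. dist (Z s \<omega>) (Z t \<omega>) > \<epsilon>}) \<longlongrightarrow> 0) (at t within {0..})) \<and>
     (AE \<omega> in M. cadlag (\<lambda>t. Z t \<omega>))"

text \<open>The exponent has no Gaussian part and no drift, so the process moves only by jumps, which
  arrive at the total rate of the finite measure \<open>\<nu>\<close>.\<close>

definition compound_poisson_process ::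
    "'a measure \<Rightarrow> 'b measure \<Rightarrow> (real \<Rightarrow> 'a \<Rightarrow> 'b::euclidean_space) \<Rightarrow> bool" where
  "compound_poisson_process M \<nu> Z \<longleftrightarrow>
     finite_measure \<nu> \<and> sets \<nu> = sets borel \<and> levy_process M Z \<and>
     (\<forall>t\<ge>0. \<forall>z. (CLINT \<omega>|M. iexp (z \<bullet> Z t \<omega>)) =
        exp (complex_of_real t * (CLINT x|\<nu>. iexp (z \<bullet> x) - 1)))"

definition jump_measure ::
    "int \<Rightarrow> real \<Rightarrow> real \<Rightarrow> real \<Rightarrow> real \<Rightarrow> (real \<times> real) measure" where
  "jump_measure k c u v w =
     distr
       (point_measure {(1, 0), (0, 1), (1, c powi (- k))}
          (\<lambda>x. ennreal (if x = (1, 0) then u else if x = (0, 1) then v else w)))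
       borel (\<lambda>x. x)"

text \<open>\<open>stoch_integral c n l t\<close> is the Lebesgue--Stieltjes integral of \<open>s \<mapsto> c powr - n(s-)\<close> over
  \<open>{0<..t}\<close> with respect to the path \<open>l\<close>, which is extended by \<open>l 0\<close> to negative times because
  \<open>interval_measure\<close> wants a function on the whole line. It also wants a nondecreasing
  right-continuous function; almost every path of the second component of a compound Poisson
  process with jump measure \<open>jump_measure k c u v w\<close> is one, as the jumps of that component
  are nonnegative.\<close>

definition stoch_integral :: "real \<Rightarrow> (real \<Rightarrow> real) \<Rightarrow> (real \<Rightarrow> real) \<Rightarrow> real \<Rightarrow> real" where
  "stoch_integral c n l t =
     (LINT s:{0<..t}|interval_measure (\<lambda>s. l (max 0 s)). c powr (- Lim (at_left s) n))"

primrec convolution_power :: "nat \<Rightarrow> real measure \<Rightarrow> real measure" where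
  "convolution_power 0 \<rho> = return borel 0"
| "convolution_power (Suc n) \<rho> = convolution (convolution_power n \<rho>) \<rho>"

definition infinitely_divisible :: "real measure \<Rightarrow> bool" where
  "infinitely_divisible \<mu> \<longleftrightarrow>
     (\<forall>n\<ge>1. \<exists>\<rho>. real_distribution \<rho> \<and> \<mu> = convolution_power n \<rho>)"

end

(*
The renewal structure at the first jump gives the characteristic function phi of X the equation
  (1 - q e^{iz}) phi(z) = (p + r e^{i z / c^k}) phi(z / c).
To obtain it without jump times, condition on the increments up to a time T (using Riemann sums of
the stochastic integral) to get phi(z) = E[e^{iz X_T} phi(z c^{-N_T})], replace X_T by L_T at the
cost of O(T^2), and let T tend to 0.  As r < p, iterating the equation and expanding logarithms gives
  phi(z) = exp(SUM_{n,j} b(n,j) (e^{i z j / c^n} - 1)),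
  b(n,j) = q^j / j - [n >= k] (-r/p)^j / j,
where the signed weights are summable against the points j / c^n.  If all atoms of the signed measure
are nonnegative, phi is the characteristic function of a sum of independent Poisson multiples, hence
infinitely divisible; conversely every atom must be nonnegative, which is tested with squared moduli
of trigonometric polynomials vanishing at 0.  The weights are nonnegative under (a).  Under (b) the
point 2j / c^m equals j / c^(m-l), so that the negative mass of even multiples is absorbed l levels
lower.  Otherwise the atom at 2P / c^k is negative for all large primes P: its only representations
at lower levels come from c^l = 2, and those at higher levels are exponentially smaller.
*)

theory Submission
  imports Defs
begin

section \<open>Characteristic functions of compound Poisson laws\<close>

text \<open>Write a = r/p. As 1 - q = p + r, the equation reads phi(z) = phi(z/c) G(z) B(z/c^k),
  where G is the characteristic function of a geometric law and B that of a law on 0 and 1. The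
  logarithm of G has the weights q^j/j, that of B the weights -(-a)^j/j, which are negative exactly
  at even j >= 2; so everything turns on what can pay for even multiples. On its own level the
  payment is q^j against a^j, hence condition (a), which is a <= q. A point 2j/c^m that reappears as
  j/c^(m-l) sets q^j/j against a^(2j)/(2j), and for large j only a^2 <= q survives, which is the
  inequality in (b). Primes P are used because an equation j c^l = 2P with rational c^l forces a
  large P to divide j. Every level n >= k carries the same nonzero weights, so the weights
  themselves are not summable; all limits rest on |e^(ix) - 1| <= |x| and on summability of weight
  times point. Since the process is given by the laws of its increments and by path regularity,
  marginals are read off characteristic functions.\<close>

text \<open>\<open>poisson_pmf\<close> presupposes a positive rate; the point mass at 0 takes care
  of weights that vanish.\<close>

definition scaled_poisson :: "real \<Rightarrow> real \<Rightarrow> real measure" where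
  "scaled_poisson b x =
     distr (measure_pmf (if b > 0 then poisson_pmf b else return_pmf 0)) borel (\<lambda>n. real n * x)"

lemma has_bochner_integral_poisson_power:
  fixes z :: "'b::{real_normed_field, banach, second_countable_topology}"
  assumes "b > 0"
  shows "has_bochner_integral (measure_pmf (poisson_pmf b)) (\<lambda>n. z ^ n) (exp (of_real b * (z - 1)))"
proof -
  have eq: "pmf (poisson_pmf b) n *\<^sub>R z ^ n = (of_real b * z) ^ n /\<^sub>R fact n * of_real (exp (-b))" for n
    using assms by (simp add: scaleR_conv_of_real power_mult_distrib divide_simps)
  have int: "integrable (count_space UNIV) (\<lambda>n. pmf (poisson_pmf b) n *\<^sub>R z ^ n)"
    unfolding integrable_count_space_nat_iff eq
    using summable_mult2[OF summable_norm_exp[of "of_real b * z"], of "norm (of_real (exp (-b)) :: 'b)"]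
    by (simp add: norm_mult mult_ac)
  have sums: "(\<lambda>n. pmf (poisson_pmf b) n *\<^sub>R z ^ n) sums (exp (of_real b * (z - 1)))"
    unfolding eq using sums_mult2[OF exp_converges[of "of_real b * z"], of "of_real (exp (-b))"]
    by (simp add: exp_of_real [symmetric] exp_add [symmetric] algebra_simps del: exp_of_real exp_minus)
  have "integral\<^sup>L (count_space UNIV) (\<lambda>n. pmf (poisson_pmf b) n *\<^sub>R z ^ n) = exp (of_real b * (z - 1))"
    using integral_count_space_nat[OF int] sums_unique[OF sums] by simp
  then show ?thesis
    unfolding measure_pmf_eq_density using int
    by (intro has_bochner_integral_density) (auto simp: has_bochner_integral_iff)
qed

lemma real_distribution_scaled_poisson [simp]: "real_distribution (scaled_poisson b x)"
  unfolding scaled_poisson_def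
  by (intro real_distribution.intro prob_space.prob_space_distr real_distribution_axioms.intro)
     (auto intro: prob_space_measure_pmf)

lemma char_scaled_poisson:
  assumes "b \<ge> 0"
  shows "char (scaled_poisson b x) t = exp (of_real b * (iexp (t * x) - 1))"
proof (cases "b > 0")
  case True
  have "char (scaled_poisson b x) t = (CLINT n|measure_pmf (poisson_pmf b). iexp (t * x) ^ n)"
    using True unfolding char_def scaled_poisson_def
    by (simp add: integral_distr exp_of_nat_mult [symmetric] mult_ac)
  then show ?thesis
    using has_bochner_integral_poisson_power[OF True, of "iexp (t * x)"] by (simp add: has_bochner_integral_iff)
next
  case False
  then have "b = 0" using assms by simp
  then show ?thesis unfolding char_def scaled_poisson_def by (simp add: integral_distr)
qed

text \<open>The mean serves twice: for almost sure convergence of the infinite sum in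
  \<open>char_exp_exists\<close> and for the first moments of \<open>N\<close> and \<open>L\<close>.
  Its series is that of the exponential function shifted by one index, the term at 0 being
  zero.\<close>

lemma nn_integral_scaled_poisson:
  assumes "b \<ge> 0" "x \<ge> 0"
  shows "(\<integral>\<^sup>+y. ennreal y \<partial>scaled_poisson b x) = ennreal (b * x)"
proof (cases "b > 0")
  case True
  have sums: "(\<lambda>n. pmf (poisson_pmf b) n * (real n * x)) sums (b * x)"
  proof -
    have "(\<lambda>n. b ^ n /\<^sub>R fact n * (b * x * exp (-b))) sums (exp b * (b * x * exp (-b)))"
      by (intro sums_mult2 exp_converges)
    also have "exp b * (b * x * exp (-b)) = b * x"
      by (simp add: exp_minus)
    also have "(\<lambda>n. b ^ n /\<^sub>R fact n * (b * x * exp (-b))) =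
        (\<lambda>n. pmf (poisson_pmf b) (Suc n) * (real (Suc n) * x))"
      using True by (auto simp: divide_simps simp del: of_nat_Suc)
    finally show ?thesis by (subst (asm) sums_Suc_iff) simp
  qed
  have "(\<integral>\<^sup>+y. ennreal y \<partial>scaled_poisson b x) = (\<integral>\<^sup>+n. ennreal (real n * x) \<partial>measure_pmf (poisson_pmf b))"
    using True unfolding scaled_poisson_def by (simp add: nn_integral_distr)
  also have "\<dots> = (\<integral>\<^sup>+n. ennreal (pmf (poisson_pmf b) n * (real n * x)) \<partial>count_space UNIV)"
    using assms by (simp add: nn_integral_measure_pmf ennreal_mult'')
  also have "\<dots> = (\<Sum>n. ennreal (pmf (poisson_pmf b) n * (real n * x)))"
    by (simp add: nn_integral_count_space_nat)
  also have "\<dots> = ennreal (b * x)"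
    using sums assms by (intro suminf_ennreal_eq) auto
  finally show ?thesis .
next
  case False
  then have "b = 0" using assms by simp
  then show ?thesis unfolding scaled_poisson_def by (simp add: nn_integral_distr nn_integral_measure_pmf_finite)
qed

lemma AE_scaled_poisson_nonneg: "x \<ge> 0 \<Longrightarrow> AE y in scaled_poisson b x. 0 \<le> y"
  unfolding scaled_poisson_def by (subst AE_distr_iff) auto

lemma
  assumes "real_distribution A" "real_distribution B"
  shows real_distribution_convolution: "real_distribution (convolution A B)"
    and char_convolution: "char (convolution A B) t = char A t * char B t"
proof -
  interpret A: real_distribution A by fact
  interpret B: real_distribution B by fact
  interpret AB: pair_prob_space A B ..
  have [measurable]: "(\<lambda>(x, y). x + y) \<in> borel_measurable (A \<Otimes>\<^sub>M B)"
    by measurable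
  show "real_distribution (convolution A B)"
    unfolding convolution_def
    by (intro real_distribution.intro AB.prob_space_distr real_distribution_axioms.intro) auto
  have int: "integrable (A \<Otimes>\<^sub>M B) (\<lambda>(x, y). iexp (t * x) * iexp (t * y))"
    by (intro AB.integrable_const_bound[of _ 1]) (auto simp: norm_mult)
  have "char (convolution A B) t = (CLINT z|A \<Otimes>\<^sub>M B. (case z of (x, y) \<Rightarrow> iexp (t * x) * iexp (t * y)))"
    unfolding char_def convolution_def
    by (subst integral_distr) (auto simp: ring_distribs exp_add case_prod_beta intro!: Bochner_Integration.integral_cong)
  also have "\<dots> = (CLINT x|A. CLINT y|B. iexp (t * x) * iexp (t * y))"
    by (subst AB.integral_fst'[OF int, symmetric]) simp
  also have "\<dots> = char A t * char B t"
    by (simp add: char_def)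
  finally show "char (convolution A B) t = char A t * char B t" .
qed

lemma
  assumes "real_distribution A"
  shows real_distribution_convolution_power: "real_distribution (convolution_power n A)"
    and char_convolution_power: "char (convolution_power n A) t = char A t ^ n"
proof -
  have *: "real_distribution (convolution_power n A) \<and> char (convolution_power n A) t = char A t ^ n"
  proof (induction n)
    case 0
    have "real_distribution (return borel (0::real))"
      by (intro real_distribution.intro real_distribution_axioms.intro prob_space_return) auto
    then show ?case by (simp add: char_def integral_return)
  next
    case (Suc n)
    then show ?case
      using assms by (simp add: real_distribution_convolution char_convolution)
  qed
  then show "real_distribution (convolution_power n A)" "char (convolution_power n A) t = char A t ^ n"
    by auto
qed

lemma iexp_minus_1_le: "cmod (iexp x - 1) \<le> \<bar>x\<bar>"
  using iexp_approx1[of x 0] by simp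

lemma summable_exponent:
  fixes b x :: "nat \<Rightarrow> real"
  assumes "\<And>i. b i \<ge> 0" "\<And>i. x i \<ge> 0" "summable (\<lambda>i. b i * x i)"
  shows "summable (\<lambda>i. of_real (b i) * (iexp (t * x i) - 1))"
proof (rule summable_comparison_test')
  show "summable (\<lambda>i. \<bar>t\<bar> * (b i * x i))" by (intro summable_mult assms)
  show "norm (of_real (b i) * (iexp (t * x i) - 1)) \<le> \<bar>t\<bar> * (b i * x i)" for i
    using mult_left_mono[OF iexp_minus_1_le[of "t * x i"] assms(1)[of i]] assms(1,2)
    by (simp add: norm_mult abs_mult mult_ac)
qed

lemma char_exp_exists:
  fixes b x :: "nat \<Rightarrow> real"
  assumes b: "\<And>i. b i \<ge> 0" and x: "\<And>i. x i \<ge> 0" and sm: "summable (\<lambda>i. b i * x i)"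
  shows "\<exists>\<rho>. real_distribution \<rho> \<and>
           (\<forall>t. char \<rho> t = exp (\<Sum>i. of_real (b i) * (iexp (t * x i) - 1)))"
proof -
  define D where "D i = scaled_poisson (b i) (x i)" for i
  define P where "P = PiM UNIV D"
  have D: "real_distribution (D i)" for i by (simp add: D_def)
  interpret D: real_distribution "D i" for i by (rule D)
  interpret DD: product_prob_space D UNIV ..
  interpret P: prob_space P unfolding P_def by (rule DD.prob_space_axioms)
  have setsP: "sets P = sets (PiM UNIV (\<lambda>_. borel))"
    unfolding P_def by (rule sets_PiM_cong) auto
  have coord [measurable]: "(\<lambda>\<omega>. \<omega> i) \<in> borel_measurable P" for i
    using measurable_component_singleton[of i UNIV "\<lambda>_. borel"] measurable_cong_sets[OF setsP refl] by blast
  have comp: "distr P borel (\<lambda>\<omega>. \<omega> i) = D i" for i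
  proof -
    have "distr P borel (\<lambda>\<omega>. \<omega> i) = distr P (D i) (\<lambda>\<omega>. \<omega> i)"
      by (rule distr_cong) auto
    then show ?thesis using DD.PiM_component[of i] by (simp add: P_def)
  qed
  \<comment> \<open>Independence amounts to the joint law being the product of the marginals; here
    the joint map is the identity and the product measure is the space itself.\<close>
  have ind: "P.indep_vars (\<lambda>_. borel) (\<lambda>i \<omega>. \<omega> i) UNIV"
  proof (subst P.indep_vars_iff_distr_eq_PiM')
    show "distr P (Pi\<^sub>M UNIV (\<lambda>_. borel)) (\<lambda>\<omega>. \<lambda>i\<in>UNIV. \<omega> i) = (\<Pi>\<^sub>M i\<in>UNIV. distr P borel (\<lambda>\<omega>. \<omega> i))"
      using distr_id2[OF setsP[symmetric]] unfolding comp restrict_UNIV by (simp only: P_def)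
  qed (use coord in auto)
  have AEnn: "AE \<omega> in P. \<forall>i. 0 \<le> \<omega> i"
  proof (subst AE_all_countable, intro allI)
    fix i
    have "AE y in distr P borel (\<lambda>\<omega>. \<omega> i). 0 \<le> y"
      unfolding comp D_def by (rule AE_scaled_poisson_nonneg[OF x])
    then show "AE \<omega> in P. 0 \<le> \<omega> i" by (rule AE_distrD[rotated]) auto
  qed
  have "(\<integral>\<^sup>+\<omega>. (\<Sum>i. ennreal (\<omega> i)) \<partial>P) = (\<Sum>i. \<integral>\<^sup>+\<omega>. ennreal (\<omega> i) \<partial>P)"
    by (rule nn_integral_suminf) measurable
  also have "\<dots> = (\<Sum>i. ennreal (b i * x i))"
  proof (rule suminf_cong)
    fix i
    have "(\<integral>\<^sup>+\<omega>. ennreal (\<omega> i) \<partial>P) = (\<integral>\<^sup>+y. ennreal y \<partial>distr P borel (\<lambda>\<omega>. \<omega> i))"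
      by (subst nn_integral_distr) auto
    also have "\<dots> = ennreal (b i * x i)"
      unfolding comp D_def by (rule nn_integral_scaled_poisson[OF b x])
    finally show "(\<integral>\<^sup>+\<omega>. ennreal (\<omega> i) \<partial>P) = ennreal (b i * x i)" .
  qed
  also have "\<dots> = ennreal (\<Sum>i. b i * x i)"
    using b x sm by (intro suminf_ennreal2) auto
  finally have "(\<integral>\<^sup>+\<omega>. (\<Sum>i. ennreal (\<omega> i)) \<partial>P) \<noteq> \<infinity>" by simp
  then have "AE \<omega> in P. (\<Sum>i. ennreal (\<omega> i)) \<noteq> \<infinity>"
    by (rule nn_integral_PInf_AE[rotated]) measurable
  with AEnn have AEs: "AE \<omega> in P. summable (\<lambda>i. \<omega> i)"
    by eventually_elim (auto intro!: summable_suminf_not_top)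
  define Y where "Y \<omega> = (\<Sum>i. \<omega> i)" for \<omega> :: "nat \<Rightarrow> real"
  have [measurable]: "Y \<in> borel_measurable P" unfolding Y_def by measurable
  define \<rho> where "\<rho> = distr P borel Y"
  have "real_distribution \<rho>"
    unfolding \<rho>_def by (intro real_distribution.intro P.prob_space_distr real_distribution_axioms.intro) auto
  moreover have "char \<rho> t = exp (\<Sum>i. of_real (b i) * (iexp (t * x i) - 1))" for t
  proof -
    have "(\<lambda>n. CLINT \<omega>|P. iexp (t * (\<Sum>i<n. \<omega> i))) \<longlonglongrightarrow> (CLINT \<omega>|P. iexp (t * Y \<omega>))"
    proof (rule integral_dominated_convergence[where w="\<lambda>_. 1"])
      show "AE \<omega> in P. (\<lambda>n. iexp (t * (\<Sum>i<n. \<omega> i))) \<longlonglongrightarrow> iexp (t * Y \<omega>)"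
        using AEs unfolding Y_def by eventually_elim (intro tendsto_intros summable_LIMSEQ)
    qed auto
    moreover have "(CLINT \<omega>|P. iexp (t * (\<Sum>i<n. \<omega> i))) = exp (\<Sum>i<n. of_real (b i) * (iexp (t * x i) - 1))" for n
    proof -
      have "(CLINT \<omega>|P. iexp (t * (\<Sum>i<n. \<omega> i))) = char (distr P borel (\<lambda>\<omega>. \<Sum>i<n. \<omega> i)) t"
        unfolding char_def by (subst integral_distr) auto
      also have "\<dots> = (\<Prod>i<n. char (distr P borel (\<lambda>\<omega>. \<omega> i)) t)"
        by (rule P.char_distr_sum) (rule P.indep_vars_subset[OF ind], simp)
      also have "\<dots> = (\<Prod>i<n. exp (of_real (b i) * (iexp (t * x i) - 1)))"
        unfolding comp D_def by (simp add: char_scaled_poisson b)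
      finally show ?thesis by (simp add: exp_sum)
    qed
    moreover have "(\<lambda>n. exp (\<Sum>i<n. of_real (b i) * (iexp (t * x i) - 1))) \<longlonglongrightarrow> exp (\<Sum>i. of_real (b i) * (iexp (t * x i) - 1))"
      by (intro tendsto_exp summable_LIMSEQ summable_exponent b x sm)
    ultimately have lim: "(\<lambda>n. CLINT \<omega>|P. iexp (t * (\<Sum>i<n. \<omega> i))) \<longlonglongrightarrow> (CLINT \<omega>|P. iexp (t * Y \<omega>))"
      and lim': "(\<lambda>n. CLINT \<omega>|P. iexp (t * (\<Sum>i<n. \<omega> i))) \<longlonglongrightarrow> exp (\<Sum>i. of_real (b i) * (iexp (t * x i) - 1))"
      by simp_all
    have "(CLINT \<omega>|P. iexp (t * Y \<omega>)) = exp (\<Sum>i. of_real (b i) * (iexp (t * x i) - 1))"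
      by (rule LIMSEQ_unique[OF lim lim'])
    then show ?thesis unfolding \<rho>_def char_def by (subst integral_distr) auto
  qed
  ultimately show ?thesis by blast
qed

text \<open>The convolution root of order n has the weights divided by n; they remain nonnegative,
  so \<open>char_exp_exists\<close> applies to them.\<close>

lemma infinitely_divisible_nonneg_exponent:
  fixes b x :: "nat \<Rightarrow> real"
  assumes b: "\<And>i. b i \<ge> 0" and x: "\<And>i. x i \<ge> 0" and sm: "summable (\<lambda>i. b i * x i)"
    and \<mu>: "real_distribution \<mu>"
    and ch: "\<And>t. char \<mu> t = exp (\<Sum>i. of_real (b i) * (iexp (t * x i) - 1))"
  shows "infinitely_divisible \<mu>"
  unfolding infinitely_divisible_def
proof (intro allI impI)
  fix n :: nat assume n: "n \<ge> 1"
  have "summable (\<lambda>i. b i * x i / real n)" by (intro summable_divide sm)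
  then have sm': "summable (\<lambda>i. b i / real n * x i)" by simp
  obtain \<rho> where \<rho>: "real_distribution \<rho>"
     "\<And>t. char \<rho> t = exp (\<Sum>i. of_real (b i / real n) * (iexp (t * x i) - 1))"
    using char_exp_exists[of "\<lambda>i. b i / real n" x] b x sm' by auto
  have "char \<mu> t = char (convolution_power n \<rho>) t" for t
  proof -
    have "summable (\<lambda>i. of_real (b i / real n) * (iexp (t * x i) - 1))"
      using b by (intro summable_exponent x sm') auto
    note suminf_mult[OF this, of "of_nat n"]
    then    have "of_nat n * (\<Sum>i. of_real (b i / real n) * (iexp (t * x i) - 1))
        = (\<Sum>i. of_real (b i) * (iexp (t * x i) - 1))"
      using n by simp
    then show ?thesis
      by (simp add: char_convolution_power[OF \<rho>(1)] \<rho>(2) ch exp_of_nat_mult [symmetric])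
  qed
  then have "\<mu> = convolution_power n \<rho>"
    by (intro Levy_uniqueness \<mu> real_distribution_convolution_power \<rho>) auto
  then show "\<exists>\<rho>. real_distribution \<rho> \<and> \<mu> = convolution_power n \<rho>" using \<rho> by blast
qed

section \<open>Atoms of signed Levy measures\<close>

text \<open>An integral over counting measure instead of an iterated series: the signed weights
  enter absolutely, any index type is allowed, and dominated convergence applies.\<close>

definition cp_exponent :: "('i \<Rightarrow> real) \<Rightarrow> ('i \<Rightarrow> real) \<Rightarrow> real \<Rightarrow> complex" where
  "cp_exponent b x t = (CLINT i|count_space UNIV. of_real (b i) * (iexp (t * x i) - 1))"

lemma integrable_cp_exponent:
  assumes "integrable (count_space UNIV) (\<lambda>i. b i * x i)"
  shows "integrable (count_space UNIV) (\<lambda>i. complex_of_real (b i) * (iexp (t * x i) - 1))"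
proof (rule Bochner_Integration.integrable_bound)
  show "integrable (count_space UNIV) (\<lambda>i. t * (b i * x i))"
    using assms by (rule integrable_mult_right)
  show "AE i in count_space UNIV. norm (complex_of_real (b i) * (iexp (t * x i) - 1)) \<le> norm (t * (b i * x i))"
    using mult_left_mono[OF iexp_minus_1_le, of "\<bar>b i\<bar>" "t * x i" for i]
    by (auto simp: norm_mult abs_mult mult_ac)
qed simp

lemma cp_exponent_0 [simp]: "cp_exponent b x 0 = 0"
  by (simp add: cp_exponent_def)

lemma cp_exponent_lipschitz:
  assumes "integrable (count_space UNIV) (\<lambda>i. b i * x i)"
  shows "cmod (cp_exponent b x s - cp_exponent b x t) \<le> \<bar>s - t\<bar> * (LINT i|count_space UNIV. \<bar>b i * x i\<bar>)"
proof -
  have "cp_exponent b x s - cp_exponent b x t =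
      (CLINT i|count_space UNIV. of_real (b i) * (iexp (s * x i) - 1) - of_real (b i) * (iexp (t * x i) - 1))"
    unfolding cp_exponent_def by (simp only: Bochner_Integration.integral_diff integrable_cp_exponent[OF assms])
  also have "cmod \<dots> \<le> (LINT i|count_space UNIV. \<bar>s - t\<bar> * \<bar>b i * x i\<bar>)"
  proof (rule order_trans[OF integral_norm_bound], rule integral_mono)
    show "integrable (count_space UNIV) (\<lambda>i. cmod (of_real (b i) * (iexp (s * x i) - 1) - of_real (b i) * (iexp (t * x i) - 1)))"
      by (rule integrable_norm, rule Bochner_Integration.integrable_diff) (rule integrable_cp_exponent[OF assms])+
    show "integrable (count_space UNIV) (\<lambda>i. \<bar>s - t\<bar> * \<bar>b i * x i\<bar>)"
      by (rule integrable_mult_right, rule integrable_abs, rule assms)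
    fix i
    have "of_real (b i) * (iexp (s * x i) - 1) - of_real (b i) * (iexp (t * x i) - 1)
       = of_real (b i) * (iexp (t * x i) * (iexp ((s - t) * x i) - 1))"
      by (simp add: algebra_simps flip: exp_add)
    also have "norm \<dots> \<le> \<bar>s - t\<bar> * \<bar>b i * x i\<bar>"
      using mult_left_mono[OF iexp_minus_1_le, of "\<bar>b i\<bar>" "(s - t) * x i"]
      by (simp add: norm_mult abs_mult mult_ac)
    finally show "norm (of_real (b i) * (iexp (s * x i) - 1) - of_real (b i) * (iexp (t * x i) - 1)) \<le> \<bar>s - t\<bar> * \<bar>b i * x i\<bar>" .
  qed
  finally show ?thesis by simp
qed

lemma continuous_cp_exponent:
  assumes "integrable (count_space UNIV) (\<lambda>i. b i * x i)"
  shows "continuous_on UNIV (cp_exponent b x)"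
proof (rule continuous_at_imp_continuous_on, rule ballI)
  fix t
  have "((\<lambda>s. cp_exponent b x s - cp_exponent b x t) \<longlongrightarrow> 0) (at t)"
  proof (rule Lim_null_comparison)
    show "eventually (\<lambda>s. cmod (cp_exponent b x s - cp_exponent b x t) \<le> \<bar>s - t\<bar> * (LINT i|count_space UNIV. \<bar>b i * x i\<bar>)) (at t)"
      by (intro always_eventually allI cp_exponent_lipschitz assms)
    show "((\<lambda>s. \<bar>s - t\<bar> * (LINT i|count_space UNIV. \<bar>b i * x i\<bar>)) \<longlongrightarrow> 0) (at t)"
      by (rule tendsto_eq_intros refl)+ simp
  qed
  then show "isCont (cp_exponent b x) t"
    unfolding isCont_def by (rule LIM_zero_cancel)
qed

text \<open>The quotient of the two sides is continuous with values in the finite set of roots of unity.\<close>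

lemma char_root_unique:
  assumes \<rho>: "real_distribution \<rho>" and n: "n > 0"
    and \<psi>: "continuous_on UNIV \<psi>" "\<psi> 0 = 0"
    and eq: "\<And>t. char \<rho> t ^ n = exp (\<psi> t)"
  shows "char \<rho> t = exp (\<psi> t / of_nat n)"
proof -
  interpret real_distribution \<rho> by fact
  define f where "f t = char \<rho> t / exp (\<psi> t / of_nat n)" for t
  have f1: "f t ^ n = 1" for t
    using n by (simp add: f_def power_divide eq flip: exp_of_nat_mult)
  have cont: "continuous_on UNIV f"
    unfolding f_def
  proof (intro continuous_on_divide continuous_on_exp continuous_on_const)
    show "continuous_on UNIV (char \<rho>)"
      by (intro continuous_at_imp_continuous_on ballI isCont_char)
  qed (use \<psi> n in auto)
  have "finite (f ` UNIV)"
    by (rule finite_subset[of _ "{z. z ^ n = 1}"]) (use f1 n in \<open>auto intro!: finite_roots_unity\<close>)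
  then have "f constant_on UNIV"
    using continuous_finite_range_constant[of UNIV f] cont by simp
  then have "f t = f 0" unfolding constant_on_def by auto
  also have "f 0 = 1" by (simp add: f_def char_zero \<psi>)
  finally show ?thesis by (simp add: f_def)
qed

lemma iexp_diff: "iexp ((a - b) * x) = iexp (a * x) * cnj (iexp (b * x))"
  by (simp add: exp_cnj left_diff_distrib exp_diff exp_minus divide_simps right_diff_distrib)

text \<open>Schoenberg's argument. The root of order n has the characteristic function
  exp(\<psi>/n), whose quadratic form is the integral of a squared modulus. The coefficients sum to
  zero, so constants drop out and n (exp(\<psi>/n) - 1) has a nonnegative form as well; it tends to
  \<psi>.\<close>

lemma infinitely_divisible_conditionally_positive:
  fixes F :: "'m set" and \<beta> :: "'m \<Rightarrow> complex" and s :: "'m \<Rightarrow> real"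
  assumes id: "infinitely_divisible \<mu>" and \<psi>: "continuous_on UNIV \<psi>" "\<psi> 0 = 0"
    and ch: "\<And>t. char \<mu> t = exp (\<psi> t)"
    and F: "finite F" "(\<Sum>m\<in>F. \<beta> m) = 0"
  shows "0 \<le> Re (\<Sum>m\<in>F. \<Sum>l\<in>F. \<beta> m * cnj (\<beta> l) * \<psi> (s m - s l))"
proof -
  let ?S = "\<lambda>f. \<Sum>m\<in>F. \<Sum>l\<in>F. \<beta> m * cnj (\<beta> l) * f (s m - s l)"
  have S0: "?S (\<lambda>_. c) = 0" for c
  proof -
    have "?S (\<lambda>_. c) = (\<Sum>m\<in>F. \<beta> m) * (\<Sum>l\<in>F. cnj (\<beta> l) * c)"
      by (simp only: sum_product mult.assoc)
    then show ?thesis using F by simp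
  qed
  have nonneg: "0 \<le> Re (?S (\<lambda>t. of_nat n * (exp (\<psi> t / of_nat n) - 1)))" if n1: "n \<ge> 1" for n
  proof -
    obtain \<rho> where \<rho>: "real_distribution \<rho>" "\<mu> = convolution_power n \<rho>"
      using id[unfolded infinitely_divisible_def, rule_format, OF n1] by (elim exE conjE) (rule that)
    interpret real_distribution \<rho> by fact
    have "char \<rho> t ^ n = exp (\<psi> t)" for t
      using ch[of t] char_convolution_power[OF \<rho>(1), of n t] by (simp only: \<rho>(2))
    then have ch\<rho>: "char \<rho> t = exp (\<psi> t / of_nat n)" for t
      using n1 by (intro char_root_unique[OF \<rho>(1) _ \<psi>]) auto
    have int: "integrable \<rho> (\<lambda>x. iexp (t * x))" for t
      by (rule integrable_iexp) auto
    have "?S (char \<rho>) = (CLINT x|\<rho>. (\<Sum>m\<in>F. \<Sum>l\<in>F. \<beta> m * cnj (\<beta> l) * iexp ((s m - s l) * x)))"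
      unfolding char_def
      by (subst Bochner_Integration.integral_sum, intro Bochner_Integration.integrable_sum integrable_mult_right int,
          subst Bochner_Integration.integral_sum, intro integrable_mult_right int)
         (simp only: integral_mult_right_zero)
    also have "\<dots> = (CLINT x|\<rho>. complex_of_real ((cmod (\<Sum>m\<in>F. \<beta> m * iexp (s m * x)))\<^sup>2))"
    proof (rule Bochner_Integration.integral_cong[OF refl])
      fix x
      have "(\<Sum>m\<in>F. \<Sum>l\<in>F. \<beta> m * cnj (\<beta> l) * iexp ((s m - s l) * x))
          = (\<Sum>m\<in>F. \<beta> m * iexp (s m * x)) * cnj (\<Sum>m\<in>F. \<beta> m * iexp (s m * x))"
        unfolding cnj_sum sum_product iexp_diff complex_cnj_mult by (simp only: mult_ac)
      then show "(\<Sum>m\<in>F. \<Sum>l\<in>F. \<beta> m * cnj (\<beta> l) * iexp ((s m - s l) * x))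
          = complex_of_real ((cmod (\<Sum>m\<in>F. \<beta> m * iexp (s m * x)))\<^sup>2)"
        by (simp only: complex_norm_square)
    qed
    also have "\<dots> = complex_of_real (LINT x|\<rho>. (cmod (\<Sum>m\<in>F. \<beta> m * iexp (s m * x)))\<^sup>2)"
      by (rule integral_complex_of_real)
    finally have "0 \<le> Re (?S (char \<rho>))" by simp
    moreover have "?S (\<lambda>t. of_nat n * (exp (\<psi> t / of_nat n) - 1)) = of_nat n * ?S (char \<rho>) - of_nat n * ?S (\<lambda>_. 1)"
      unfolding ch\<rho> sum_distrib_left sum_subtractf[symmetric]
      by (intro sum.cong refl) (simp add: algebra_simps)
    moreover have "0 \<le> Re X" if "0 \<le> Re z" "X = of_nat n * z - of_nat n * 0" for X z
      using that by simp
    ultimately show ?thesis unfolding S0 by blast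
  qed
  have lim: "(\<lambda>n. of_nat n * (exp (z / of_nat n) - 1)) \<longlonglongrightarrow> z" for z :: complex
  proof (cases "z = 0")
    case False
    have "((\<lambda>w. (exp w - 1) / w) \<longlongrightarrow> exp 0) (at (0::complex))"
      using DERIV_exp[of "0::complex"] unfolding has_field_derivative_iff by simp
    moreover have "filterlim (\<lambda>n. z / of_nat n) (at 0) sequentially"
      unfolding filterlim_at using False
      by (auto intro!: tendsto_divide_0[OF tendsto_const] tendsto_of_nat eventually_sequentiallyI[of 1])
    ultimately have "(\<lambda>n. (exp (z / of_nat n) - 1) / (z / of_nat n)) \<longlonglongrightarrow> exp 0"
      by (rule filterlim_compose)
    then have "(\<lambda>n. z * ((exp (z / of_nat n) - 1) / (z / of_nat n))) \<longlonglongrightarrow> z * exp 0"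
      by (intro tendsto_intros)
    then show ?thesis using False by (simp add: mult_ac)
  qed simp
  have "(\<lambda>n. Re (?S (\<lambda>t. of_nat n * (exp (\<psi> t / of_nat n) - 1)))) \<longlonglongrightarrow> Re (?S \<psi>)"
    by (intro tendsto_intros lim)
  then show ?thesis
    by (rule LIMSEQ_le_const) (use nonneg in auto)
qed

text \<open>In the quadratic form of the exponent the terms -1 add up to the squared modulus of the
  sum of the \<open>\<beta> m\<close>, which is zero. What remains is the integral of a squared
  trigonometric polynomial against the signed weights.\<close>

lemma cp_exponent_positive:
  fixes F :: "'m set" and \<beta> :: "'m \<Rightarrow> complex" and s :: "'m \<Rightarrow> real"
  assumes id: "infinitely_divisible \<mu>"
    and int: "integrable (count_space UNIV) (\<lambda>i. b i * x i)"
    and ch: "\<And>t. char \<mu> t = exp (cp_exponent b x t)"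
    and F: "finite F" "(\<Sum>m\<in>F. \<beta> m) = 0"
  shows "0 \<le> (LINT i|count_space UNIV. b i * (cmod (\<Sum>m\<in>F. \<beta> m * iexp (s m * x i)))\<^sup>2)"
proof -
  have "(\<Sum>m\<in>F. \<Sum>l\<in>F. \<beta> m * cnj (\<beta> l) * cp_exponent b x (s m - s l))
     = (CLINT i|count_space UNIV. (\<Sum>m\<in>F. \<Sum>l\<in>F. \<beta> m * cnj (\<beta> l) * (of_real (b i) * (iexp ((s m - s l) * x i) - 1))))"
    unfolding cp_exponent_def
    by (subst Bochner_Integration.integral_sum, intro Bochner_Integration.integrable_sum integrable_mult_right integrable_cp_exponent int,
        subst Bochner_Integration.integral_sum, intro integrable_mult_right integrable_cp_exponent int)
       (simp only: integral_mult_right_zero)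
  also have "\<dots> = (CLINT i|count_space UNIV. complex_of_real (b i * (cmod (\<Sum>m\<in>F. \<beta> m * iexp (s m * x i)))\<^sup>2))"
  proof (rule Bochner_Integration.integral_cong[OF refl])
    fix i
    have "(\<Sum>m\<in>F. \<Sum>l\<in>F. \<beta> m * cnj (\<beta> l) * (of_real (b i) * (iexp ((s m - s l) * x i) - 1)))
        = of_real (b i) * ((\<Sum>m\<in>F. \<beta> m * iexp (s m * x i)) * cnj (\<Sum>m\<in>F. \<beta> m * iexp (s m * x i))
             - (\<Sum>m\<in>F. \<beta> m) * cnj (\<Sum>m\<in>F. \<beta> m))"
    proof -
      have "\<beta> m * cnj (\<beta> l) * (of_real (b i) * (iexp ((s m - s l) * x i) - 1)) =
          of_real (b i) * ((\<beta> m * iexp (s m * x i)) * cnj (\<beta> l * iexp (s l * x i)) - \<beta> m * cnj (\<beta> l))" for m l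
        by (simp add: exp_cnj left_diff_distrib exp_diff exp_minus divide_simps right_diff_distrib mult_ac)
      then show ?thesis
        unfolding cnj_sum sum_product by (simp only: sum_subtractf[symmetric] sum_distrib_left)
    qed
    then show "(\<Sum>m\<in>F. \<Sum>l\<in>F. \<beta> m * cnj (\<beta> l) * (of_real (b i) * (iexp ((s m - s l) * x i) - 1)))
       = complex_of_real (b i * (cmod (\<Sum>m\<in>F. \<beta> m * iexp (s m * x i)))\<^sup>2)"
      by (simp only: F of_real_mult complex_norm_square[symmetric]) simp
  qed
  also have "\<dots> = complex_of_real (LINT i|count_space UNIV. b i * (cmod (\<Sum>m\<in>F. \<beta> m * iexp (s m * x i)))\<^sup>2)"
    by (rule integral_complex_of_real)
  finally show ?thesis
    using infinitely_divisible_conditionally_positive[OF id continuous_cp_exponent[OF int] _ ch F, of s] by simp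
qed

lemma geometric_mean_tendsto_0:
  fixes w :: complex
  assumes "cmod w = 1" "w \<noteq> 1"
  shows "(\<lambda>K. (\<Sum>j<K. w ^ j) / of_nat K) \<longlonglongrightarrow> 0"
proof (rule Lim_null_comparison[OF always_eventually])
  show "\<forall>K. cmod ((\<Sum>j<K. w ^ j) / of_nat K) \<le> 2 / cmod (w - 1) * inverse (real K)"
  proof
    fix K
    have "cmod (\<Sum>j<K. w ^ j) = cmod (w ^ K - 1) / cmod (w - 1)"
      using assms by (simp add: geometric_sum norm_divide)
    also have "\<dots> \<le> 2 / cmod (w - 1)"
      using norm_triangle_ineq4[of "w ^ K" 1] assms by (intro divide_right_mono) (auto simp: norm_power)
    finally show "cmod ((\<Sum>j<K. w ^ j) / of_nat K) \<le> 2 / cmod (w - 1) * inverse (real K)"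
      by (simp add: norm_divide divide_inverse mult_right_mono norm_mult norm_inverse)
  qed
  show "(\<lambda>K. 2 / cmod (w - 1) * inverse (real K)) \<longlonglongrightarrow> 0"
    by (intro tendsto_mult_right_zero lim_inverse_n)
qed

text \<open>Wiener's averaging isolates the mass at y: squared test polynomials converge to a
  multiple of the indicator of y. The point 0 has to be excluded because its mass does not
  contribute to the exponent.\<close>

lemma infinitely_divisible_atom_nonneg:
  fixes b x :: "'i::countable \<Rightarrow> real"
  assumes id: "infinitely_divisible \<mu>"
    and int: "integrable (count_space UNIV) (\<lambda>i. b i * x i)"
    and ch: "\<And>t. char \<mu> t = exp (cp_exponent b x t)"
    and y: "y \<noteq> 0"
  shows "0 \<le> (LINT i|count_space UNIV. b i * indicator {i. x i = y} i)"
proof -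
  \<comment> \<open>For \<open>x i = y\<close> the quotient takes the default value 0, which merely
    excludes \<open>\<delta> = 0\<close>.\<close>
  have "countable (range (\<lambda>(i, m). 2 * pi * real_of_int m / (x i - y)))"
    by (rule countable_image) simp
  then have "range (\<lambda>(i, m). 2 * pi * real_of_int m / (x i - y)) \<noteq> UNIV"
    using uncountable_UNIV_real by metis
  then obtain \<delta> where \<delta>: "\<And>i m. \<delta> \<noteq> 2 * pi * real_of_int m / (x i - y)"
    by (auto simp: set_eq_iff image_iff)
  \<comment> \<open>\<open>\<delta>\<close> separates \<open>y\<close> from the countably many other points: the means of the powers of \<open>w i\<close> vanish in the
    limit unless \<open>x i = y\<close>. The factor with \<open>s\<close> makes the test polynomial \<open>Q\<close> vanish at 0 but not at \<open>y\<close>.\<close>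
  define s where "s = pi / y"
  have sy: "iexp (s * y) = -1" using y by (simp add: s_def exp_eq_polar flip: of_real_mult)
  define w where "w i = iexp (\<delta> * (x i - y))" for i
  have w1: "w i \<noteq> 1" if "x i \<noteq> y" for i
  proof
    assume "w i = 1"
    then obtain m :: int where "\<delta> * (x i - y) = of_int (2 * m) * pi"
      by (auto simp: w_def exp_eq_1)
    with \<delta>[of m i] that show False by (simp add: field_simps)
  qed
  define Q where "Q K i = (\<Sum>j<K. w i ^ j) / of_nat K * (1 - iexp (s * x i))" for K i
  have nonneg: "0 \<le> (LINT i|count_space UNIV. b i * (cmod (Q K i))\<^sup>2)" for K
  proof -
    \<comment> \<open>The pairs expand the product that defines \<open>Q\<close>: j runs through the
      geometric mean, e through the two terms of 1 - iexp(s x). The latter have opposite signs, so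
      the coefficients cancel in pairs.\<close>
    let ?F = "{..<K} \<times> (UNIV :: bool set)"
    define \<beta> where "\<beta> = (\<lambda>(j, e). (if e then -1 else 1) * iexp (- real j * \<delta> * y) / of_nat K)"
    define t where "t = (\<lambda>(j, e). real j * \<delta> + (if e then s else 0))"
    have "Q K i = (\<Sum>m\<in>?F. \<beta> m * iexp (t m * x i))" for i
    proof -
      have "(\<Sum>m\<in>?F. \<beta> m * iexp (t m * x i)) = (\<Sum>j<K. \<Sum>e\<in>UNIV. \<beta> (j, e) * iexp (t (j, e) * x i))"
        by (simp add: sum.cartesian_product)
      also have "\<dots> = (\<Sum>j<K. w i ^ j / of_nat K * (1 - iexp (s * x i)))"
      proof (intro sum.cong refl)
        fix j
        have "iexp (- real j * \<delta> * y) * iexp (real j * \<delta> * x i) = w i ^ j"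
          unfolding w_def exp_of_nat_mult[symmetric] exp_add[symmetric]
          by (intro arg_cong[of _ _ exp]) (simp add: algebra_simps)
        moreover have "iexp ((real j * \<delta> + s) * x i) = iexp (real j * \<delta> * x i) * iexp (s * x i)"
          unfolding exp_add[symmetric] by (intro arg_cong[of _ _ exp]) (simp add: algebra_simps)
        ultimately show "(\<Sum>e\<in>UNIV. \<beta> (j, e) * iexp (t (j, e) * x i)) = w i ^ j / of_nat K * (1 - iexp (s * x i))"
          unfolding UNIV_bool \<beta>_def t_def by (simp add: ring_distribs del: of_real_mult of_real_add)
      qed
      also have "\<dots> = Q K i"
        unfolding Q_def by (simp only: sum_distrib_right sum_divide_distrib)
      finally show ?thesis by simp
    qed
    moreover have "(\<Sum>m\<in>?F. \<beta> m) = (\<Sum>j<K. \<Sum>e\<in>UNIV. \<beta> (j, e))"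
      by (simp add: sum.cartesian_product)
    then have "(\<Sum>m\<in>?F. \<beta> m) = 0"
      by (simp add: UNIV_bool \<beta>_def)
    ultimately show ?thesis
      using cp_exponent_positive[OF id int ch, of ?F \<beta> t] by simp
  qed
  have "(\<lambda>K. LINT i|count_space UNIV. b i * (cmod (Q K i))\<^sup>2) \<longlonglongrightarrow>
      (LINT i|count_space UNIV. b i * (4 * indicator {i. x i = y} i))"
  \<comment> \<open>At y the factor 1 - iexp(s y) is 2, hence the 4. For the majorant one factor of
    the squared modulus is bounded by 2 and the other by |s x|, because only weight times point is
    integrable.\<close>
  proof (rule integral_dominated_convergence[where w="\<lambda>i. 2 * \<bar>s\<bar> * \<bar>b i * x i\<bar>"])
    show "integrable (count_space UNIV) (\<lambda>i. 2 * \<bar>s\<bar> * \<bar>b i * x i\<bar>)"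
      by (intro integrable_mult_right integrable_abs int)
    show "AE i in count_space UNIV. (\<lambda>K. b i * (cmod (Q K i))\<^sup>2) \<longlonglongrightarrow> b i * (4 * indicator {i. x i = y} i)"
    proof (rule AE_I2, intro tendsto_mult tendsto_const)
      fix i
      show "(\<lambda>K. (cmod (Q K i))\<^sup>2) \<longlonglongrightarrow> 4 * indicator {i. x i = y} i"
      proof (cases "x i = y")
        case True
        have "Q K i = 2" if "K \<ge> 1" for K using that True sy by (simp add: Q_def w_def)
        then have "eventually (\<lambda>K. (cmod (Q K i))\<^sup>2 = 4 * indicator {i. x i = y} i) sequentially"
          using True by (intro eventually_sequentiallyI[of 1]) simp_all
        then show ?thesis by (rule tendsto_eventually)
      next
        case False
        have "(\<lambda>K. Q K i) \<longlonglongrightarrow> 0 * (1 - iexp (s * x i))"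
          unfolding Q_def using w1[OF False]
          by (intro tendsto_mult tendsto_const geometric_mean_tendsto_0) (simp_all add: w_def)
        then have "(\<lambda>K. (cmod (Q K i))\<^sup>2) \<longlonglongrightarrow> (cmod 0)\<^sup>2"
          by (intro tendsto_intros) simp
        then show ?thesis using False by simp
      qed
    qed
    show "AE i in count_space UNIV. norm (b i * (cmod (Q K i))\<^sup>2) \<le> 2 * \<bar>s\<bar> * \<bar>b i * x i\<bar>" for K
    proof (rule AE_I2)
      fix i
      have "cmod (\<Sum>j<K. w i ^ j) \<le> (\<Sum>j<K. cmod (w i ^ j))" by (rule norm_sum)
      also have "\<dots> = real K" by (simp add: norm_power w_def)
      finally have "cmod ((\<Sum>j<K. w i ^ j) / of_nat K) \<le> 1"
        by (cases "K = 0") (simp_all add: norm_divide)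
      then have *: "cmod (Q K i) \<le> cmod (1 - iexp (s * x i))"
        unfolding Q_def norm_mult by (rule mult_left_le_one_le[OF norm_ge_zero norm_ge_zero])
      have "cmod (1 - iexp (s * x i)) \<le> 2"
        using norm_triangle_ineq4[of 1 "iexp (s * x i)"] by simp
      moreover have "cmod (1 - iexp (s * x i)) \<le> \<bar>s * x i\<bar>"
        using iexp_minus_1_le[of "s * x i"] by (simp add: norm_minus_commute)
      ultimately have "(cmod (Q K i))\<^sup>2 \<le> 2 * \<bar>s * x i\<bar>"
        unfolding power2_eq_square using * by (intro mult_mono) auto
      from mult_left_mono[OF this, of "\<bar>b i\<bar>"]
      show "norm (b i * (cmod (Q K i))\<^sup>2) \<le> 2 * \<bar>s\<bar> * \<bar>b i * x i\<bar>"
        by (simp add: abs_mult mult_ac)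
    qed
  qed auto
  then have "0 \<le> (LINT i|count_space UNIV. b i * (4 * indicator {i. x i = y} i))"
    by (rule LIMSEQ_le_const) (use nonneg in auto)
  also have "(\<lambda>i. b i * (4 * indicator {i. x i = y} i)) = (\<lambda>i. 4 * (b i * indicator {i. x i = y} i))"
    by (simp add: fun_eq_iff)
  finally show ?thesis by simp
qed

section \<open>Weights on the points $j / c^n$\<close>

lemma double_suminf:
  fixes f :: "nat \<times> nat \<Rightarrow> 'a::{banach, second_countable_topology}"
  assumes "integrable (count_space UNIV) f"
  shows "(\<lambda>n. \<Sum>j. f (n, j)) sums (LINT i|count_space UNIV. f i)"
    and "summable (\<lambda>j. norm (f (n, j)))"
proof -
  interpret pair_sigma_finite "count_space (UNIV :: nat set)" "count_space (UNIV :: nat set)"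
    by (intro pair_sigma_finite.intro sigma_finite_measure_count_space_countable) auto
  have eq: "count_space (UNIV :: nat set) \<Otimes>\<^sub>M count_space (UNIV :: nat set) = count_space UNIV"
    by (subst pair_measure_countable) auto
  have int: "integrable (count_space UNIV \<Otimes>\<^sub>M count_space UNIV) f"
    unfolding eq by fact
  have 1: "integrable (count_space UNIV) (\<lambda>j. f (n, j))" for n
    using AE_integrable_fst'[OF int] by (simp add: AE_count_space)
  then show "summable (\<lambda>j. norm (f (n, j)))"
    by (simp add: integrable_count_space_nat_iff)
  have "(\<lambda>n. LINT j|count_space UNIV. f (n, j)) sums (LINT n|count_space UNIV. LINT j|count_space UNIV. f (n, j))"
    by (intro sums_integral_count_space_nat integrable_fst' int)
  then show "(\<lambda>n. \<Sum>j. f (n, j)) sums (LINT i|count_space UNIV. f i)"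
    using integral_fst'[OF int] 1 unfolding eq by (simp add: integral_count_space_nat)
qed

definition geom_points :: "real \<Rightarrow> nat \<times> nat \<Rightarrow> real" where
  "geom_points c = (\<lambda>(n, j). real j / c ^ n)"

text \<open>Repeating the same sequence on all levels from m on is what makes the exponent telescope
  under t -> t/c.\<close>

definition level_weights :: "(nat \<Rightarrow> real) \<Rightarrow> nat \<Rightarrow> nat \<times> nat \<Rightarrow> real" where
  "level_weights g m = (\<lambda>(n, j). if m \<le> n then g j else 0)"

definition lattice_exponent :: "(nat \<Rightarrow> real) \<Rightarrow> real \<Rightarrow> complex" where
  "lattice_exponent g t = (\<Sum>j. of_real (g j) * (iexp (t * real j) - 1))"

text \<open>Convergence over the levels comes from the factor c^(-n) of the points, not from the
  weights, which do not decay in n.\<close>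

lemma integrable_level_weights:
  assumes "c > 1" "summable (\<lambda>j. \<bar>g j\<bar> * real j)"
  shows "integrable (count_space UNIV) (\<lambda>i. level_weights g m i * geom_points c i)"
proof -
  have "Infinite_Set_Sum.abs_summable_on (\<lambda>n. inverse c ^ n) UNIV"
    unfolding abs_summable_on_nat_iff' norm_power
    using assms by (intro summable_geometric) (simp add: divide_simps)
  moreover have "Infinite_Set_Sum.abs_summable_on (\<lambda>j. g j * real j) UNIV"
    unfolding abs_summable_on_nat_iff' using assms by (simp add: abs_mult)
  ultimately
  have "Infinite_Set_Sum.abs_summable_on (\<lambda>(n, j). inverse c ^ n * (g j * real j)) (UNIV \<times> UNIV)"
    by (intro abs_summable_on_product) auto
  then have int: "integrable (count_space UNIV) (\<lambda>(n, j). inverse c ^ n * (g j * real j))"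
    by (simp add: Infinite_Set_Sum.abs_summable_on_def)
  show ?thesis
    by (rule Bochner_Integration.integrable_bound[OF int])
       (use assms in \<open>auto simp: level_weights_def geom_points_def abs_mult divide_simps power_inverse\<close>)
qed

text \<open>Replacing t by t/c moves every level one step up, so the difference of the two series is
  the contribution of the lowest level m.\<close>

lemma cp_exponent_level_weights:
  assumes "c > 1" "summable (\<lambda>j. \<bar>g j\<bar> * real j)"
  shows "cp_exponent (level_weights g m) (geom_points c) t - cp_exponent (level_weights g m) (geom_points c) (t / c)
    = lattice_exponent g (t / c ^ m)"
proof -
  have s: "(\<lambda>n. lattice_exponent g (t / c ^ (n + m))) sums cp_exponent (level_weights g m) (geom_points c) t" for t
  proof -
    have "(\<lambda>n. \<Sum>j. of_real (level_weights g m (n, j)) * (iexp (t * geom_points c (n, j)) - 1))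
       sums cp_exponent (level_weights g m) (geom_points c) t"
      unfolding cp_exponent_def
      by (rule double_suminf, rule integrable_cp_exponent, rule integrable_level_weights[OF assms])
    also have "(\<lambda>n. \<Sum>j. of_real (level_weights g m (n, j)) * (iexp (t * geom_points c (n, j)) - 1))
      = (\<lambda>n. if m \<le> n then lattice_exponent g (t / c ^ n) else 0)"
      by (auto simp: fun_eq_iff level_weights_def geom_points_def lattice_exponent_def)
    finally have "(\<lambda>n. if m \<le> n then lattice_exponent g (t / c ^ n) else 0)
        sums cp_exponent (level_weights g m) (geom_points c) t" .
    then show ?thesis
      using sums_iff_shift[of "\<lambda>n. if m \<le> n then lattice_exponent g (t / c ^ n) else 0" m] by simp
  qed
  have "(\<lambda>n. lattice_exponent g (t / c ^ (Suc n + m))) sums cp_exponent (level_weights g m) (geom_points c) (t / c)"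
    using s[of "t / c"] by (simp add: mult.assoc)
  then have "(\<lambda>n. lattice_exponent g (t / c ^ (n + m))) sums
      (cp_exponent (level_weights g m) (geom_points c) (t / c) + lattice_exponent g (t / c ^ m))"
    by (subst (asm) sums_Suc_iff) simp
  from sums_unique2[OF this s[of t]] show ?thesis by (simp add: algebra_simps)
qed

text \<open>Coefficients of $-\ln(1-zx)$; the junk value $1/0=0$ makes the coefficient at $j=0$ vanish.\<close>

definition log_weights :: "real \<Rightarrow> nat \<Rightarrow> real" where
  "log_weights z j = z ^ j / real j"

lemma summable_log_weights:
  assumes "\<bar>z\<bar> < 1"
  shows "summable (\<lambda>j. \<bar>log_weights z j\<bar> * real j)"
proof (rule summable_comparison_test')
  show "summable (\<lambda>j. \<bar>z\<bar> ^ j)" using assms by (simp add: summable_geometric_iff)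
qed (auto simp: log_weights_def power_abs)

lemma sums_log_weights:
  assumes "\<bar>z\<bar> < 1"
  shows "(\<lambda>j. of_real (log_weights z j) * (iexp (t * real j) - 1)) sums (Ln (1 - of_real z) - Ln (1 - of_real z * iexp t))"
proof -
  have *: "(\<lambda>j. w ^ j / of_nat j) sums (- Ln (1 - w))" if "cmod w < 1" for w
    using sums_minus[OF Ln_series'[of "- w"]] that by simp
  have "(\<lambda>j. (of_real z * iexp t) ^ j / of_nat j - of_real z ^ j / of_nat j) sums
     (- Ln (1 - of_real z * iexp t) - (- Ln (1 - of_real z)))"
    using assms by (intro sums_diff *) (simp_all add: norm_mult)
  also have "(\<lambda>j. (of_real z * iexp t) ^ j / of_nat j - of_real z ^ j / of_nat j)
     = (\<lambda>j. of_real (log_weights z j) * (iexp (t * real j) - 1))"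
    by (simp add: fun_eq_iff log_weights_def power_mult_distrib right_diff_distrib mult_ac flip: exp_of_nat_mult)
  finally show ?thesis by simp
qed

text \<open>For 0 <= z < 1 this is the characteristic function of a geometric law; for z = -a with 0
  < a < 1 it is the reciprocal of that of the law on 0 and 1 with masses 1/(1+a) and
  a/(1+a).\<close>

lemma exp_lattice_exponent_log_weights:
  assumes "\<bar>z\<bar> < 1"
  shows "exp (lattice_exponent (log_weights z) t) = (1 - of_real z) / (1 - of_real z * iexp t)"
proof -
  have "of_real z * iexp t \<noteq> 1" "of_real z \<noteq> (1::complex)"
    using assms by (auto dest!: arg_cong[where f = cmod] simp: norm_mult)
  moreover have "lattice_exponent (log_weights z) t = Ln (1 - of_real z) - Ln (1 - of_real z * iexp t)"
    unfolding lattice_exponent_def using sums_log_weights[OF assms] by (rule sums_unique[symmetric])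
  ultimately show ?thesis by (simp add: exp_diff)
qed

text \<open>Under $c^l = 2$ this moves the even multiples $l$ levels down.\<close>

lemma lattice_exponent_log_weights_square:
  assumes "\<bar>z\<bar> < 1"
  shows "lattice_exponent (log_weights (z\<^sup>2)) (2 * t) =
    lattice_exponent (log_weights z) t + lattice_exponent (log_weights (- z)) t"
proof -
  let ?f = "\<lambda>j. of_real (log_weights z j + log_weights (- z) j) * (iexp (t * real j) - 1)"
  have "lattice_exponent (log_weights (z\<^sup>2)) (2 * t) = (\<Sum>j. ?f (2 * j))"
    unfolding lattice_exponent_def
  proof (intro suminf_cong)
    fix j
    have "z ^ (2 * j) = (z\<^sup>2) ^ j" "(- z) ^ (2 * j) = (z\<^sup>2) ^ j"
      by (simp_all only: power_mult power2_minus)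
    then have "log_weights (z\<^sup>2) j = log_weights z (2 * j) + log_weights (- z) (2 * j)"
      by (simp add: log_weights_def field_simps)
    then show "of_real (log_weights (z\<^sup>2) j) * (iexp (2 * t * real j) - 1) = ?f (2 * j)"
      by (simp add: mult_ac)
  qed
  also have "\<dots> = suminf ?f"
  proof (rule suminf_mono_reindex)
    fix n :: nat assume "n \<notin> range ((*) 2)"
    then have "odd n" by auto
    then show "?f n = 0" by (simp add: log_weights_def)
  qed (auto simp: strict_mono_def)
  also have "\<dots> = lattice_exponent (log_weights z) t + lattice_exponent (log_weights (- z)) t"
    unfolding lattice_exponent_def of_real_add ring_distribs(2)
    using sums_log_weights[of z t] sums_log_weights[of "-z" t] assms
    by (intro suminf_add[symmetric]) (auto simp: sums_iff)
  finally show ?thesis .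
qed

section \<open>From the functional equation to the signed exponent\<close>

text \<open>The quotient of \<phi> and exp \<psi> is invariant under t -> t/c, so continuity at 0
  makes it constant. No logarithm of \<phi> has to be chosen.\<close>

lemma eq_exp_of_scaling:
  fixes \<phi> \<psi> :: "real \<Rightarrow> complex"
  assumes c: "c > 1" and \<phi>: "isCont \<phi> 0" "\<phi> 0 = 1" and \<psi>: "isCont \<psi> 0" "\<psi> 0 = 0"
    and eq: "\<And>t. \<phi> t = \<phi> (t / c) * exp (\<psi> t - \<psi> (t / c))"
  shows "\<phi> t = exp (\<psi> t)"
proof -
  define f where "f t = \<phi> t * exp (- \<psi> t)" for t
  have "f t = f (t / c)" for t
    unfolding f_def by (subst eq[of t]) (simp add: exp_diff exp_minus divide_simps)
  then have *: "f (t / c ^ n) = f t" for n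
    by (induction n) (simp_all, metis divide_divide_eq_left mult.commute)
  have "isCont f 0" unfolding f_def using \<phi> \<psi> by (intro continuous_intros)
  moreover have "(\<lambda>n. t / c ^ n) \<longlonglongrightarrow> 0"
    using c LIMSEQ_divide_realpow_zero by blast
  ultimately have "(\<lambda>n. f (t / c ^ n)) \<longlonglongrightarrow> f 0"
    by (rule isCont_tendsto_compose)
  then have "f t = f 0" unfolding * by (simp add: LIMSEQ_const_iff)
  then show ?thesis by (simp add: f_def \<phi> \<psi> exp_minus divide_simps)
qed

lemma cp_exponent_add:
  assumes "integrable (count_space UNIV) (\<lambda>i. b1 i * x i)" "integrable (count_space UNIV) (\<lambda>i. b2 i * x i)"
  shows "cp_exponent (\<lambda>i. b1 i + b2 i) x t = cp_exponent b1 x t + cp_exponent b2 x t"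
  unfolding cp_exponent_def of_real_add ring_distribs(2)
  by (intro Bochner_Integration.integral_add integrable_cp_exponent assms)

lemma infinitely_divisible_cp_exponent:
  fixes b x :: "nat \<times> nat \<Rightarrow> real"
  assumes \<mu>: "real_distribution \<mu>"
    and int: "integrable (count_space UNIV) (\<lambda>i. b i * x i)"
    and ch: "\<And>t. char \<mu> t = exp (cp_exponent b x t)"
    and nonneg: "\<And>i. 0 \<le> b i" "\<And>i. 0 \<le> x i"
  shows "infinitely_divisible \<mu>"
proof (rule infinitely_divisible_nonneg_exponent[OF _ _ _ \<mu>])
  have bij: "bij_betw prod_decode UNIV UNIV" by (rule bij_prod_decode)
  have "integrable (count_space UNIV) (\<lambda>i. b (prod_decode i) * x (prod_decode i))"
    using integrable_bij_count_space[OF bij, of "\<lambda>i. b i * x i"] int by simp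
  then show sm: "summable (\<lambda>i. b (prod_decode i) * x (prod_decode i))"
    by (simp add: integrable_count_space_nat_iff summable_norm_cancel)
  fix t
  let ?f = "\<lambda>i. of_real (b i) * (iexp (t * x i) - 1)"
  have "integrable (count_space UNIV) ?f"
    by (rule integrable_cp_exponent[OF int])
  then have "integrable (count_space UNIV) (\<lambda>i. ?f (prod_decode i))"
    using integrable_bij_count_space[OF bij, of ?f] by simp
  then have "(\<Sum>i. ?f (prod_decode i)) = cp_exponent b x t"
    unfolding cp_exponent_def using integral_bij_count_space[OF bij, of ?f]
    by (simp add: integral_count_space_nat)
  then show "char \<mu> t = exp (\<Sum>i. of_real (b (prod_decode i)) * (iexp (t * x (prod_decode i)) - 1))"
    using ch by simp
qed (use nonneg in auto)

text \<open>The contribution of the two-point factor may be distributed over two sequences with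
  different lowest levels: \<open>h\<close> starting at level k and \<open>e\<close> starting at
  level m. With \<open>e\<close> zero this is the plain expansion; in the case c^l = 2 it allows the
  even multiples to start at level k - l.\<close>

lemma char_eq_exp_level_weights:
  fixes c p q r :: real and k m :: nat
  assumes \<phi>: "isCont \<phi> 0" "\<phi> 0 = 1"
    and c: "c > 1" and pqr: "0 \<le> q" "0 < r" "r < p" "p + q + r = 1"
    and fe: "\<And>t. (1 - q * iexp t) * \<phi> t = (p + r * iexp (t / c ^ k)) * \<phi> (t / c)"
    and sm: "summable (\<lambda>j. \<bar>h j\<bar> * real j)" "summable (\<lambda>j. \<bar>e j\<bar> * real j)"
    and he: "\<And>t. lattice_exponent h (t / c ^ k) + lattice_exponent e (t / c ^ m) =
               - lattice_exponent (log_weights (- (r / p))) (t / c ^ k)"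
  defines "b \<equiv> \<lambda>i. level_weights (log_weights q) 0 i + level_weights h k i + level_weights e m i"
  shows "integrable (count_space UNIV) (\<lambda>i. b i * geom_points c i)"
    and "\<phi> t = exp (cp_exponent b (geom_points c) t)"
proof -
  have q: "\<bar>q\<bar> < 1" and a: "\<bar>- (r / p)\<bar> < 1" using pqr by (auto simp: field_simps)
  have i1: "integrable (count_space UNIV) (\<lambda>i. level_weights (log_weights q) 0 i * geom_points c i)"
    and i2: "integrable (count_space UNIV) (\<lambda>i. level_weights h k i * geom_points c i)"
    and i3: "integrable (count_space UNIV) (\<lambda>i. level_weights e m i * geom_points c i)"
    by (intro integrable_level_weights c summable_log_weights q sm)+
  have i12: "integrable (count_space UNIV) (\<lambda>i. (level_weights (log_weights q) 0 i + level_weights h k i) * geom_points c i)"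
    using Bochner_Integration.integrable_add[OF i1 i2] by (simp add: ring_distribs)
  show int: "integrable (count_space UNIV) (\<lambda>i. b i * geom_points c i)"
    using Bochner_Integration.integrable_add[OF i12 i3] by (simp add: ring_distribs b_def)
  show "\<phi> t = exp (cp_exponent b (geom_points c) t)"
  proof (rule eq_exp_of_scaling[OF c \<phi>])
    show "isCont (cp_exponent b (geom_points c)) 0"
      using continuous_cp_exponent[OF int] by (simp add: continuous_on_eq_continuous_at)
    fix t
    have "cp_exponent b (geom_points c) t - cp_exponent b (geom_points c) (t / c) =
       lattice_exponent (log_weights q) (t / c ^ 0) + lattice_exponent h (t / c ^ k) + lattice_exponent e (t / c ^ m)"
      unfolding b_def cp_exponent_add[OF i1 i2] cp_exponent_add[OF i12 i3]
      using cp_exponent_level_weights[OF c summable_log_weights[OF q], of 0 t]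
        cp_exponent_level_weights[OF c sm(1), of k t] cp_exponent_level_weights[OF c sm(2), of m t]
      by (simp add: algebra_simps)
    also have "\<dots> = lattice_exponent (log_weights q) t - lattice_exponent (log_weights (- (r / p))) (t / c ^ k)"
      using he[of t] by simp
    also have "exp \<dots> = (1 - q) / (1 - q * iexp t) * ((1 + r / p * iexp (t / c ^ k)) / (1 + r / p))"
      unfolding exp_diff exp_lattice_exponent_log_weights[OF q] exp_lattice_exponent_log_weights[OF a]
      by simp
    also have "\<dots> = (p + r * iexp (t / c ^ k)) / (1 - q * iexp t)"
    proof -
      \<comment> \<open>Since p + r = p (1 + r/p), the normalizing constants of the geometric and
        the two-point factor combine to p.\<close>
      have 1: "1 - q = p + r" using pqr by simp
      have "complex_of_real (1 - q) * (1 + r / p * iexp (t / c ^ k)) / (1 + r / p) = p + r * iexp (t / c ^ k)"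
      proof -
        have nz: "complex_of_real p \<noteq> 0" "complex_of_real (p + r) \<noteq> 0" using pqr by (simp_all flip: of_real_add)
        have "1 + complex_of_real (r / p) = complex_of_real (p + r) / p"
          using nz by (simp add: divide_simps)
        then show ?thesis
          unfolding 1 using nz by (simp add: divide_simps ring_distribs del: of_real_add)
      qed
      then show ?thesis by (simp add: divide_simps)
    qed
    finally have "exp (cp_exponent b (geom_points c) t - cp_exponent b (geom_points c) (t / c))
      = (p + r * iexp (t / c ^ k)) / (1 - q * iexp t)" .
    moreover have "1 - q * iexp t \<noteq> 0"
      using q by (auto dest!: arg_cong[where f = cmod] simp: norm_mult)
    ultimately show "\<phi> t = \<phi> (t / c) * exp (cp_exponent b (geom_points c) t - cp_exponent b (geom_points c) (t / c))"
      using fe[of t] by (simp only: mult.commute[of "\<phi> (t / c)"] times_divide_eq_left) (simp add: eq_divide_eq mult_ac)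
  qed simp
qed

lemma char_eq_exp_log_weights:
  fixes c p q r :: real and k :: nat
  assumes \<mu>: "real_distribution \<mu>"
    and c: "c > 1" and pqr: "0 \<le> q" "0 < r" "r < p" "p + q + r = 1"
    and fe: "\<And>t. (1 - q * iexp t) * char \<mu> t = (p + r * iexp (t / c ^ k)) * char \<mu> (t / c)"
  defines "b \<equiv> \<lambda>i. level_weights (log_weights q) 0 i + level_weights (\<lambda>j. - log_weights (- (r / p)) j) k i"
  shows "integrable (count_space UNIV) (\<lambda>i. b i * geom_points c i)"
    and "char \<mu> t = exp (cp_exponent b (geom_points c) t)"
proof -
  interpret real_distribution \<mu> by fact
  define a where "a = r / p"
  have "0 < p" using pqr by simp
  then have a: "0 < a" "a < 1" using pqr(1-3) by (simp_all add: a_def)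
  let ?h = "\<lambda>j. - log_weights (- a) j"
  have b: "b = (\<lambda>i. level_weights (log_weights q) 0 i + level_weights ?h k i + level_weights (\<lambda>_. 0) 0 i)"
    by (auto simp: fun_eq_iff b_def a_def level_weights_def)
  have "summable (\<lambda>j. \<bar>?h j\<bar> * real j)"
    using summable_log_weights[of "- a"] a by simp
  moreover have "lattice_exponent ?h (t / c ^ k) + lattice_exponent (\<lambda>_. 0) (t / c ^ 0)
      = - lattice_exponent (log_weights (- (r / p))) (t / c ^ k)" for t
    using sums_minus[OF sums_log_weights[of "- a" "t / c ^ k"]] sums_log_weights[of "- a" "t / c ^ k"] a
    unfolding lattice_exponent_def a_def by (simp add: sums_iff)
  ultimately show "integrable (count_space UNIV) (\<lambda>i. b i * geom_points c i)"
      "char \<mu> t = exp (cp_exponent b (geom_points c) t)"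
    unfolding b using char_eq_exp_level_weights[OF isCont_char char_zero c pqr fe, of ?h "\<lambda>_. 0" 0] by simp_all
qed

section \<open>Sufficiency of (a) and of (b)\<close>

text \<open>The condition says that a = r/p is at most q, so q^j dominates (-a)^j at every
  j.\<close>

lemma infinitely_divisible_if_le:
  fixes c p q r :: real
  assumes \<mu>: "real_distribution \<mu>"
    and c: "c > 1" and pqr: "0 \<le> q" "0 < r" "r < p" "p + q + r = 1"
    and fe: "\<And>t. (1 - q * iexp t) * char \<mu> t = (p + r * iexp (t / c ^ k)) * char \<mu> (t / c)"
    and le: "r \<le> p * q"
  shows "infinitely_divisible \<mu>"
proof -
  define a where "a = r / p"
  have "0 < p" using pqr by simp
  then have a: "0 < a" "a < 1" "a \<le> q" using pqr(1-3) le by (simp_all add: a_def divide_le_eq mult.commute)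
  let ?b = "\<lambda>i. level_weights (log_weights q) 0 i + level_weights (\<lambda>j. - log_weights (- a) j) k i"
  note rep = char_eq_exp_log_weights[OF \<mu> c pqr fe, folded a_def]
  show ?thesis
  proof (rule infinitely_divisible_cp_exponent[OF \<mu> rep])
    fix i :: "nat \<times> nat"
    obtain n j where i: "i = (n, j)" by (cases i)
    have "(- a) ^ j \<le> \<bar>- a\<bar> ^ j" using abs_ge_self[of "(- a) ^ j"] by (simp add: power_abs)
    also have "\<dots> \<le> q ^ j" using a by (intro power_mono) auto
    finally have "0 \<le> (q ^ j - (- a) ^ j) / real j" by simp
    moreover have "0 \<le> q ^ j / real j" using pqr by simp
    ultimately show "0 \<le> ?b i"
      by (auto simp: level_weights_def i log_weights_def diff_divide_distrib)
    show "0 \<le> geom_points c i" using c by (simp add: geom_points_def i)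
  qed
qed

text \<open>The exponent is rewritten with different weights on the same points, all of which are
  nonnegative when a = r/p satisfies a^2 <= q: the even part, started at level k - l, then costs
  a^(2j)/(2j) against q^j/j.\<close>

lemma infinitely_divisible_if_power_eq_2:
  fixes c p q r :: real
  assumes \<mu>: "real_distribution \<mu>"
    and c: "c > 1" and pqr: "0 \<le> q" "0 < r" "r < p" "p + q + r = 1"
    and fe: "\<And>t. (1 - q * iexp t) * char \<mu> t = (p + r * iexp (t / c ^ k)) * char \<mu> (t / c)"
    and l: "l \<le> k" "c ^ l = 2" and le: "r\<^sup>2 \<le> p\<^sup>2 * q"
  shows "infinitely_divisible \<mu>"
proof -
  interpret real_distribution \<mu> by fact
  define a where "a = r / p"
  have "0 < p" using pqr by simp
  then have a: "0 < a" "a < 1" "a\<^sup>2 \<le> q" using pqr(1-3) le by (simp_all add: a_def power_divide divide_le_eq mult.commute)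
  have a': "\<bar>a\<bar> < 1" "\<bar>- a\<bar> < 1" "\<bar>a\<^sup>2\<bar> < 1" using a by (auto simp: power_less_one_iff)
  \<comment> \<open>The weights -(-a)^j/j split into an odd part \<open>?h\<close>, which is
    nonnegative, and an even part, minus half the sum of \<open>log_weights a\<close> and
    \<open>log_weights (- a)\<close>. By \<open>lattice_exponent_log_weights_square\<close> the even
    part is the exponent of \<open>?e\<close> at twice the frequency, and doubling the frequency of
    level k leads to level k - l.\<close>
  let ?h = "\<lambda>j. (log_weights a j - log_weights (- a) j) / 2"
  let ?e = "\<lambda>j. - log_weights (a\<^sup>2) j / 2"
  let ?b = "\<lambda>i. level_weights (log_weights q) 0 i + level_weights ?h k i + level_weights ?e (k - l) i"
  have "summable (\<lambda>j. \<bar>?h j\<bar> * real j)"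
  proof (rule summable_comparison_test')
    show "summable (\<lambda>j. \<bar>log_weights a j\<bar> * real j + \<bar>log_weights (- a) j\<bar> * real j)"
      by (intro summable_add summable_log_weights a')
    show "norm (\<bar>?h j\<bar> * real j) \<le> \<bar>log_weights a j\<bar> * real j + \<bar>log_weights (- a) j\<bar> * real j" for j
    proof -
      have "\<bar>?h j\<bar> \<le> \<bar>log_weights a j\<bar> + \<bar>log_weights (- a) j\<bar>" 
        using abs_triangle_ineq4[of "log_weights a j" "log_weights (- a) j"] unfolding abs_divide by simp
      from mult_right_mono[OF this, of "real j"] show ?thesis by (simp add: ring_distribs)
    qed
  qed
  moreover have "summable (\<lambda>j. \<bar>?e j\<bar> * real j)"
    using summable_divide[OF summable_log_weights[OF a'(3)], of 2] by simp
  moreover have "lattice_exponent ?h (t / c ^ k) + lattice_exponent ?e (t / c ^ (k - l))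
      = - lattice_exponent (log_weights (- (r / p))) (t / c ^ k)" for t
  proof -
    let ?s = "t / c ^ k"
    have s: "t / c ^ (k - l) = 2 * ?s"
      using l c by (simp add: power_diff)
    have L: "(\<lambda>j. of_real (log_weights z j) * (iexp (t * real j) - 1)) sums lattice_exponent (log_weights z) t"
      if "\<bar>z\<bar> < 1" for z t
      using sums_log_weights[OF that, of t] by (simp add: lattice_exponent_def sums_iff)
    have "(\<lambda>j. (of_real (log_weights a j) * (iexp (?s * real j) - 1) - of_real (log_weights (- a) j) * (iexp (?s * real j) - 1)) / 2) sums
        ((lattice_exponent (log_weights a) ?s - lattice_exponent (log_weights (- a)) ?s) / 2)"
      by (intro sums_divide sums_diff L a')
    then have "(\<lambda>j. of_real (?h j) * (iexp (?s * real j) - 1)) sums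
        ((lattice_exponent (log_weights a) ?s - lattice_exponent (log_weights (- a)) ?s) / 2)"
      by (simp add: left_diff_distrib diff_divide_distrib)
    then have e1: "lattice_exponent ?h ?s =
       (lattice_exponent (log_weights a) ?s - lattice_exponent (log_weights (- a)) ?s) / 2"
      unfolding lattice_exponent_def[of ?h] by (rule sums_unique[symmetric])
    have "(\<lambda>j. - (of_real (log_weights (a\<^sup>2) j) * (iexp (2 * ?s * real j) - 1)) / 2) sums
        (- lattice_exponent (log_weights (a\<^sup>2)) (2 * ?s) / 2)"
      by (intro sums_divide sums_minus L a')
    then have "(\<lambda>j. of_real (?e j) * (iexp (2 * ?s * real j) - 1)) sums
        (- lattice_exponent (log_weights (a\<^sup>2)) (2 * ?s) / 2)"
      by simp
    then have e2: "lattice_exponent ?e (2 * ?s) = - lattice_exponent (log_weights (a\<^sup>2)) (2 * ?s) / 2"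
      unfolding lattice_exponent_def[of ?e] by (rule sums_unique[symmetric])
    show ?thesis
      unfolding s a_def[symmetric] e1 e2 lattice_exponent_log_weights_square[OF a'(1)] by (simp add: field_simps)
  qed
  ultimately have rep: "integrable (count_space UNIV) (\<lambda>i. ?b i * geom_points c i)"
      "\<And>t. char \<mu> t = exp (cp_exponent ?b (geom_points c) t)"
    using char_eq_exp_level_weights[OF isCont_char char_zero c pqr fe, of ?h ?e "k - l"] by simp_all
  show ?thesis
  proof (rule infinitely_divisible_cp_exponent[OF \<mu> rep])
    fix i :: "nat \<times> nat"
    obtain n j where i: "i = (n, j)" by (cases i)
    have "(a\<^sup>2) ^ j \<le> q ^ j" using a by (intro power_mono) auto
    moreover have "0 \<le> q ^ j" using pqr by simp
    ultimately have "(a\<^sup>2) ^ j \<le> 2 * q ^ j" by linarith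
    then have "0 \<le> (q ^ j - (a\<^sup>2) ^ j / 2) / real j" by simp
    moreover have "0 \<le> q ^ j / real j" using pqr by simp
    moreover have "(- a) ^ j \<le> a ^ j" using abs_ge_self[of "(- a) ^ j"] a by (simp add: power_abs)
    then have "0 \<le> (a ^ j - (- a) ^ j) / real j" by simp
    ultimately show "0 \<le> ?b i"
      by (auto simp: level_weights_def i log_weights_def diff_divide_distrib)
    show "0 \<le> geom_points c i" using c by (simp add: geom_points_def i)
  qed
qed

section \<open>Necessity: a negative atom at \<open>2 * real P / c ^ k\<close>\<close>

text \<open>An irrational C admits no solution. If C = A/B, then j A = 2 P B, so a prime P > A
  divides j, and j < 2P leaves j = P. Applied to C = c^l, a point of a lower level can meet 2P/c^k
  only if c^l = 2.\<close>

lemma eventually_prime_multiple: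
  fixes C :: real
  assumes "C > 1"
  shows "eventually (\<lambda>P. prime P \<longrightarrow> (\<forall>j. real j * C = 2 * real P \<longrightarrow> j = P)) sequentially"
proof (cases "C \<in> \<rat>")
  case True
  then obtain A B :: nat where AB: "B \<noteq> 0" "\<bar>C\<bar> = real A / real B"
    by (rule Rats_abs_nat_div_natE)
  then have C: "C = real A / real B" and A: "A > 0" using assms by (auto intro!: gr0I)
  show ?thesis
  proof (rule eventually_sequentiallyI[of "Suc A"], intro impI allI)
    fix P j :: nat assume P: "Suc A \<le> P" "prime P" and j: "real j * C = 2 * real P"
    have "real (j * A) = real (2 * P * B)" using j AB C by (simp add: field_simps)
    then have "j * A = 2 * P * B" by (simp only: of_nat_eq_iff)
    then have "P dvd j * A" by simp
    moreover have "\<not> P dvd A" using P A by (auto dest: dvd_imp_le)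
    ultimately have "P dvd j" using P by (auto simp: prime_dvd_mult_iff)
    then obtain m where m: "j = P * m" by (rule dvdE)
    have "P > 0" using P by (simp add: prime_gt_0_nat)
    with j have "j > 0" by (auto intro!: gr0I)
    with j assms have "real j < 2 * real P" by (metis mult.right_neutral mult_strict_left_mono of_nat_0_less_iff)
    then have "P * m < P * 2" unfolding m by (simp only: of_nat_less_iff[symmetric, where 'a=real] of_nat_mult of_nat_numeral mult.commute)
    then have "m < 2" by simp
    moreover have "m \<noteq> 0" using m \<open>j > 0\<close> by (auto intro!: gr0I)
    ultimately show "j = P" using m by simp
  qed
next
  case False
  show ?thesis
  proof (rule always_eventually, intro allI impI)
    fix P j :: nat assume "prime P" and j: "real j * C = 2 * real P"
    then have "j \<noteq> 0" using prime_gt_0_nat by (auto intro!: gr0I)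
    with j have "C = 2 * real P / real j" by (simp add: field_simps)
    also have "\<dots> \<in> \<rat>" by (intro Rats_divide Rats_mult) auto
    finally show "j = P" using False by simp
  qed
qed

text \<open>Meant for one level, which meets a given point at most once. The bound u may be
  negative: a level that misses the point therefore needs 0 <= u, whereas on level k some term
  attains the bound.\<close>

lemma suminf_le_unique_support:
  fixes f :: "nat \<Rightarrow> real"
  assumes "\<And>i j. f i \<noteq> 0 \<Longrightarrow> f j \<noteq> 0 \<Longrightarrow> i = j" "\<And>j. f j \<noteq> 0 \<Longrightarrow> f j \<le> u" "0 \<le> u \<or> (\<exists>j. f j = u)"
  shows "suminf f \<le> u"
proof (cases "\<exists>j. f j \<noteq> 0")
  case True
  then obtain j where j: "f j \<noteq> 0" by blast
  then have "f i = 0" if "i \<noteq> j" for i using assms(1) that by blast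
  then have "suminf f = f j" by (subst suminf_finite[of "{j}"]) auto
  with assms(2)[OF j] show ?thesis by simp
next
  case False
  then have "f = (\<lambda>_. 0)" by auto
  with assms(3) False show ?thesis by auto
qed

text \<open>With a = r/p the assumptions become a > q and, if some c^l is 2, also a^2 > q. Both the
  payment q^(2P) on level k and the payment q^P from below are then of smaller exponential order
  than a^(2P), so the atom is negative for large primes P.\<close>

lemma not_infinitely_divisible:
  fixes c p q r :: real and k :: nat
  assumes \<mu>: "real_distribution \<mu>"
    and c: "c > 1" and pqr: "0 \<le> q" "0 < r" "r < p" "p + q + r = 1"
    and fe: "\<And>t. (1 - q * iexp t) * char \<mu> t = (p + r * iexp (t / c ^ k)) * char \<mu> (t / c)"
    and id: "infinitely_divisible \<mu>"
    and gt: "p * q < r" and D: "(\<exists>l\<in>{1..k}. c ^ l = 2) \<Longrightarrow> p\<^sup>2 * q < r\<^sup>2"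
  shows False
proof -
  define a where "a = r / p"
  define D2 where "D2 = (\<exists>l\<in>{1..k}. c ^ l = 2)"
  have "0 < p" using pqr by simp
  then have a: "0 < a" "a < 1" "q < a" using pqr(1-3) gt by (simp_all add: a_def less_divide_eq mult.commute)
  have a2: "q < a\<^sup>2" if D2
    using D that \<open>0 < p\<close> by (simp add: D2_def a_def power_divide less_divide_eq mult.commute)
  define b where "b = (\<lambda>i. level_weights (log_weights q) 0 i + level_weights (\<lambda>j. - log_weights (- a) j) k i)"
  have int: "integrable (count_space UNIV) (\<lambda>i. b i * geom_points c i)"
    and ch: "\<And>t. char \<mu> t = exp (cp_exponent b (geom_points c) t)"
    unfolding b_def a_def by (rule char_eq_exp_log_weights[OF \<mu> c pqr fe])+
  \<comment> \<open>On level k + d the index is j = 2P c^d, at least 2P + 2P d (c - 1) by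
    Bernoulli's inequality. Hence a^j is at most a^(2P) times \<sigma>^(P d).\<close>
  define \<sigma> where "\<sigma> = a powr (2 * (c - 1))"
  have \<sigma>: "0 < \<sigma>" "\<sigma> < 1"
    using a c powr_less_mono2[of "2 * (c - 1)" a 1] by (simp_all add: \<sigma>_def)
  \<comment> \<open>An upper bound for the atom at 2P/c^k, with the levels below, at and above k in
    this order; the last term sums a geometric series over d >= 1.\<close>
  define E where "E P = (if D2 then q ^ P / real P else 0) + (q ^ (2 * P) - a ^ (2 * P)) / (2 * real P)
      + 2 * a ^ (2 * P) * (\<sigma> ^ P / (1 - \<sigma> ^ P))" for P
  have main: "0 \<le> E P" if P: "prime P" and
     mult: "\<And>l j. l \<in> {1..k} \<Longrightarrow> real j * c ^ l = 2 * real P \<Longrightarrow> j = P" for P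
  proof -
    have P0: "P > 0" using P by (simp add: prime_gt_0_nat)
    define y where "y = 2 * real P / c ^ k"
    have y: "y > 0" using P0 c by (simp add: y_def)
    define f where "f i = b i * indicator {i. geom_points c i = y} i" for i
    have nonneg: "0 \<le> (LINT i|count_space UNIV. f i)"
      unfolding f_def using y by (intro infinitely_divisible_atom_nonneg[OF id int ch]) auto
    \<comment> \<open>On the atom the point divided by y is 1, so integrability of weight times
      point yields integrability of the restricted weights.\<close>
    have intf: "integrable (count_space UNIV) f"
    proof (rule Bochner_Integration.integrable_bound)
      show "integrable (count_space UNIV) (\<lambda>i. b i * geom_points c i / y)"
        using int by simp
    qed (use y in \<open>auto simp: f_def indicator_def AE_count_space abs_mult\<close>)
    have sup: "real j * c ^ k = 2 * real P * c ^ n" if "f (n, j) \<noteq> 0" for n j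
      using that c by (auto simp: f_def geom_points_def y_def field_simps split: split_indicator_asm)
    have uniq: "i = j" if "f (n, i) \<noteq> 0" "f (n, j) \<noteq> 0" for n i j
    proof -
      have "real i * c ^ k = real j * c ^ k" using sup[OF that(1)] sup[OF that(2)] by simp
      then show ?thesis using c by simp
    qed
    \<comment> \<open>Below level k only j = P is possible, and only where the power of c is 2; on
      level k it is j = 2P, which carries the negative mass; above it a crude bound of both powers
      by a^j suffices.\<close>
    define U where "U n = (if n < k then (if c ^ (k - n) = 2 then q ^ P / real P else 0)
        else if n = k then (q ^ (2 * P) - a ^ (2 * P)) / (2 * real P)
        else 2 * a ^ (2 * P) * (\<sigma> ^ P) ^ (n - k))" for n
    have le: "(\<Sum>j. f (n, j)) \<le> U n" for n
    proof (rule suminf_le_unique_support)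
      fix i j assume "f (n, i) \<noteq> 0" "f (n, j) \<noteq> 0"
      then show "i = j" by (rule uniq)
    next
      consider "n < k" | "n = k" | "n > k" by linarith
      then have "(f (n, j) \<noteq> 0 \<longrightarrow> f (n, j) \<le> U n) \<and> (0 \<le> U n \<or> f (n, 2 * P) = U n)" for j
      proof cases
        case 1
        have "f (n, j) \<le> U n" if "f (n, j) \<noteq> 0"
        proof -
          have ck: "c ^ k = c ^ (k - n) * c ^ n" using 1 by (simp flip: power_add)
          have "real j * c ^ (k - n) = 2 * real P"
            using sup[OF that] c unfolding ck by simp
          moreover from this have "j = P" using mult[of "k - n" j] 1 by simp
          ultimately have "c ^ (k - n) = 2" using P0 by simp
          moreover have "f (n, j) \<le> b (n, j)" using pqr
            using 1 by (auto simp: f_def b_def level_weights_def log_weights_def split: split_indicator)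
          ultimately show ?thesis using 1 \<open>j = P\<close> by (simp add: U_def b_def level_weights_def log_weights_def)
        qed
        moreover have "0 \<le> U n" using 1 pqr by (simp add: U_def)
        ultimately show ?thesis by blast
      next
        case 2
        have "f (n, j) = U n" if "real j * c ^ k = 2 * real P * c ^ n" for j
        proof -
          have "real j = real (2 * P)" using that 2 c by simp
          then have j: "j = 2 * P" by (simp only: of_nat_eq_iff)
          have "(- a) ^ (2 * P) = a ^ (2 * P)" by (simp add: power_mult)
          then show ?thesis
            using 2 by (simp add: f_def geom_points_def y_def U_def b_def level_weights_def log_weights_def j diff_divide_distrib)
        qed
        with 2 sup[of n j] show ?thesis by auto
      next
        case 3
        have "f (n, j) \<le> U n" if nz: "f (n, j) \<noteq> 0"
        proof -
          define d where "d = n - k"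
          have n: "n = d + k" using 3 by (simp add: d_def)
          have j: "real j = 2 * real P * c ^ d"
            using sup[OF nz] c unfolding n power_add by simp
          then have "real j > 0" using c P0 by simp
          then have j1: "real j \<ge> 1" by simp
          have "f (n, j) = b (n, j)" using nz by (auto simp: f_def split: split_indicator_asm)
          also have "\<dots> = (q ^ j - (- a) ^ j) / real j"
            using 3 by (simp add: b_def level_weights_def log_weights_def diff_divide_distrib)
          also have "\<dots> \<le> 2 * a ^ j / real j"
          proof (rule divide_right_mono)
            have "- ((- a) ^ j) \<le> a ^ j" using abs_ge_minus_self[of "(- a) ^ j"] a by (simp add: power_abs)
            moreover have "q ^ j \<le> a ^ j" using a pqr by (intro power_mono) auto
            ultimately show "q ^ j - (- a) ^ j \<le> 2 * a ^ j" by linarith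
          qed simp
          also have "\<dots> \<le> 2 * a ^ j"
            using j1 a by (simp add: divide_le_eq mult_le_cancel_left1)
          also have "a ^ j = a powr real j" using a by (simp add: powr_realpow)
          also have "a powr real j \<le> a powr (2 * real P + real P * (real d * (2 * (c - 1))))"
          proof (rule powr_mono')
            have "1 + real d * (c - 1) \<le> c ^ d"
              using Bernoulli_inequality[of "c - 1" d] c by simp
            from mult_left_mono[OF this, of "2 * real P"]
            show "2 * real P + real P * (real d * (2 * (c - 1))) \<le> real j"
              unfolding j by (simp add: algebra_simps)
          qed (use a in auto)
          also have "\<dots> = a ^ (2 * P) * (\<sigma> ^ P) ^ d"
            using a \<sigma> powr_realpow[of a "2 * P"] unfolding powr_add
            by (simp add: \<sigma>_def powr_powr mult_ac flip: powr_realpow)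
          finally show ?thesis using 3 by (simp add: U_def d_def)
        qed
        moreover have "0 \<le> U n" using 3 a \<sigma> by (simp add: U_def)
        ultimately show ?thesis by blast
      qed
      then have 1: "\<And>j. f (n, j) \<noteq> 0 \<longrightarrow> f (n, j) \<le> U n" and 2: "0 \<le> U n \<or> f (n, 2 * P) = U n" by blast+
      show "0 \<le> U n \<or> (\<exists>j. f (n, j) = U n)" using 2 by blast
      fix j assume "f (n, j) \<noteq> 0"
      then show "f (n, j) \<le> U n" using 1 by blast
    qed
    have \<sigma>P: "0 < \<sigma> ^ P" "\<sigma> ^ P < 1" using \<sigma> P0 by (simp_all add: power_less_one_iff)
    have "(\<lambda>m. 2 * a ^ (2 * P) * (\<sigma> ^ P * (\<sigma> ^ P) ^ m)) sums (2 * a ^ (2 * P) * (\<sigma> ^ P * (1 / (1 - \<sigma> ^ P))))"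
      using \<sigma>P by (intro sums_mult geometric_sums) simp
    also have "(\<lambda>m. 2 * a ^ (2 * P) * (\<sigma> ^ P * (\<sigma> ^ P) ^ m)) = (\<lambda>m. U (m + Suc k))"
      by (simp add: fun_eq_iff U_def Suc_diff_le)
    finally have "U sums (2 * a ^ (2 * P) * (\<sigma> ^ P / (1 - \<sigma> ^ P)) + (\<Sum>n<Suc k. U n))"
      by (subst (asm) sums_iff_shift) (simp add: add.commute)
    then have "(LINT i|count_space UNIV. f i) \<le> 2 * a ^ (2 * P) * (\<sigma> ^ P / (1 - \<sigma> ^ P)) + (\<Sum>n<Suc k. U n)"
      by (rule sums_le[OF le double_suminf(1)[OF intf]])
    moreover have "(\<Sum>n<k. U n) \<le> (if D2 then q ^ P / real P else 0)"
    proof (cases D2)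
      case True
      then obtain l where l: "l \<in> {1..k}" "c ^ l = 2" by (auto simp: D2_def)
      \<comment> \<open>Distinct powers of c > 1 differ, so a single level below k
        contributes.\<close>
      have "c ^ (k - n) = 2 \<longleftrightarrow> n = k - l" if "n < k" for n
        using l that c power_inject_exp[of c "k - n" l] by auto
      then have "(\<Sum>n<k. U n) = (\<Sum>n<k. if n = k - l then q ^ P / real P else 0)"
        by (intro sum.cong refl) (simp add: U_def)
      also have "\<dots> = q ^ P / real P" using l by (simp add: sum.delta)
      finally show ?thesis using True by simp
    next
      case False
      have "c ^ (k - n) \<noteq> 2" if "n < k" for n
        using False that unfolding D2_def by (metis One_nat_def Suc_leI atLeastAtMost_iff diff_le_self zero_less_diff)
      then show ?thesis using False by (simp add: U_def)
    qed
    ultimately show ?thesis using nonneg by (simp add: E_def U_def)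
  qed
  have lim1: "(\<lambda>P. if D2 then 2 * (q / a\<^sup>2) ^ P else 0) \<longlonglongrightarrow> (if D2 then 2 * 0 else 0)"
    using a2 a pqr by (cases D2) (auto intro!: tendsto_mult_right_zero LIMSEQ_power_zero)
  have "0 \<le> q / a" "q / a < 1" using a pqr by simp_all
  then have lim2: "(\<lambda>P. ((q / a)\<^sup>2) ^ P) \<longlonglongrightarrow> 0"
    by (intro LIMSEQ_power_zero) (simp add: power_less_one_iff abs_square_less_1 del: power_divide)
  have lim3: "(\<lambda>P. real P * \<sigma> ^ P) \<longlonglongrightarrow> 0"
    using \<sigma> by (intro powser_times_n_limit_0) simp
  have lim4: "(\<lambda>P. \<sigma> ^ P) \<longlonglongrightarrow> 0" using \<sigma> by (intro LIMSEQ_power_zero) simp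
  \<comment> \<open>This is \<open>E P\<close> multiplied by
    \<open>2 * real P / a ^ (2 * P)\<close>: the negative mass on level k becomes the constant -1
    and all the rest tends to 0.\<close>
  have "(\<lambda>P. (if D2 then 2 * (q / a\<^sup>2) ^ P else 0) + ((q / a)\<^sup>2) ^ P - 1 + 4 * (real P * \<sigma> ^ P) / (1 - \<sigma> ^ P))
      \<longlonglongrightarrow> (if D2 then 2 * 0 else 0) + 0 - 1 + 4 * 0 / (1 - 0)"
    by (intro tendsto_add tendsto_diff tendsto_divide tendsto_mult tendsto_const lim1 lim2 lim3 lim4) simp
  then have "eventually (\<lambda>P. (if D2 then 2 * (q / a\<^sup>2) ^ P else 0) + ((q / a)\<^sup>2) ^ P - 1
      + 4 * (real P * \<sigma> ^ P) / (1 - \<sigma> ^ P) < 0) sequentially"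
    by (rule order_tendstoD) simp
  moreover have "eventually (\<lambda>P. \<forall>l\<in>{1..k}. prime P \<longrightarrow> (\<forall>j. real j * c ^ l = 2 * real P \<longrightarrow> j = P)) sequentially"
    using c by (intro eventually_ball_finite ballI eventually_prime_multiple) (auto simp: one_less_power)
  ultimately have "eventually (\<lambda>P. \<not> prime P) sequentially"
    using eventually_gt_at_top[of 0]
  proof eventually_elim
    case (elim P)
    show "\<not> prime P"
    proof
      assume P: "prime P"
      have "0 \<le> E P * (2 * real P / a ^ (2 * P))"
        using main[OF P] elim P a by (intro mult_nonneg_nonneg) auto
      also have "E P * (2 * real P / a ^ (2 * P)) = (if D2 then 2 * (q / a\<^sup>2) ^ P else 0) + ((q / a)\<^sup>2) ^ P - 1
          + 4 * (real P * \<sigma> ^ P) / (1 - \<sigma> ^ P)"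
      proof -
        have pw: "(x\<^sup>2) ^ P = (x ^ P)\<^sup>2" for x :: real
          by (simp add: mult.commute flip: power_mult)
        show ?thesis
          using a(1) elim(3) unfolding E_def power_divide power_even_eq pw by (simp add: field_simps)
      qed
      also have "\<dots> < 0" by (rule elim)
      finally show False by simp
    qed
  qed
  then obtain n :: nat where "\<forall>P\<ge>n. \<not> prime P"
    by (auto simp: eventually_sequentially)
  then show False using bigger_prime[of n] by (meson less_imp_le_nat)
qed

section \<open>Riemann sums of the stochastic integral\<close>

text \<open>\<open>Lim\<close> has a usable value only where the limit exists; for a monotone path
  it is the supremum of the earlier values.\<close>

lemma mono_on_left_limit:
  fixes f :: "real \<Rightarrow> real"
  assumes mono: "mono_on {0..} f" and s: "s > 0"
  shows "(f \<longlongrightarrow> Lim (at_left s) f) (at_left s)"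
proof -
  define l where "l = Sup (f ` {0..<s})"
  have ne: "f ` {0..<s} \<noteq> {}" using s by auto
  have bdd: "bdd_above (f ` {0..<s})"
    by (rule bdd_aboveI2[of _ _ "f s"]) (use mono in \<open>auto simp: mono_on_def\<close>)
  have "(f \<longlongrightarrow> l) (at_left s)"
  proof (rule tendstoI)
    fix e :: real assume e: "e > 0"
    then have "l - e < Sup (f ` {0..<s})" by (simp add: l_def)
    then obtain x where x: "x \<in> {0..<s}" "l - e < f x"
      unfolding less_cSup_iff[OF ne bdd] by auto
    have "eventually (\<lambda>t. t \<in> {x<..<s}) (at_left s)"
      using x by (intro eventually_at_leftI[of x]) auto
    then show "eventually (\<lambda>t. dist (f t) l < e) (at_left s)"
    proof eventually_elim
      case (elim t)
      have "f x \<le> f t" using mono x elim by (auto simp: mono_on_def)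
      moreover have "f t \<le> l"
        unfolding l_def using x elim by (intro cSup_upper bdd) auto
      ultimately show ?case using x e by (simp add: dist_real_def abs_if)
    qed
  qed
  then have "Lim (at_left s) f = l" by (intro tendsto_Lim) auto
  with \<open>(f \<longlongrightarrow> l) (at_left s)\<close> show ?thesis by simp
qed

definition riemann_sum :: "real \<Rightarrow> (real \<Rightarrow> real) \<Rightarrow> (real \<Rightarrow> real) \<Rightarrow> real \<Rightarrow> nat \<Rightarrow> real" where
  "riemann_sum c n l h m = (\<Sum>i<m. c powr (- n (real i * h)) * (l (real (Suc i) * h) - l (real i * h)))"

text \<open>The step functions evaluate n at the left end of each cell. That end tends to s from
  strictly below, so they converge at every s to the left limit of the integrand; monotonicity
  bounds them by the value at time 0.\<close>

lemma riemann_sum_tendsto: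
  fixes n l :: "real \<Rightarrow> real"
  assumes c: "c > 1" and n: "mono_on {0..} n" and l: "mono_on {0..} l"
    and cont: "\<And>t. t \<ge> 0 \<Longrightarrow> continuous (at_right t) l"
    and T: "T > 0"
  shows "(\<lambda>m. riemann_sum c n l (T / real m) m) \<longlonglongrightarrow> stoch_integral c n l T"
proof -
  define F where "F s = l (max 0 s)" for s
  have Fmono: "F x \<le> F y" if "x \<le> y" for x y
    using l that unfolding F_def by (auto simp: mono_on_def max_def)
  have Fcont: "continuous (at_right a) F" for a
  proof (cases "a \<ge> 0")
    case True
    have "((\<lambda>s. l (max 0 s)) \<longlongrightarrow> l a) (at_right a)"
    proof (rule Lim_transform_eventually)
      show "(l \<longlongrightarrow> l a) (at_right a)" using cont[OF True] by (simp add: continuous_within)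
      show "eventually (\<lambda>s. l s = l (max 0 s)) (at_right a)"
        using True by (intro eventually_at_rightI[of a "a + 1"]) (auto simp: max_def)
    qed
    then show ?thesis using True by (simp add: continuous_within F_def[abs_def] max_def)
  next
    case False
    have "((\<lambda>s. l (max 0 s)) \<longlongrightarrow> l 0) (at_right a)"
    proof (rule tendsto_eventually)
      show "eventually (\<lambda>s. l (max 0 s) = l 0) (at_right a)"
        using False by (intro eventually_at_rightI[of a 0]) (auto simp: max_def)
    qed
    then show ?thesis using False by (simp add: continuous_within F_def[abs_def] max_def)
  qed
  let ?\<mu> = "interval_measure F"
  define g where "g m s = (\<Sum>i<m. c powr (- n (real i * (T / real m))) *
      indicator {real i * (T / real m)<..real (Suc i) * (T / real m)} s)" for m s
  have g_eq: "\<exists>i. real i * (T / real m) < s \<and> s \<le> real i * (T / real m) + T / real m \<and>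
      g m s = c powr (- n (real i * (T / real m)))" if s: "0 < s" "s \<le> T" and m: "m > 0" for m s
  proof -
    define h where "h = T / real m"
    have h: "h > 0" using m T by (simp add: h_def)
    \<comment> \<open>The ceiling minus one and not the floor: the cells are open on the left, so
      the left end stays strictly below s even if s is a grid point.\<close>
    define i where "i = nat (\<lceil>s / h\<rceil> - 1)"
    have "\<lceil>s / h\<rceil> \<ge> 1" using s h by simp
    then have i: "real i = of_int \<lceil>s / h\<rceil> - 1" by (simp add: i_def)
    have "real i < s / h" "s / h \<le> real i + 1" unfolding i by linarith+
    then have ih: "real i * h < s" "s \<le> real (Suc i) * h"
      using h by (simp_all add: field_simps)
    have "real i * h < real m * h" using ih(1) s m by (simp add: h_def)
    then have im: "i < m" using h by simp
    have "indicator {real j * h<..real (Suc j) * h} s = (if j = i then 1 else 0 :: real)" for j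
    proof -
      have "j = i" if "real j * h < s" "s \<le> real (Suc j) * h"
      proof -
        have "real j * h < real (Suc i) * h" "real i * h < real (Suc j) * h"
          using that ih by linarith+
        then have "real j < real (Suc i)" "real i < real (Suc j)"
          unfolding mult_less_cancel_right_pos[OF h] by blast+
        then show ?thesis by simp
      qed
      then have "s \<in> {real j * h<..real (Suc j) * h} \<longleftrightarrow> j = i" using ih by auto
      then show ?thesis unfolding indicator_def by (simp only: of_bool_def)
    qed
    then have "g m s = (\<Sum>j<m. if j = i then c powr (- n (real j * h)) else 0)"
      unfolding g_def h_def[symmetric] by (intro sum.cong refl) simp
    also have "\<dots> = c powr (- n (real i * h))" using im by simp
    finally show ?thesis using ih unfolding h_def[symmetric] by (intro exI[of _ i]) (simp add: algebra_simps)
  qed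
  have g_0: "g m s = 0" if "\<not> (0 < s \<and> s \<le> T)" for m s
  proof (cases "m = 0")
    case False
    define h where "h = T / real m"
    have h: "h > 0" using False T by (simp add: h_def)
    have "\<not> (real i * h < s \<and> s \<le> real (Suc i) * h)" if i: "i < m" for i
    proof
      assume "real i * h < s \<and> s \<le> real (Suc i) * h"
      moreover have "0 \<le> real i * h" using h by simp
      moreover have "real (Suc i) * h \<le> real m * h"
        using i h by (intro mult_right_mono) (auto simp del: of_nat_Suc)
      moreover have "real m * h = T" using False by (simp add: h_def)
      ultimately show False using \<open>\<not> (0 < s \<and> s \<le> T)\<close> by linarith
    qed
    then show ?thesis unfolding g_def h_def[symmetric] by (intro sum.neutral) (auto simp: indicator_def)
  qed (simp add: g_def)
  have g_lim: "(\<lambda>m. g m s) \<longlonglongrightarrow> indicator {0<..T} s * c powr (- Lim (at_left s) n)" for s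
  proof (cases "0 < s \<and> s \<le> T")
    case True
    then have "\<forall>m. \<exists>i. m > 0 \<longrightarrow> real i * (T / real m) < s \<and> s \<le> real i * (T / real m) + T / real m \<and>
      g m s = c powr (- n (real i * (T / real m)))" using g_eq by blast
    from choice[OF this] obtain I where "\<forall>m. m > 0 \<longrightarrow> real (I m) * (T / real m) < s \<and> s \<le> real (I m) * (T / real m) + T / real m \<and>
      g m s = c powr (- n (real (I m) * (T / real m)))" by blast
    then have I: "real (I m) * (T / real m) < s" "s \<le> real (I m) * (T / real m) + T / real m"
      "g m s = c powr (- n (real (I m) * (T / real m)))" if "m > 0" for m using that by blast+
    have "filterlim (\<lambda>m. real (I m) * (T / real m)) (at_left s) sequentially"
    proof (rule filterlim_at_withinI)
      show "(\<lambda>m. real (I m) * (T / real m)) \<longlonglongrightarrow> s"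
      proof (rule tendsto_sandwich)
        show "eventually (\<lambda>m. s - T / real m \<le> real (I m) * (T / real m)) sequentially"
          using eventually_gt_at_top[of 0] by eventually_elim (drule I(2), linarith)
        show "eventually (\<lambda>m. real (I m) * (T / real m) \<le> s) sequentially"
          using eventually_gt_at_top[of 0] by eventually_elim (rule less_imp_le[OF I(1)])
        have "(\<lambda>m. s - T / real m) \<longlonglongrightarrow> s - 0"
          by (intro tendsto_diff tendsto_const lim_const_over_n)
        then show "(\<lambda>m. s - T / real m) \<longlonglongrightarrow> s" by simp
      qed simp
      show "eventually (\<lambda>m. real (I m) * (T / real m) \<in> {..<s} - {s}) sequentially"
        using eventually_gt_at_top[of 0] by eventually_elim (drule I(1), simp)
    qed
    then have "(\<lambda>m. n (real (I m) * (T / real m))) \<longlonglongrightarrow> Lim (at_left s) n"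
      using mono_on_left_limit[OF n, of s] True by (auto intro: filterlim_compose)
    then have "(\<lambda>m. c powr (- n (real (I m) * (T / real m)))) \<longlonglongrightarrow> c powr (- Lim (at_left s) n)"
      using c by (intro tendsto_intros) auto
    then have "(\<lambda>m. g m s) \<longlonglongrightarrow> c powr (- Lim (at_left s) n)"
    proof (rule Lim_transform_eventually)
      show "eventually (\<lambda>m. c powr (- n (real (I m) * (T / real m))) = g m s) sequentially"
        using eventually_gt_at_top[of 0] by eventually_elim (rule I(3)[symmetric])
    qed
    then show ?thesis using True by simp
  next
    case False
    then show ?thesis by (auto simp: g_0 indicator_def)
  qed
  have gm: "g m \<in> borel_measurable ?\<mu>" for m unfolding g_def by measurable
  have em: "emeasure ?\<mu> {a<..b} = ennreal (F b - F a)" if "a \<le> b" for a b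
    using that Fmono Fcont by (rule emeasure_interval_measure_Ioc)
  have me: "measure ?\<mu> {a<..b} = F b - F a" if "a \<le> b" for a b
    using that Fmono Fcont by (rule measure_interval_measure_Ioc)
  have int: "integrable ?\<mu> (indicator {a<..b} :: real \<Rightarrow> real)" for a b
    by (cases "a \<le> b") (auto simp: integrable_indicator_iff em less_top[symmetric])
  have "(\<lambda>m. LINT s|?\<mu>. g m s) \<longlonglongrightarrow> (LINT s|?\<mu>. indicator {0<..T} s * c powr (- Lim (at_left s) n))"
  proof (rule integral_dominated_convergence[where w="\<lambda>s. c powr (- n 0) * indicator {0<..T} s"])
    show "integrable ?\<mu> (\<lambda>s. c powr (- n 0) * indicator {0<..T} s)"
      by (intro integrable_mult_right int)
    show "g m \<in> borel_measurable ?\<mu>" for m by (rule gm)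
    show lim: "AE s in ?\<mu>. (\<lambda>m. g m s) \<longlonglongrightarrow> indicator {0<..T} s * c powr (- Lim (at_left s) n)"
      by (rule AE_I2) (rule g_lim)
    \<comment> \<open>Measurability of the integrand with its left limits is inherited from the step
      functions, which converge at every point.\<close>
    show "(\<lambda>s. indicator {0<..T} s * c powr (- Lim (at_left s) n)) \<in> borel_measurable ?\<mu>"
      by (rule borel_measurable_LIMSEQ_metric[OF gm g_lim])
    show "AE s in ?\<mu>. norm (g m s) \<le> c powr (- n 0) * indicator {0<..T} s" for m
    proof (rule AE_I2)
      fix s
      show "norm (g m s) \<le> c powr (- n 0) * indicator {0<..T} s"
      proof (cases "0 < s \<and> s \<le> T \<and> m > 0")
        case True
        then obtain i where "g m s = c powr (- n (real i * (T / real m)))" using g_eq by blast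
        moreover have "n 0 \<le> n (real i * (T / real m))"
          using n T by (auto simp: mono_on_def)
        ultimately show ?thesis using True c by (simp add: powr_mono)
      next
        case False
        then have "g m s = 0" using g_0[of s m] by (cases "m = 0") (auto simp: g_def)
        then show ?thesis by simp
      qed
    qed
  qed
  moreover have "(LINT s|?\<mu>. g m s) = riemann_sum c n l (T / real m) m" for m
  proof -
    have "(LINT s|?\<mu>. g m s) = (\<Sum>i<m. c powr (- n (real i * (T / real m))) *
        measure ?\<mu> {real i * (T / real m)<..real (Suc i) * (T / real m)})"
      unfolding g_def
      by (subst Bochner_Integration.integral_sum, rule integrable_mult_right, rule int) simp
    also have "\<dots> = riemann_sum c n l (T / real m) m"
      unfolding riemann_sum_def
      by (intro sum.cong refl) (use T in \<open>simp add: me F_def divide_right_mono mult_right_mono max_def\<close>)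
    finally show ?thesis .
  qed
  ultimately show ?thesis
    unfolding stoch_integral_def set_lebesgue_integral_def F_def by simp
qed

section \<open>Marginals and paths of the jump process\<close>

text \<open>Increments are nonnegative almost surely for each pair of times, hence simultaneously
  for countably many pairs; right-continuity extends this to all times.\<close>

lemma mono_on_if_mono_Rats:
  fixes f :: "real \<Rightarrow> real"
  assumes cont: "\<And>t. t \<ge> 0 \<Longrightarrow> continuous (at_right t) f"
    and mono: "\<And>s t. s \<in> \<rat> \<Longrightarrow> t \<in> \<rat> \<Longrightarrow> 0 \<le> s \<Longrightarrow> s \<le> t \<Longrightarrow> f s \<le> f t"
  shows "mono_on {0..} f"
proof (rule mono_onI, rule ccontr)
  fix s t :: real assume st: "s \<in> {0..}" "t \<in> {0..}" "s \<le> t" "\<not> f s \<le> f t"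
  then have "s < t" by (cases "s = t") auto
  define e where "e = (f s + f t) / 2"
  have "(f \<longlongrightarrow> f s) (at_right s)" "(f \<longlongrightarrow> f t) (at_right t)"
    using cont st by (simp_all add: continuous_within)
  moreover have "e < f s" "f t < e" using st by (auto simp: e_def)
  ultimately have "eventually (\<lambda>x. e < f x) (at_right s)" "eventually (\<lambda>x. f x < e) (at_right t)"
    by (blast intro: order_tendstoD)+
  then obtain s' t' where s': "s' > s" "\<And>x. s < x \<Longrightarrow> x < s' \<Longrightarrow> e < f x"
    and t': "t' > t" "\<And>x. t < x \<Longrightarrow> x < t' \<Longrightarrow> f x < e"
    unfolding eventually_at_right_field by auto
  obtain x where x: "x \<in> \<rat>" "s < x" "x < min s' t" using Rats_dense_in_real[of s "min s' t"] s' \<open>s < t\<close> by auto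
  obtain y where y: "y \<in> \<rat>" "t < y" "y < t'" using Rats_dense_in_real[of t t'] t' by auto
  have "f x \<le> f y" using mono[of x y] x y st by auto
  with s'(2)[of x] t'(2)[of y] x y show False by auto
qed

locale jump_process =
  fixes M :: "'a measure" and N L :: "real \<Rightarrow> 'a \<Rightarrow> real" and k :: nat and c u v w :: real
  assumes cpp: "compound_poisson_process M (jump_measure (int k) c u v w) (\<lambda>t \<omega>. (N t \<omega>, L t \<omega>))"
    and c: "c > 1" and uvw: "u \<ge> 0" "v \<ge> 0" "w \<ge> 0"
begin

lemma levy: "levy_process M (\<lambda>t \<omega>. (N t \<omega>, L t \<omega>))"
  using cpp by (simp add: compound_poisson_process_def)

sublocale prob_space M
  using levy by (simp add: levy_process_def)

lemma measurable_NL [measurable]: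
  assumes "t \<ge> 0"
  shows "N t \<in> borel_measurable M" "L t \<in> borel_measurable M"
proof -
  have "(\<lambda>\<omega>. (N t \<omega>, L t \<omega>)) \<in> borel_measurable M"
    using levy assms by (simp add: levy_process_def)
  then have "(\<lambda>\<omega>. (N t \<omega>, L t \<omega>)) \<in> measurable M (borel \<Otimes>\<^sub>M borel)"
    by (simp add: borel_prod)
  from measurable_compose[OF this measurable_fst] measurable_compose[OF this measurable_snd]
  show "N t \<in> borel_measurable M" "L t \<in> borel_measurable M" by simp_all
qed

lemma joint_char:
  assumes "t \<ge> 0"
  shows "(CLINT \<omega>|M. iexp (y * N t \<omega> + z * L t \<omega>)) =
    exp (t * (u * (iexp y - 1) + v * (iexp z - 1) + w * (iexp (y + z / c ^ k) - 1)))"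
proof -
  have pw: "c powi - int k = 1 / c ^ k"
    using c by (simp add: power_int_minus divide_inverse)
  \<comment> \<open>This keeps (1, 0) and the third point distinct, so that the sum over the set has
    three terms with their own masses.\<close>
  have nz: "1 / c ^ k \<noteq> 0" using c by simp
  let ?g = "\<lambda>x. iexp ((y, z) \<bullet> x) - 1"
  let ?A = "{(1, 0), (0, 1), (1, 1 / c ^ k)} :: (real \<times> real) set"
  let ?m = "\<lambda>x::real \<times> real. if x = (1, 0) then u else if x = (0, 1) then v else w"
  have "(CLINT \<omega>|M. iexp ((y, z) \<bullet> (N t \<omega>, L t \<omega>))) =
        exp (complex_of_real t * (CLINT x|jump_measure (int k) c u v w. ?g x))"
    using cpp assms unfolding compound_poisson_process_def by blast
  also have "(CLINT x|jump_measure (int k) c u v w. ?g x) = (CLINT x|point_measure ?A ?m. ?g x)"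
    unfolding jump_measure_def pw
  proof (rule integral_distr)
    show "?g \<in> borel_measurable borel"
      by (intro borel_measurable_continuous_onI continuous_intros)
  qed (simp add: measurable_def sets_point_measure space_point_measure)
  also have "\<dots> = (\<Sum>x\<in>?A. ?m x *\<^sub>R ?g x)"
    using uvw by (intro lebesgue_integral_point_measure_finite) auto
  also have "\<dots> = u * (iexp y - 1) + v * (iexp z - 1) + w * (iexp (y + z / c ^ k) - 1)"
    using nz c by (simp add: scaleR_conv_of_real)
  finally show ?thesis by simp
qed

lemma distr_N:
  assumes "t \<ge> 0"
  shows "distr M borel (N t) = scaled_poisson (t * (u + w)) 1"
proof (rule Levy_uniqueness)
  show "real_distribution (distr M borel (N t))"
    using assms by (intro real_distribution.intro real_distribution_axioms.intro prob_space_distr) auto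
  show "char (distr M borel (N t)) = char (scaled_poisson (t * (u + w)) 1)"
  proof
    fix y
    have "char (distr M borel (N t)) y = (CLINT \<omega>|M. iexp (y * N t \<omega> + 0 * L t \<omega>))"
      unfolding char_def using assms by (subst integral_distr) auto
    also have "\<dots> = exp (of_real (t * (u + w)) * (iexp (y * 1) - 1))"
      unfolding joint_char[OF assms] by (simp add: algebra_simps)
    also have "\<dots> = char (scaled_poisson (t * (u + w)) 1) y"
      using assms uvw by (intro char_scaled_poisson[symmetric]) simp
    finally show "char (distr M borel (N t)) y = char (scaled_poisson (t * (u + w)) 1) y" .
  qed
qed simp

lemma distr_L:
  assumes "t \<ge> 0"
  shows "distr M borel (L t) = convolution (scaled_poisson (t * v) 1) (scaled_poisson (t * w) (1 / c ^ k))"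
proof (rule Levy_uniqueness)
  show "real_distribution (distr M borel (L t))"
    using assms by (intro real_distribution.intro real_distribution_axioms.intro prob_space_distr) auto
  show "real_distribution (convolution (scaled_poisson (t * v) 1) (scaled_poisson (t * w) (1 / c ^ k)))"
    by (intro real_distribution_convolution) simp_all
  show "char (distr M borel (L t)) = char (convolution (scaled_poisson (t * v) 1) (scaled_poisson (t * w) (1 / c ^ k)))"
  proof
    fix z
    have "char (distr M borel (L t)) z = (CLINT \<omega>|M. iexp (0 * N t \<omega> + z * L t \<omega>))"
      unfolding char_def using assms by (subst integral_distr) auto
    also have "\<dots> = exp (of_real (t * v) * (iexp (z * 1) - 1)) * exp (of_real (t * w) * (iexp (z * (1 / c ^ k)) - 1))"
      unfolding joint_char[OF assms] exp_add[symmetric] by (simp add: algebra_simps)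
    also have "\<dots> = char (scaled_poisson (t * v) 1) z * char (scaled_poisson (t * w) (1 / c ^ k)) z"
      using assms uvw by (subst (1 2) char_scaled_poisson) auto
    also have "\<dots> = char (convolution (scaled_poisson (t * v) 1) (scaled_poisson (t * w) (1 / c ^ k))) z"
      by (intro char_convolution[symmetric]) simp_all
    finally show "char (distr M borel (L t)) z = char (convolution (scaled_poisson (t * v) 1) (scaled_poisson (t * w) (1 / c ^ k))) z" .
  qed
qed

lemma AE_N_Nats:
  assumes "t \<ge> 0"
  shows "AE \<omega> in M. N t \<omega> \<in> \<nat>"
proof -
  have [measurable]: "(\<nat> :: real set) \<in> sets borel"
    unfolding Nats_def by (rule sets.countable) auto
  have "AE x in scaled_poisson (t * (u + w)) 1. x \<in> \<nat>"
    unfolding scaled_poisson_def by (subst AE_distr_iff) auto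
  then show ?thesis
    unfolding distr_N[OF assms, symmetric] using assms by (intro AE_distrD[of "N t" M borel]) auto
qed

lemma
  assumes "t \<ge> 0"
  shows AE_L_nonneg: "AE \<omega> in M. 0 \<le> L t \<omega>"
    and nn_integral_L: "(\<integral>\<^sup>+\<omega>. ennreal (L t \<omega>) \<partial>M) = ennreal (t * (v + w / c ^ k))"
proof -
  let ?A = "scaled_poisson (t * v) 1" and ?B = "scaled_poisson (t * w) (1 / c ^ k)"
  interpret A: real_distribution ?A by simp
  interpret B: real_distribution ?B by simp
  have A: "AE x in ?A. 0 \<le> x" and B: "AE x in ?B. 0 \<le> x"
    using c by (auto intro!: AE_scaled_poisson_nonneg)
  have "(\<integral>\<^sup>+x. indicator {..<0} x \<partial>convolution ?A ?B) = (\<integral>\<^sup>+x. \<integral>\<^sup>+y. indicator {..<0} (x + y) \<partial>?B \<partial>?A)"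
    by (intro nn_integral_convolution) (auto intro: A.finite_measure_axioms B.finite_measure_axioms)
  also have "\<dots> = (\<integral>\<^sup>+x. \<integral>\<^sup>+y. 0 \<partial>?B \<partial>?A)"
  proof (rule nn_integral_cong_AE)
    show "AE x in ?A. (\<integral>\<^sup>+y. indicator {..<0} (x + y) \<partial>?B) = (\<integral>\<^sup>+y. 0 \<partial>?B)"
      using A
    proof eventually_elim
      case (elim x)
      show ?case
      proof (rule nn_integral_cong_AE)
        show "AE y in ?B. indicator {..<0} (x + y) = (0 :: ennreal)"
          using B by eventually_elim (use elim in simp)
      qed
    qed
  qed
  finally have "emeasure (distr M borel (L t)) {..<0} = 0"
    unfolding distr_L[OF assms] by simp
  then have "AE x in distr M borel (L t). x \<notin> {..<0}"
    by (intro AE_not_in) (auto simp: null_sets_def)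
  then show "AE \<omega> in M. 0 \<le> L t \<omega>"
    using assms by (subst (asm) AE_distr_iff) (auto simp: not_less)
  have "(\<integral>\<^sup>+\<omega>. ennreal (L t \<omega>) \<partial>M) = (\<integral>\<^sup>+x. ennreal x \<partial>distr M borel (L t))"
    using assms by (subst nn_integral_distr) auto
  also have "\<dots> = (\<integral>\<^sup>+x. \<integral>\<^sup>+y. ennreal (x + y) \<partial>?B \<partial>?A)"
    unfolding distr_L[OF assms]
    by (intro nn_integral_convolution) (auto intro: A.finite_measure_axioms B.finite_measure_axioms)
  also have "\<dots> = (\<integral>\<^sup>+x. \<integral>\<^sup>+y. ennreal x + ennreal y \<partial>?B \<partial>?A)"
  proof (rule nn_integral_cong_AE)
    show "AE x in ?A. (\<integral>\<^sup>+y. ennreal (x + y) \<partial>?B) = (\<integral>\<^sup>+y. ennreal x + ennreal y \<partial>?B)"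
      using A
    proof eventually_elim
      case (elim x)
      show ?case
      proof (rule nn_integral_cong_AE)
        show "AE y in ?B. ennreal (x + y) = ennreal x + ennreal y"
          using B by eventually_elim (use elim in simp)
      qed
    qed
  qed
  also have "\<dots> = ennreal (t * v * 1) + ennreal (t * w * (1 / c ^ k))"
    using assms uvw c
    by (simp add: nn_integral_add nn_integral_scaled_poisson B.emeasure_space_1[simplified] A.emeasure_space_1[simplified])
  also have "\<dots> = ennreal (t * (v + w / c ^ k))"
    using assms uvw c by (simp add: ring_distribs flip: ennreal_plus)
  finally show "(\<integral>\<^sup>+\<omega>. ennreal (L t \<omega>) \<partial>M) = ennreal (t * (v + w / c ^ k))" .
qed

lemma
  assumes "t \<ge> 0"
  shows AE_N_nonneg: "AE \<omega> in M. 0 \<le> N t \<omega>"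
    and nn_integral_N: "(\<integral>\<^sup>+\<omega>. ennreal (N t \<omega>) \<partial>M) = ennreal (t * (u + w))"
proof -
  show "AE \<omega> in M. 0 \<le> N t \<omega>" using AE_N_Nats[OF assms] by eventually_elim (auto simp: Nats_def)
  have "(\<integral>\<^sup>+\<omega>. ennreal (N t \<omega>) \<partial>M) = (\<integral>\<^sup>+x. ennreal x \<partial>distr M borel (N t))"
    using assms by (subst nn_integral_distr) auto
  also have "\<dots> = ennreal (t * (u + w))"
    unfolding distr_N[OF assms] using assms uvw by (subst nn_integral_scaled_poisson) auto
  finally show "(\<integral>\<^sup>+\<omega>. ennreal (N t \<omega>) \<partial>M) = ennreal (t * (u + w))" .
qed

lemma
  assumes "t \<ge> 0"
  shows integrable_N: "integrable M (N t)" and expectation_N: "expectation (N t) = t * (u + w)"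
    and integrable_L: "integrable M (L t)" and expectation_L: "expectation (L t) = t * (v + w / c ^ k)"
proof -
  have "has_bochner_integral M (N t) (t * (u + w))"
    using assms uvw nn_integral_N[OF assms] AE_N_nonneg[OF assms] by (intro has_bochner_integral_nn_integral) auto
  then show "integrable M (N t)" "expectation (N t) = t * (u + w)"
    by (auto simp: has_bochner_integral_iff)
  have "has_bochner_integral M (L t) (t * (v + w / c ^ k))"
    using assms uvw c nn_integral_L[OF assms] AE_L_nonneg[OF assms] by (intro has_bochner_integral_nn_integral) auto
  then show "integrable M (L t)" "expectation (L t) = t * (v + w / c ^ k)"
    by (auto simp: has_bochner_integral_iff)
qed

text \<open>With mean b the probability is 1 - (1 + b) e^(-b), and e^(-b) >= 1 - b gives b^2. Being
  of order t^2, it can be neglected in a first-order expansion at time 0.\<close>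

lemma prob_N_ge_2:
  assumes "t \<ge> 0"
  shows "prob {\<omega> \<in> space M. N t \<omega> \<ge> 2} \<le> (t * (u + w))\<^sup>2"
proof -
  define b where "b = t * (u + w)"
  have b: "b \<ge> 0" using assms uvw by (simp add: b_def)
  have "prob {\<omega> \<in> space M. N t \<omega> \<ge> 2} = measure (distr M borel (N t)) {2..}"
    using assms by (subst measure_distr) (auto simp: vimage_def Int_def conj_commute)
  also have "\<dots> = measure (scaled_poisson b 1) {2..}"
    unfolding distr_N[OF assms] b_def ..
  also have "\<dots> \<le> b\<^sup>2"
  proof (cases "b > 0")
    case True
    have "measure (scaled_poisson b 1) {2..} = measure (measure_pmf (poisson_pmf b)) {n. 2 \<le> real n}"
      unfolding scaled_poisson_def using True by (subst measure_distr) (auto simp: vimage_def)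
    also have "{n. 2 \<le> real n} = - {0, 1}" by auto
    also have "measure (measure_pmf (poisson_pmf b)) (- {0, 1}) = 1 - measure (measure_pmf (poisson_pmf b)) {0, 1}"
      using measure_pmf.prob_compl[of "{0,1}" "poisson_pmf b"] by (simp add: Compl_eq_Diff_UNIV)
    also have "measure (measure_pmf (poisson_pmf b)) {0, 1} = exp (- b) + b * exp (- b)"
      using True by (subst measure_measure_pmf_finite) auto
    also have "1 - (exp (- b) + b * exp (- b)) = 1 - (1 + b) * exp (- b)" by (simp add: algebra_simps)
    also have "\<dots> \<le> 1 - (1 + b) * (1 - b)"
      using b exp_ge_add_one_self[of "- b"] by (intro diff_left_mono mult_left_mono) auto
    also have "\<dots> = b\<^sup>2" by (simp add: algebra_simps power2_eq_square)
    finally show ?thesis .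
  next
    case False
    then have "b = 0" using b by simp
    then show ?thesis unfolding scaled_poisson_def by (subst measure_distr) (auto simp: vimage_def)
  qed
  finally show ?thesis by (simp add: b_def)
qed

lemma distr_increment:
  assumes "s \<ge> 0" "t \<ge> 0"
  shows "distr M borel (\<lambda>\<omega>. (N (s + t) \<omega> - N s \<omega>, L (s + t) \<omega> - L s \<omega>)) = distr M borel (\<lambda>\<omega>. (N t \<omega>, L t \<omega>))"
  using levy assms unfolding levy_process_def by simp

lemma measurable_NL_Pair [measurable]: "t \<ge> 0 \<Longrightarrow> (\<lambda>\<omega>. (N t \<omega>, L t \<omega>)) \<in> borel_measurable M"
  using levy unfolding levy_process_def by simp

lemma measurable_increment [measurable]:
  "s \<ge> 0 \<Longrightarrow> t \<ge> 0 \<Longrightarrow> (\<lambda>\<omega>. (N t \<omega> - N s \<omega>, L t \<omega> - L s \<omega>)) \<in> borel_measurable M"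
  using borel_measurable_diff[OF measurable_NL_Pair measurable_NL_Pair, of t s] by simp

lemma AE_increment_nonneg:
  assumes "0 \<le> s" "s \<le> t"
  shows "AE \<omega> in M. N s \<omega> \<le> N t \<omega> \<and> L s \<omega> \<le> L t \<omega>"
proof -
  have m: "{x::real \<times> real. 0 \<le> fst x \<and> 0 \<le> snd x} \<in> sets borel"
    by (intro borel_closed closed_Collect_conj closed_Collect_le continuous_intros)
  have "AE \<omega> in M. 0 \<le> N (t - s) \<omega> \<and> 0 \<le> L (t - s) \<omega>"
    using AE_N_nonneg[of "t - s"] AE_L_nonneg[of "t - s"] assms by auto
  then have "AE x in distr M borel (\<lambda>\<omega>. (N (t - s) \<omega>, L (t - s) \<omega>)). 0 \<le> fst x \<and> 0 \<le> snd x"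
    using assms m by (subst AE_distr_iff) auto
  also have "distr M borel (\<lambda>\<omega>. (N (t - s) \<omega>, L (t - s) \<omega>)) = distr M borel (\<lambda>\<omega>. (N t \<omega> - N s \<omega>, L t \<omega> - L s \<omega>))"
    using distr_increment[of s "t - s"] assms by simp
  finally show ?thesis
    using assms m by (subst (asm) AE_distr_iff) auto
qed

lemma AE_N_0_L_0: "AE \<omega> in M. N 0 \<omega> = 0 \<and> L 0 \<omega> = 0"
  using levy unfolding levy_process_def by (simp add: zero_prod_def)

lemma AE_paths:
  "AE \<omega> in M. mono_on {0..} (\<lambda>t. N t \<omega>) \<and> mono_on {0..} (\<lambda>t. L t \<omega>) \<and>
     (\<forall>t\<ge>0. continuous (at_right t) (\<lambda>t. L t \<omega>))"
proof -
  have "AE \<omega> in M. \<forall>s\<in>\<rat> \<inter> {0..}. \<forall>t\<in>\<rat> \<inter> {s..}. N s \<omega> \<le> N t \<omega> \<and> L s \<omega> \<le> L t \<omega>"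
    by (intro AE_ball_countable[THEN iffD2] ballI AE_increment_nonneg countable_Int1 countable_rat) auto
  moreover have "AE \<omega> in M. cadlag (\<lambda>t. (N t \<omega>, L t \<omega>))"
    using levy unfolding levy_process_def by simp
  ultimately show ?thesis
  proof eventually_elim
    case (elim \<omega>)
    have "continuous (at_right t) (\<lambda>t. (N t \<omega>, L t \<omega>))" if "t \<ge> 0" for t
      using elim(2) that unfolding cadlag_def by blast
    from continuous_fst[OF this] continuous_snd[OF this]
    have "continuous (at_right t) (\<lambda>t. N t \<omega>)" "continuous (at_right t) (\<lambda>t. L t \<omega>)" if "t \<ge> 0" for t
      using that by simp_all
    then show ?case
      using elim(1) by (auto intro!: mono_on_if_mono_Rats)
  qed
qed

end

section \<open>Independent blocks of increments\<close>

text \<open>A left-point Riemann sum as a function of the increments alone: the value of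
  \<open>N\<close> in the exponent is rebuilt from earlier increments, so that independence of
  increments can be applied directly.\<close>

definition block_sum :: "real \<Rightarrow> nat \<Rightarrow> (nat \<Rightarrow> real \<times> real) \<Rightarrow> real" where
  "block_sum c m x = (\<Sum>i<m. c powr (- (\<Sum>j<i. fst (x j))) * snd (x i))"

text \<open>Discrete form of X_(s+t) = X_s + c^(-N_s) X'_t, the source of the renewal
  equation.\<close>

lemma block_sum_add:
  assumes "c > 0"
  shows "block_sum c (m + n) x =
    block_sum c m x + c powr (- (\<Sum>j<m. fst (x j))) * block_sum c n (\<lambda>i. x (m + i))"
proof -
  have "(\<Sum>j<m + i. fst (x j)) = (\<Sum>j<m. fst (x j)) + (\<Sum>j<i. fst (x (m + j)))" for i
    by (induction i) auto
  then have "c powr (- (\<Sum>j<m + i. fst (x j))) =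
      c powr (- (\<Sum>j<m. fst (x j))) * c powr (- (\<Sum>j<i. fst (x (m + j))))" for i
    by (simp flip: powr_add)
  then show ?thesis
    unfolding block_sum_def by (induction n) (simp_all add: ring_distribs mult_ac)
qed

lemma block_sum_cong:
  assumes "\<And>i. i < m \<Longrightarrow> x i = y i"
  shows "block_sum c m x = block_sum c m y"
proof -
  have "c powr (- (\<Sum>j<i. fst (x j))) * snd (x i) = c powr (- (\<Sum>j<i. fst (y j))) * snd (y i)" if "i < m" for i
    using assms that by (auto intro!: arg_cong2[where f="(*)"] arg_cong[where f="\<lambda>s. c powr - s"] sum.cong)
  then show ?thesis unfolding block_sum_def by (intro sum.cong) auto
qed

lemma measurable_fst_snd_borel [measurable]:
  "fst \<in> borel_measurable (borel :: (real \<times> real) measure)"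
  "snd \<in> borel_measurable (borel :: (real \<times> real) measure)"
  by (intro borel_measurable_continuous_onI continuous_intros)+

lemma measurable_sum_fst:
  assumes "\<And>j. j < m \<Longrightarrow> (\<lambda>x. X x j) \<in> borel_measurable A"
  shows "(\<lambda>x. \<Sum>j<m. fst (X x j :: real \<times> real)) \<in> borel_measurable A"
  by (intro borel_measurable_sum measurable_compose[OF _ measurable_fst_snd_borel(1)] assms) auto

lemma measurable_block_sum:
  assumes "\<And>j. j < m \<Longrightarrow> (\<lambda>x. X x j) \<in> borel_measurable A"
  shows "(\<lambda>x. block_sum c m (X x)) \<in> borel_measurable A"
  unfolding block_sum_def
proof (intro borel_measurable_sum borel_measurable_times)
  fix i assume "i \<in> {..<m}"
  then have i: "i < m" by simp
  have [measurable]: "(\<lambda>x. \<Sum>j<i. fst (X x j)) \<in> borel_measurable A"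
    using i by (intro measurable_sum_fst assms) auto
  show "(\<lambda>x. c powr (- (\<Sum>j<i. fst (X x j)))) \<in> borel_measurable A" by measurable
  show "(\<lambda>x. snd (X x i)) \<in> borel_measurable A"
    by (rule measurable_compose[OF _ measurable_fst_snd_borel(2)]) (rule assms[OF i])
qed

context jump_process
begin

definition incr :: "real \<Rightarrow> nat \<Rightarrow> 'a \<Rightarrow> real \<times> real" where
  "incr h i \<omega> = (N (real (Suc i) * h) \<omega> - N (real i * h) \<omega>, L (real (Suc i) * h) \<omega> - L (real i * h) \<omega>)"

lemma measurable_incr [measurable]: "h \<ge> 0 \<Longrightarrow> incr h i \<in> borel_measurable M"
  unfolding incr_def by (rule measurable_increment) auto

lemma indep_incr:
  assumes "h \<ge> 0"
  shows "indep_vars (\<lambda>_. borel) (\<lambda>i. incr h (m + i)) {..<n}"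
proof -
  have "\<forall>(n::nat) \<tau>. 0 \<le> \<tau> 0 \<and> (\<forall>i<n. \<tau> i \<le> \<tau> (Suc i)) \<longrightarrow>
      indep_vars (\<lambda>_. borel) (\<lambda>i \<omega>. (N (\<tau> (Suc i)) \<omega>, L (\<tau> (Suc i)) \<omega>) - (N (\<tau> i) \<omega>, L (\<tau> i) \<omega>)) {..<n}"
    using levy unfolding levy_process_def by blast
  from this[rule_format, of "\<lambda>i. real (m + i) * h" n] assms
  have "indep_vars (\<lambda>_. borel) (\<lambda>i \<omega>. (N (real (m + Suc i) * h) \<omega>, L (real (m + Suc i) * h) \<omega>)
      - (N (real (m + i) * h) \<omega>, L (real (m + i) * h) \<omega>)) {..<n}"
    by (simp add: mult_right_mono)
  then show ?thesis unfolding incr_def[abs_def] by simp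
qed

lemma distr_incr:
  assumes "h \<ge> 0"
  shows "distr M borel (incr h i) = distr M borel (\<lambda>\<omega>. (N h \<omega>, L h \<omega>))"
  using distr_increment[of "real i * h" h] assms by (simp add: incr_def[abs_def] algebra_simps)

lemma distr_incr_block:
  assumes "h \<ge> 0" "n > 0"
  shows "distr M (PiM {..<n} (\<lambda>_. borel)) (\<lambda>\<omega>. \<lambda>i\<in>{..<n}. incr h (m + i) \<omega>) =
         (\<Pi>\<^sub>M i\<in>{..<n}. distr M borel (\<lambda>\<omega>. (N h \<omega>, L h \<omega>)))"
proof -
  have "{..<n} \<noteq> {}" using assms by auto
  from indep_incr[OF assms(1), of m n] show ?thesis
    by (subst (asm) indep_vars_iff_distr_eq_PiM') (use assms \<open>{..<n} \<noteq> {}\<close> in \<open>auto simp: distr_incr\<close>)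
qed

definition block_char :: "real \<Rightarrow> nat \<Rightarrow> real \<Rightarrow> complex" where
  "block_char h n z = (CLINT \<omega>|M. iexp (z * block_sum c n (\<lambda>i. incr h i \<omega>)))"

lemma block_char_shift:
  assumes "h \<ge> 0"
  shows "(CLINT \<omega>|M. iexp (z * block_sum c n (\<lambda>i. incr h (m + i) \<omega>))) = block_char h n z"
proof (cases "n = 0")
  case True
  then show ?thesis by (simp add: block_char_def block_sum_def)
next
  case False
  have "(CLINT \<omega>|M. iexp (z * block_sum c n (\<lambda>i. incr h (m + i) \<omega>))) =
     (CLINT x|(\<Pi>\<^sub>M i\<in>{..<n}. distr M borel (\<lambda>\<omega>. (N h \<omega>, L h \<omega>))). iexp (z * block_sum c n x))" for m
  proof -
    have "(CLINT \<omega>|M. iexp (z * block_sum c n (\<lambda>i. incr h (m + i) \<omega>)))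
        = (CLINT \<omega>|M. iexp (z * block_sum c n (\<lambda>i\<in>{..<n}. incr h (m + i) \<omega>)))"
      by (intro Bochner_Integration.integral_cong refl arg_cong[where f="\<lambda>s. iexp (z * s)"] block_sum_cong) simp
    also have "\<dots> = (CLINT x|distr M (PiM {..<n} (\<lambda>_. borel)) (\<lambda>\<omega>. \<lambda>i\<in>{..<n}. incr h (m + i) \<omega>). iexp (z * block_sum c n x))"
    proof (rule integral_distr[symmetric])
      show "(\<lambda>\<omega>. \<lambda>i\<in>{..<n}. incr h (m + i) \<omega>) \<in> measurable M (PiM {..<n} (\<lambda>_. borel))"
        using assms by (intro measurable_restrict) auto
      have [measurable]: "(\<lambda>x. block_sum c n x) \<in> borel_measurable (PiM {..<n} (\<lambda>_. borel))"
        by (rule measurable_block_sum) (auto intro: measurable_component_singleton)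
      show "(\<lambda>x. iexp (z * block_sum c n x)) \<in> borel_measurable (PiM {..<n} (\<lambda>_. borel))"
        by measurable
    qed
    finally show ?thesis using distr_incr_block[OF assms, of n m] False by simp
  qed
  from this[of m] this[of 0] show ?thesis by (simp add: block_char_def)
qed

lemma norm_block_char_le_1: "cmod (block_char h n z) \<le> 1"
proof -
  have "cmod (block_char h n z) \<le> (LINT \<omega>|M. cmod (iexp (z * block_sum c n (\<lambda>i. incr h i \<omega>))))"
    unfolding block_char_def by (rule integral_norm_bound)
  then show ?thesis by (simp add: prob_space)
qed

lemma measurable_block_char [measurable]:
  assumes "h \<ge> 0"
  shows "block_char h n \<in> borel_measurable borel"
proof -
  have [measurable]: "(\<lambda>\<omega>. block_sum c n (\<lambda>i. incr h i \<omega>)) \<in> borel_measurable M"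
    using assms by (intro measurable_block_sum) auto
  show ?thesis unfolding block_char_def by measurable
qed

text \<open>The first m and the last n increments are independent. Fubini integrates the later block
  out first; by stationarity it gives \<open>block_char\<close> again, at the frequency discounted
  by the earlier block.\<close>

lemma block_char_add:
  assumes h: "h \<ge> 0"
  shows "block_char h (m + n) z =
    (CLINT \<omega>|M. iexp (z * block_sum c m (\<lambda>i. incr h i \<omega>)) *
       block_char h n (z * c powr (- (\<Sum>j<m. fst (incr h j \<omega>)))))"
proof -
  define PA PB where "PA = PiM {..<m} (\<lambda>_. borel :: (real \<times> real) measure)"
    and "PB = PiM {m..<m + n} (\<lambda>_. borel :: (real \<times> real) measure)"
  define A B where "A = (\<lambda>\<omega>. \<lambda>i\<in>{..<m}. incr h i \<omega>)" and "B = (\<lambda>\<omega>. \<lambda>i\<in>{m..<m + n}. incr h i \<omega>)"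
  have "indep_vars (\<lambda>_. borel) (\<lambda>i. incr h i) {..<m + n}"
    using indep_incr[OF h, of 0] by simp
  then have "indep_var PA A PB B"
    unfolding PA_def PB_def A_def B_def by (rule indep_var_restrict) auto
  then have A [measurable]: "A \<in> measurable M PA" and B [measurable]: "B \<in> measurable M PB"
    and prod: "distr M PA A \<Otimes>\<^sub>M distr M PB B = distr M (PA \<Otimes>\<^sub>M PB) (\<lambda>\<omega>. (A \<omega>, B \<omega>))"
    by (auto simp: indep_var_distribution_eq)
  interpret DA: prob_space "distr M PA A" by (rule prob_space_distr) fact
  interpret DB: prob_space "distr M PB B" by (rule prob_space_distr) fact
  interpret P: pair_prob_space "distr M PA A" "distr M PB B" ..
  define \<Phi> where "\<Phi> = (\<lambda>(a, b). iexp (z * (block_sum c m a +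
     c powr (- (\<Sum>j<m. fst (a j))) * block_sum c n (\<lambda>i. b (m + i)))))"
  have [measurable]: "(\<lambda>a. block_sum c m a) \<in> borel_measurable PA" "(\<lambda>a. \<Sum>j<m. fst (a j)) \<in> borel_measurable PA"
    unfolding PA_def by (rule measurable_block_sum measurable_sum_fst, auto intro: measurable_component_singleton)+
  have [measurable]: "(\<lambda>b. block_sum c n (\<lambda>i. b (m + i))) \<in> borel_measurable PB"
    unfolding PB_def by (rule measurable_block_sum) (auto intro: measurable_component_singleton)
  have \<Phi> [measurable]: "\<Phi> \<in> borel_measurable (PA \<Otimes>\<^sub>M PB)" unfolding \<Phi>_def by measurable
  have "block_char h (m + n) z = (CLINT \<omega>|M. \<Phi> (A \<omega>, B \<omega>))"
    unfolding block_char_def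
  proof (rule Bochner_Integration.integral_cong[OF refl])
    fix \<omega>
    have "block_sum c m (\<lambda>i. incr h i \<omega>) = block_sum c m (A \<omega>)"
      "block_sum c n (\<lambda>i. incr h (m + i) \<omega>) = block_sum c n (\<lambda>i. B \<omega> (m + i))"
      by (auto intro!: block_sum_cong simp: A_def B_def)
    moreover have "(\<Sum>j<m. fst (incr h j \<omega>)) = (\<Sum>j<m. fst (A \<omega> j))" by (simp add: A_def)
    ultimately show "iexp (z * block_sum c (m + n) (\<lambda>i. incr h i \<omega>)) = \<Phi> (A \<omega>, B \<omega>)"
      using c unfolding \<Phi>_def by (simp add: block_sum_add)
  qed
  also have "\<dots> = (CLINT x|distr M PA A \<Otimes>\<^sub>M distr M PB B. \<Phi> x)"
    unfolding prod by (rule integral_distr[symmetric]) measurable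
  also have "\<dots> = (CLINT a|distr M PA A. CLINT b|distr M PB B. \<Phi> (a, b))"
  proof (rule P.integral_fst'[symmetric])
    show "integrable (distr M PA A \<Otimes>\<^sub>M distr M PB B) \<Phi>"
      by (rule P.integrable_const_bound[of _ 1]) (auto simp: \<Phi>_def)
  qed
  also have "\<dots> = (CLINT a|distr M PA A. iexp (z * block_sum c m a) * block_char h n (z * c powr (- (\<Sum>j<m. fst (a j)))))"
  proof (rule Bochner_Integration.integral_cong[OF refl])
    fix a :: "nat \<Rightarrow> real \<times> real"
    let ?y = "z * c powr (- (\<Sum>j<m. fst (a j)))"
    have "(CLINT b|distr M PB B. \<Phi> (a, b)) =
       (CLINT b|distr M PB B. iexp (z * block_sum c m a) * iexp (?y * block_sum c n (\<lambda>i. b (m + i))))"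
      unfolding \<Phi>_def by (intro Bochner_Integration.integral_cong refl) (simp add: ring_distribs exp_add mult_ac)
    also have "\<dots> = iexp (z * block_sum c m a) * (CLINT b|distr M PB B. iexp (?y * block_sum c n (\<lambda>i. b (m + i))))"
      by simp
    also have "(CLINT b|distr M PB B. iexp (?y * block_sum c n (\<lambda>i. b (m + i)))) =
        (CLINT \<omega>|M. iexp (?y * block_sum c n (\<lambda>i. B \<omega> (m + i))))"
      by (rule integral_distr) measurable
    also have "\<dots> = (CLINT \<omega>|M. iexp (?y * block_sum c n (\<lambda>i. incr h (m + i) \<omega>)))"
      by (intro Bochner_Integration.integral_cong refl arg_cong[where f="\<lambda>s. iexp (?y * s)"] block_sum_cong) (simp add: B_def)
    also have "\<dots> = block_char h n ?y" by (rule block_char_shift[OF h])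
    finally show "(CLINT b|distr M PB B. \<Phi> (a, b)) = iexp (z * block_sum c m a) * block_char h n ?y" .
  qed
  also have "\<dots> = (CLINT \<omega>|M. iexp (z * block_sum c m (A \<omega>)) * block_char h n (z * c powr (- (\<Sum>j<m. fst (A \<omega> j)))))"
    using h by (intro integral_distr) measurable
  also have "\<dots> = (CLINT \<omega>|M. iexp (z * block_sum c m (\<lambda>i. incr h i \<omega>)) *
       block_char h n (z * c powr (- (\<Sum>j<m. fst (incr h j \<omega>)))))"
  proof (rule Bochner_Integration.integral_cong[OF refl])
    fix \<omega>
    have "block_sum c m (A \<omega>) = block_sum c m (\<lambda>i. incr h i \<omega>)"
      by (auto intro!: block_sum_cong simp: A_def)
    moreover have "(\<Sum>j<m. fst (A \<omega> j)) = (\<Sum>j<m. fst (incr h j \<omega>))" by (simp add: A_def)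
    ultimately show "iexp (z * block_sum c m (A \<omega>)) * block_char h n (z * c powr (- (\<Sum>j<m. fst (A \<omega> j))))
      = iexp (z * block_sum c m (\<lambda>i. incr h i \<omega>)) * block_char h n (z * c powr (- (\<Sum>j<m. fst (incr h j \<omega>))))"
      by simp
  qed
  finally show ?thesis .
qed

lemma sum_fst_incr: "(\<Sum>j<m. fst (incr h j \<omega>)) = N (real m * h) \<omega> - N 0 \<omega>"
  by (induction m) (simp_all add: incr_def)

lemma sum_snd_incr: "(\<Sum>j<m. snd (incr h j \<omega>)) = L (real m * h) \<omega> - L 0 \<omega>"
  by (induction m) (simp_all add: incr_def)

lemma block_sum_incr:
  assumes "N 0 \<omega> = 0"
  shows "block_sum c m (\<lambda>i. incr h i \<omega>) = riemann_sum c (\<lambda>t. N t \<omega>) (\<lambda>t. L t \<omega>) h m"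
  unfolding block_sum_def riemann_sum_def sum_fst_incr using assms by (simp add: incr_def)

text \<open>A summand of the difference is nonzero only if \<open>N\<close> has jumped before, which is independent of the next
  increment of \<open>L\<close>.\<close>

lemma expectation_block_sum_diff:
  assumes h: "h \<ge> 0"
  shows "integrable M (\<lambda>\<omega>. \<bar>L (real m * h) \<omega> - block_sum c m (\<lambda>i. incr h i \<omega>)\<bar>)"
    and "expectation (\<lambda>\<omega>. \<bar>L (real m * h) \<omega> - block_sum c m (\<lambda>i. incr h i \<omega>)\<bar>)
           \<le> ln c * (u + w) * (v + w / c ^ k) * (real m * h)\<^sup>2"
proof -
  define K where "K = (u + w) * (v + w / c ^ k)"
  have K: "0 \<le> K" using uvw c by (simp add: K_def)
  define X where "X i \<omega> = \<bar>1 - c powr (- (\<Sum>j<i. fst (incr h j \<omega>)))\<bar> * \<bar>snd (incr h i \<omega>)\<bar>" for i \<omega>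
  have X: "integrable M (X i) \<and> expectation (X i) \<le> ln c * K * real i * h\<^sup>2" for i
  proof -
    have "\<forall>(n::nat) \<tau>. 0 \<le> \<tau> 0 \<and> (\<forall>i<n. \<tau> i \<le> \<tau> (Suc i)) \<longrightarrow>
        indep_vars (\<lambda>_. borel) (\<lambda>i \<omega>. (N (\<tau> (Suc i)) \<omega>, L (\<tau> (Suc i)) \<omega>) - (N (\<tau> i) \<omega>, L (\<tau> i) \<omega>)) {..<n}"
      using levy unfolding levy_process_def by blast
    then have ind: "indep_vars (\<lambda>_. borel) (\<lambda>a \<omega>. (N (\<tau> (Suc a)) \<omega>, L (\<tau> (Suc a)) \<omega>) - (N (\<tau> a) \<omega>, L (\<tau> a) \<omega>)) {..<2}"
      if "0 \<le> \<tau> 0" "\<forall>a<2. \<tau> a \<le> \<tau> (Suc a)" for \<tau> :: "nat \<Rightarrow> real" using that by blast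
    \<comment> \<open>The times 0, i h, (i+1) h produce two independent increments; the first enters
      through \<open>N\<close>, the second through \<open>L\<close>.\<close>
    define \<tau> where "\<tau> a = (if a = 0 then 0 else if a = 1 then real i * h else real (Suc i) * h)" for a :: nat
    define Z where "Z a \<omega> = (N (\<tau> (Suc a)) \<omega>, L (\<tau> (Suc a)) \<omega>) - (N (\<tau> a) \<omega>, L (\<tau> a) \<omega>)" for a \<omega>
    define f where "f a x = (if a = 0 then \<bar>1 - c powr (- fst x)\<bar> else \<bar>snd x\<bar>)" for a :: nat and x :: "real \<times> real"
    have "indep_vars (\<lambda>_. borel) Z {..<2}"
      unfolding Z_def by (rule ind) (use h in \<open>auto simp: \<tau>_def less_Suc_eq numeral_2_eq_2 intro: mult_right_mono\<close>)
    then have indf: "indep_vars (\<lambda>_. borel) (\<lambda>a \<omega>. f a (Z a \<omega>)) {..<2}"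
      by (rule indep_vars_compose2) (simp add: f_def[abs_def])
    have f0: "f 0 (Z 0 \<omega>) = \<bar>1 - c powr (- (N (real i * h) \<omega> - N 0 \<omega>))\<bar>"
      and f1: "f 1 (Z 1 \<omega>) = \<bar>L (real (Suc i) * h) \<omega> - L (real i * h) \<omega>\<bar>" for \<omega>
      by (simp_all add: f_def Z_def \<tau>_def)
    have nn: "0 \<le> real i * h" "0 \<le> real (Suc i) * h" "real i * h \<le> real (Suc i) * h" using h by (auto intro: mult_right_mono)
    note [measurable] = measurable_NL[OF nn(1)] measurable_NL[OF nn(2)] measurable_NL[OF order_refl]
    \<comment> \<open>From e^(-x) >= 1 - x with x = N ln c; this is where the constant
      \<open>ln c\<close> comes from.\<close>
    have b0: "AE \<omega> in M. f 0 (Z 0 \<omega>) \<le> ln c * N (real i * h) \<omega>"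
      using AE_N_nonneg[of "real i * h", OF mult_nonneg_nonneg[OF of_nat_0_le_iff h]] AE_N_0_L_0
    proof eventually_elim
      case (elim \<omega>)
      let ?n = "N (real i * h) \<omega>"
      have "1 - ?n * ln c \<le> c powr (- ?n)"
        using exp_ge_add_one_self[of "- (?n * ln c)"] c by (simp add: powr_def)
      moreover have "c powr (- ?n) \<le> 1"
        using c elim by (simp add: powr_minus divide_inverse inverse_le_1_iff ge_one_powr_ge_zero)
      ultimately show ?case using elim unfolding f0 by (simp add: mult_ac)
    qed
    have m0: "(\<lambda>\<omega>. f 0 (Z 0 \<omega>)) \<in> borel_measurable M"
      unfolding f0 by measurable
    have i0: "integrable M (\<lambda>\<omega>. f 0 (Z 0 \<omega>))"
    proof (rule Bochner_Integration.integrable_bound[OF _ m0])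
      show "integrable M (\<lambda>\<omega>. ln c * N (real i * h) \<omega>)"
        by (intro integrable_mult_right integrable_N nn)
      show "AE \<omega> in M. norm (f 0 (Z 0 \<omega>)) \<le> norm (ln c * N (real i * h) \<omega>)"
        using b0 by eventually_elim (simp add: f0)
    qed
    have e0: "expectation (\<lambda>\<omega>. f 0 (Z 0 \<omega>)) \<le> ln c * (real i * h * (u + w))"
    proof -
      have "expectation (\<lambda>\<omega>. f 0 (Z 0 \<omega>)) \<le> expectation (\<lambda>\<omega>. ln c * N (real i * h) \<omega>)"
        using h by (intro integral_mono_AE i0 b0 integrable_mult_right integrable_N) auto
      then show ?thesis using h by (simp add: expectation_N)
    qed
    have b1: "AE \<omega> in M. f 1 (Z 1 \<omega>) = L (real (Suc i) * h) \<omega> - L (real i * h) \<omega>"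
      using AE_increment_nonneg[OF nn(1,3)] by eventually_elim (simp only: f1, simp)
    have i1: "integrable M (\<lambda>\<omega>. L (real (Suc i) * h) \<omega> - L (real i * h) \<omega>)"
      by (intro Bochner_Integration.integrable_diff integrable_L nn)
    have m1: "(\<lambda>\<omega>. f 1 (Z 1 \<omega>)) \<in> borel_measurable M"
      unfolding f1 by measurable
    have i1': "integrable M (\<lambda>\<omega>. f 1 (Z 1 \<omega>))"
      unfolding f1 using i1 by (rule integrable_abs)
    have "expectation (\<lambda>\<omega>. f 1 (Z 1 \<omega>)) = expectation (\<lambda>\<omega>. L (real (Suc i) * h) \<omega> - L (real i * h) \<omega>)"
      using b1 i1 m1 by (intro integral_cong_AE) auto
    also have "\<dots> = real (Suc i) * h * (v + w / c ^ k) - real i * h * (v + w / c ^ k)"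
      using nn by (subst Bochner_Integration.integral_diff) (simp_all add: integrable_L expectation_L del: of_nat_Suc)
    also have "\<dots> = h * (v + w / c ^ k)"
      unfolding left_diff_distrib[symmetric] of_nat_Suc by simp
    finally have e1: "expectation (\<lambda>\<omega>. f 1 (Z 1 \<omega>)) = h * (v + w / c ^ k)" .
    have p2: "(\<Prod>a\<in>{..<2}. g a) = g 0 * g 1" for g :: "nat \<Rightarrow> real" by (simp add: numeral_2_eq_2)
    have prod: "X i = (\<lambda>\<omega>. \<Prod>a\<in>{..<2}. f a (Z a \<omega>))"
      unfolding p2 f0 f1 X_def sum_fst_incr by (simp add: incr_def)
    have "integrable M (X i)"
      unfolding prod by (rule indep_vars_integrable[OF _ indf]) (use i0 i1' in \<open>auto simp: less_2_cases_iff\<close>)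
    moreover have "expectation (X i) = (\<Prod>a\<in>{..<2}. expectation (\<lambda>\<omega>. f a (Z a \<omega>)))"
      unfolding prod by (rule indep_vars_lebesgue_integral[OF _ indf]) (use i0 i1' in \<open>auto simp: less_2_cases_iff\<close>)
    then have "expectation (X i) = expectation (\<lambda>\<omega>. f 0 (Z 0 \<omega>)) * expectation (\<lambda>\<omega>. f 1 (Z 1 \<omega>))"
      by (simp add: numeral_2_eq_2)
    then have "expectation (X i) \<le> ln c * (real i * h * (u + w)) * (h * (v + w / c ^ k))"
      unfolding e1 using e0 h uvw c by (simp only:) (intro mult_right_mono, auto)
    ultimately show ?thesis by (simp add: K_def power2_eq_square mult_ac)
  qed
  have le: "AE \<omega> in M. \<bar>L (real m * h) \<omega> - block_sum c m (\<lambda>i. incr h i \<omega>)\<bar> \<le> (\<Sum>i<m. X i \<omega>)"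
    using AE_N_0_L_0
  proof eventually_elim
    case (elim \<omega>)
    have "L (real m * h) \<omega> - block_sum c m (\<lambda>i. incr h i \<omega>) =
       (\<Sum>i<m. snd (incr h i \<omega>)) - block_sum c m (\<lambda>i. incr h i \<omega>)"
      using elim by (simp add: sum_snd_incr)
    also have "\<dots> = (\<Sum>i<m. (1 - c powr (- (\<Sum>j<i. fst (incr h j \<omega>)))) * snd (incr h i \<omega>))"
      unfolding block_sum_def sum_subtractf[symmetric] by (simp add: algebra_simps)
    also have "\<bar>\<dots>\<bar> \<le> (\<Sum>i<m. X i \<omega>)"
      unfolding X_def abs_mult[symmetric] by (rule sum_abs)
    finally show ?case .
  qed
  have intS: "integrable M (\<lambda>\<omega>. \<Sum>i<m. X i \<omega>)" using X by (intro Bochner_Integration.integrable_sum) auto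
  have ms: "(\<lambda>\<omega>. \<bar>L (real m * h) \<omega> - block_sum c m (\<lambda>i. incr h i \<omega>)\<bar>) \<in> borel_measurable M"
    using h by (intro borel_measurable_abs borel_measurable_diff measurable_block_sum) auto
  show int: "integrable M (\<lambda>\<omega>. \<bar>L (real m * h) \<omega> - block_sum c m (\<lambda>i. incr h i \<omega>)\<bar>)"
    by (rule Bochner_Integration.integrable_bound[OF intS ms]) (use le in \<open>auto elim!: eventually_mono\<close>)
  have "expectation (\<lambda>\<omega>. \<bar>L (real m * h) \<omega> - block_sum c m (\<lambda>i. incr h i \<omega>)\<bar>) \<le> expectation (\<lambda>\<omega>. \<Sum>i<m. X i \<omega>)"
    by (intro integral_mono_AE int intS le)
  also have "\<dots> = (\<Sum>i<m. expectation (X i))"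
    using X by (intro Bochner_Integration.integral_sum) auto
  \<comment> \<open>Each i is replaced by m; m terms of order m h^2 give (m h)^2, which does not
    depend on the mesh once m h = T is fixed.\<close>
  also have "\<dots> \<le> (\<Sum>i<m. ln c * K * real m * h\<^sup>2)"
  proof (rule sum_mono)
    fix i assume "i \<in> {..<m}"
    then have "ln c * K * real i * h\<^sup>2 \<le> ln c * K * real m * h\<^sup>2"
      using K c by (intro mult_right_mono mult_left_mono) auto
    then show "expectation (X i) \<le> ln c * K * real m * h\<^sup>2" using X[of i] by linarith
  qed
  also have "\<dots> = ln c * (u + w) * (v + w / c ^ k) * (real m * h)\<^sup>2"
    by (simp add: K_def power2_eq_square mult_ac)
  finally show "expectation (\<lambda>\<omega>. \<bar>L (real m * h) \<omega> - block_sum c m (\<lambda>i. incr h i \<omega>)\<bar>)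
           \<le> ln c * (u + w) * (v + w / c ^ k) * (real m * h)\<^sup>2" .
qed

end

section \<open>The functional equation\<close>

text \<open>A change of order T^2 leaves no first-order term, so the derivative at 0
  vanishes.\<close>

lemma deriv_zero_if_quadratic:
  fixes \<alpha> \<beta> A B :: complex
  assumes "\<And>T::real. T > 0 \<Longrightarrow> cmod (\<alpha> * exp (of_real T * A) + \<beta> * exp (of_real T * B) - (\<alpha> + \<beta>)) \<le> K * T\<^sup>2"
  shows "\<alpha> * A + \<beta> * B = 0"
proof -
  define H where "H s = \<alpha> * exp (s * A) + \<beta> * exp (s * B)" for s :: complex
  define t :: "nat \<Rightarrow> real" where "t n = inverse (real (Suc n))" for n
  have t: "t n > 0" "t \<longlonglongrightarrow> 0" for n
    unfolding t_def by (simp, rule LIMSEQ_inverse_real_of_nat)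
  have "(H has_field_derivative (\<alpha> * A + \<beta> * B)) (at 0)"
    unfolding H_def by (auto intro!: derivative_eq_intros)
  then have "((\<lambda>s. (H s - H 0) / s) \<longlongrightarrow> \<alpha> * A + \<beta> * B) (at 0)"
    by (simp add: has_field_derivative_iff)
  moreover have "filterlim (\<lambda>n. of_real (t n) :: complex) (at 0) sequentially"
    unfolding filterlim_at using t(1) tendsto_of_real[OF t(2), where 'a = complex]
    by (auto simp: less_imp_neq[symmetric])
  ultimately have lim: "(\<lambda>n. (H (of_real (t n)) - H 0) / of_real (t n)) \<longlonglongrightarrow> \<alpha> * A + \<beta> * B"
    by (rule filterlim_compose)
  have "(\<lambda>n. (H (of_real (t n)) - H 0) / of_real (t n)) \<longlonglongrightarrow> 0"
  proof (rule Lim_null_comparison[OF always_eventually, rule_format])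
    fix n
    have "cmod (H (of_real (t n)) - H 0) \<le> K * (t n)\<^sup>2"
      using assms[OF t(1)[of n]] by (simp add: H_def)
    then have "cmod (H (of_real (t n)) - H 0) / t n \<le> K * (t n)\<^sup>2 / t n"
      using t(1)[of n] by (intro divide_right_mono) auto
    then show "norm ((H (of_real (t n)) - H 0) / of_real (t n)) \<le> K * t n"
      using t(1)[of n] by (simp add: norm_divide power2_eq_square)
  next
    show "(\<lambda>n. K * t n) \<longlonglongrightarrow> 0" using t(2) by (rule tendsto_mult_right_zero)
  qed
  with lim show ?thesis by (rule LIMSEQ_unique)
qed

context jump_process
begin

text \<open>The interval up to j T is cut with mesh T/m, so that the first m steps end exactly at T
  and can be split off. These grids are a subsequence of the equidistant ones of that
  interval.\<close>

lemma AE_block_sum_tendsto: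
  assumes T: "T > 0" and j: "j > 0"
  shows "AE \<omega> in M. (\<lambda>m. block_sum c (j * m) (\<lambda>i. incr (T / real m) i \<omega>))
           \<longlonglongrightarrow> stoch_integral c (\<lambda>s. N s \<omega>) (\<lambda>s. L s \<omega>) (real j * T)"
  using AE_paths AE_N_0_L_0
proof eventually_elim
  case (elim \<omega>)
  have "(\<lambda>m. riemann_sum c (\<lambda>s. N s \<omega>) (\<lambda>s. L s \<omega>) (real j * T / real m) m)
      \<longlonglongrightarrow> stoch_integral c (\<lambda>s. N s \<omega>) (\<lambda>s. L s \<omega>) (real j * T)"
    using elim T j c by (intro riemann_sum_tendsto) auto
  moreover have "filterlim (\<lambda>m. j * m) at_top sequentially"
    using j by (intro filterlim_subseq strict_monoI) auto
  ultimately have "(\<lambda>m. riemann_sum c (\<lambda>s. N s \<omega>) (\<lambda>s. L s \<omega>) (real j * T / real (j * m)) (j * m))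
      \<longlonglongrightarrow> stoch_integral c (\<lambda>s. N s \<omega>) (\<lambda>s. L s \<omega>) (real j * T)"
    by (rule filterlim_compose)
  moreover have "real j * T / real (j * m) = T / real m" for m using j by simp
  ultimately show ?case using elim by (simp only: block_sum_incr)
qed

lemma measurable_block_sum_incr [measurable]:
  "h \<ge> 0 \<Longrightarrow> (\<lambda>\<omega>. block_sum c m (\<lambda>i. incr h i \<omega>)) \<in> borel_measurable M"
  by (intro measurable_block_sum) auto

text \<open>The discrete renewal equation with the first block [0, T] passes to the limit twice: m
  -> infinity refines the mesh, then j -> infinity lengthens the horizon. Only afterwards is the
  integral over [0, T] replaced by \<open>L T\<close>, at the stated cost.\<close>

lemma char_limit_renewal:
  assumes X [measurable]: "X \<in> borel_measurable M"
    and lim: "AE \<omega> in M. ((\<lambda>t. stoch_integral c (\<lambda>s. N s \<omega>) (\<lambda>s. L s \<omega>) t) \<longlongrightarrow> X \<omega>) at_top"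
    and T: "T > 0"
  defines "\<phi> \<equiv> \<lambda>z. CLINT \<omega>|M. iexp (z * X \<omega>)"
  shows "cmod (\<phi> z - (CLINT \<omega>|M. iexp (z * L T \<omega>) * \<phi> (z * c powr (- N T \<omega>))))
           \<le> \<bar>z\<bar> * (ln c * (u + w) * (v + w / c ^ k) * T\<^sup>2)"
proof -
  define S where "S j m \<omega> = block_sum c (j * m) (\<lambda>i. incr (T / real m) i \<omega>)" for j m \<omega>
  \<comment> \<open>As a limit of measurable sums this is measurable; it agrees almost surely with
    the stochastic integral up to j T for j > 0.\<close>
  define Y where "Y j \<omega> = lim (\<lambda>m. S j m \<omega>)" for j \<omega>
  have S [measurable]: "S j m \<in> borel_measurable M" for j m
    unfolding S_def using T by (intro measurable_block_sum_incr) simp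
  have Y [measurable]: "Y j \<in> borel_measurable M" for j
    unfolding Y_def by (intro borel_measurable_lim_metric S)
  have SY: "AE \<omega> in M. \<forall>j>0. (\<lambda>m. S j m \<omega>) \<longlonglongrightarrow> Y j \<omega> \<and>
      Y j \<omega> = stoch_integral c (\<lambda>s. N s \<omega>) (\<lambda>s. L s \<omega>) (real j * T)"
  proof -
    have "AE \<omega> in M. \<forall>j\<in>{0<..}. (\<lambda>m. S j m \<omega>) \<longlonglongrightarrow> stoch_integral c (\<lambda>s. N s \<omega>) (\<lambda>s. L s \<omega>) (real j * T)"
      unfolding S_def by (intro AE_ball_countable[THEN iffD2] ballI AE_block_sum_tendsto T) auto
    then show ?thesis
    proof eventually_elim
      case (elim \<omega>)
      have "(\<lambda>m. S j m \<omega>) \<longlonglongrightarrow> Y j \<omega> \<and> Y j \<omega> = stoch_integral c (\<lambda>s. N s \<omega>) (\<lambda>s. L s \<omega>) (real j * T)"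
        if "j > 0" for j
      proof -
        have l: "(\<lambda>m. S j m \<omega>) \<longlonglongrightarrow> stoch_integral c (\<lambda>s. N s \<omega>) (\<lambda>s. L s \<omega>) (real j * T)"
          using elim that by blast
        with limI[OF l] show ?thesis by (simp add: Y_def)
      qed
      then show ?case by blast
    qed
  qed
  have SY1: "AE \<omega> in M. (\<lambda>m. S 1 m \<omega>) \<longlonglongrightarrow> Y 1 \<omega>"
    using SY by eventually_elim (use zero_less_one in blast)
  have YX: "AE \<omega> in M. (\<lambda>j. Y (Suc j) \<omega>) \<longlonglongrightarrow> X \<omega>"
    using SY lim
  proof eventually_elim
    case (elim \<omega>)
    have "filterlim (\<lambda>j. real (Suc j) * T) at_top sequentially"
      using T by (intro filterlim_at_top_mult_tendsto_pos[OF tendsto_const]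
        filterlim_compose[OF filterlim_real_sequentially filterlim_Suc]) 
    with elim(2) have "(\<lambda>j. stoch_integral c (\<lambda>s. N s \<omega>) (\<lambda>s. L s \<omega>) (real (Suc j) * T)) \<longlonglongrightarrow> X \<omega>"
      by (rule filterlim_compose)
    then show ?case using elim(1) by simp
  qed
  define F where "F j z = (CLINT \<omega>|M. iexp (z * Y j \<omega>))" for j z
  define B where "B j m z = block_char (T / real m) (j * m) z" for j m z
  have BF: "(\<lambda>m. B j m z) \<longlonglongrightarrow> F j z" if "j > 0" for j z
    unfolding B_def F_def block_char_def S_def[symmetric]
  proof (rule integral_dominated_convergence[where w="\<lambda>_. 1"])
    show "AE \<omega> in M. (\<lambda>m. iexp (z * S j m \<omega>)) \<longlonglongrightarrow> iexp (z * Y j \<omega>)"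
      using SY by eventually_elim (use that in \<open>intro tendsto_intros, blast\<close>)
  qed auto
  have F\<phi>: "(\<lambda>j. F (Suc j) z) \<longlonglongrightarrow> \<phi> z" for z
    unfolding F_def \<phi>_def
  proof (rule integral_dominated_convergence[where w="\<lambda>_. 1"])
    show "AE \<omega> in M. (\<lambda>j. iexp (z * Y (Suc j) \<omega>)) \<longlonglongrightarrow> iexp (z * X \<omega>)"
      using YX by eventually_elim (intro tendsto_intros)
  qed auto
  have F1: "cmod (F j z) \<le> 1" for j z
  proof -
    have "cmod (F j z) \<le> (LINT \<omega>|M. cmod (iexp (z * Y j \<omega>)))"
      unfolding F_def by (rule integral_norm_bound)
    then show ?thesis by (simp add: prob_space)
  qed
  have \<phi>1: "cmod (\<phi> z) \<le> 1" for z
  proof -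
    have "cmod (\<phi> z) \<le> (LINT \<omega>|M. cmod (iexp (z * X \<omega>)))"
      unfolding \<phi>_def by (rule integral_norm_bound)
    then show ?thesis by (simp add: prob_space)
  qed
  have [measurable]: "F j \<in> borel_measurable borel" for j unfolding F_def by measurable
  have [measurable]: "\<phi> \<in> borel_measurable borel" unfolding \<phi>_def by measurable
  have [measurable]: "B j m \<in> borel_measurable borel" for j m
    unfolding B_def using T by (intro measurable_block_char) simp
  \<comment> \<open>\<open>N 0\<close> is kept because the sum of the increments produces it; it is
    zero almost surely and disappears at the end.\<close>
  define y where "y \<omega> = z * c powr (- (N T \<omega> - N 0 \<omega>))" for \<omega>
  have NT [measurable]: "N T \<in> borel_measurable M" "L T \<in> borel_measurable M" "N 0 \<in> borel_measurable M"
    using T by (auto intro: measurable_NL)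
  have y [measurable]: "y \<in> borel_measurable M" unfolding y_def by measurable
  \<comment> \<open>The limit m -> infinity, with integrands bounded by 1. It is restricted to j >
    0, where \<open>Y j\<close> is known to be the limit; hence the double successor in the next
    limit.\<close>
  have "F (Suc j) z = (CLINT \<omega>|M. iexp (z * Y 1 \<omega>) * F j (y \<omega>))" if j: "j > 0" for j
  proof (rule LIMSEQ_unique)
    show "(\<lambda>m. B (Suc j) m z) \<longlonglongrightarrow> F (Suc j) z" by (rule BF) simp
    have "(\<lambda>m. CLINT \<omega>|M. iexp (z * S 1 m \<omega>) * B j m (y \<omega>)) \<longlonglongrightarrow> (CLINT \<omega>|M. iexp (z * Y 1 \<omega>) * F j (y \<omega>))"
    proof (rule integral_dominated_convergence[where w="\<lambda>_. 1"])
      show "AE \<omega> in M. (\<lambda>m. iexp (z * S 1 m \<omega>) * B j m (y \<omega>)) \<longlonglongrightarrow> iexp (z * Y 1 \<omega>) * F j (y \<omega>)"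
        using SY1 by eventually_elim (intro tendsto_intros BF j)
      show "AE \<omega> in M. norm (iexp (z * S 1 m \<omega>) * B j m (y \<omega>)) \<le> 1" for m
        by (auto simp: norm_mult B_def norm_block_char_le_1)
    qed auto
    moreover have "eventually (\<lambda>m. (CLINT \<omega>|M. iexp (z * S 1 m \<omega>) * B j m (y \<omega>)) = B (Suc j) m z) sequentially"
      using eventually_gt_at_top[of 0]
    proof eventually_elim
      case (elim m)
      have "B (Suc j) m z = block_char (T / real m) (m + j * m) z" by (simp add: B_def)
      also have "\<dots> = (CLINT \<omega>|M. iexp (z * S 1 m \<omega>) * B j m (y \<omega>))"
        using T elim by (subst block_char_add) (simp_all add: S_def B_def y_def sum_fst_incr)
      finally show ?case by simp
    qed
    ultimately show "(\<lambda>m. B (Suc j) m z) \<longlonglongrightarrow> (CLINT \<omega>|M. iexp (z * Y 1 \<omega>) * F j (y \<omega>))"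
      by (rule Lim_transform_eventually)
  qed
  note rec = this
  have \<phi>_eq: "\<phi> z = (CLINT \<omega>|M. iexp (z * Y 1 \<omega>) * \<phi> (y \<omega>))"
  proof (rule LIMSEQ_unique)
    show "(\<lambda>j. F (Suc (Suc j)) z) \<longlonglongrightarrow> \<phi> z" by (rule LIMSEQ_Suc[OF F\<phi>])
    have "(\<lambda>j. CLINT \<omega>|M. iexp (z * Y 1 \<omega>) * F (Suc j) (y \<omega>)) \<longlonglongrightarrow> (CLINT \<omega>|M. iexp (z * Y 1 \<omega>) * \<phi> (y \<omega>))"
    proof (rule integral_dominated_convergence[where w="\<lambda>_. 1"])
      show "AE \<omega> in M. (\<lambda>j. iexp (z * Y 1 \<omega>) * F (Suc j) (y \<omega>)) \<longlonglongrightarrow> iexp (z * Y 1 \<omega>) * \<phi> (y \<omega>)"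
        by (intro AE_I2 tendsto_mult tendsto_const F\<phi>)
      show "AE \<omega> in M. norm (iexp (z * Y 1 \<omega>) * F (Suc j) (y \<omega>)) \<le> 1" for j
        by (auto simp: norm_mult F1)
    qed auto
    then show "(\<lambda>j. F (Suc (Suc j)) z) \<longlonglongrightarrow> (CLINT \<omega>|M. iexp (z * Y 1 \<omega>) * \<phi> (y \<omega>))"
      by (simp add: rec)
  qed
  let ?K = "\<bar>z\<bar> * (ln c * (u + w) * (v + w / c ^ k) * T\<^sup>2)"
  let ?G = "\<lambda>f. CLINT \<omega>|M. iexp (z * f \<omega>) * \<phi> (y \<omega>)"
  have int: "integrable M (\<lambda>\<omega>. iexp (z * f \<omega>) * \<phi> (y \<omega>))" if [measurable]: "f \<in> borel_measurable M" for f
    by (rule integrable_const_bound[of _ 1]) (auto simp: norm_mult \<phi>1)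
  have bound: "cmod (?G (S 1 m) - ?G (L T)) \<le> ?K" if m: "m > 0" for m
  proof -
    have mT: "real m * (T / real m) = T" using m by simp
    have h: "T / real m \<ge> 0" using T by simp
    have S1: "S 1 m = (\<lambda>\<omega>. block_sum c m (\<lambda>i. incr (T / real m) i \<omega>))" by (simp add: S_def fun_eq_iff)
    have "cmod (?G (S 1 m) - ?G (L T)) = cmod (CLINT \<omega>|M. iexp (z * S 1 m \<omega>) * \<phi> (y \<omega>) - iexp (z * L T \<omega>) * \<phi> (y \<omega>))"
      by (subst Bochner_Integration.integral_diff[OF int int]) auto
    also have "\<dots> \<le> (LINT \<omega>|M. cmod (iexp (z * S 1 m \<omega>) * \<phi> (y \<omega>) - iexp (z * L T \<omega>) * \<phi> (y \<omega>)))"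
      by (rule integral_norm_bound)
    also have "\<dots> \<le> (LINT \<omega>|M. \<bar>z\<bar> * \<bar>L T \<omega> - S 1 m \<omega>\<bar>)"
    proof (rule integral_mono)
      show "integrable M (\<lambda>\<omega>. cmod (iexp (z * S 1 m \<omega>) * \<phi> (y \<omega>) - iexp (z * L T \<omega>) * \<phi> (y \<omega>)))"
        by (intro integrable_norm Bochner_Integration.integrable_diff int S NT)
      show "integrable M (\<lambda>\<omega>. \<bar>z\<bar> * \<bar>L T \<omega> - S 1 m \<omega>\<bar>)"
        using expectation_block_sum_diff(1)[OF h, of m] unfolding mT S1 by (rule integrable_mult_right)
      fix \<omega>
      have "iexp (z * S 1 m \<omega>) * \<phi> (y \<omega>) - iexp (z * L T \<omega>) * \<phi> (y \<omega>) =
          iexp (z * L T \<omega>) * (iexp (z * (S 1 m \<omega> - L T \<omega>)) - 1) * \<phi> (y \<omega>)"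
        by (simp add: algebra_simps flip: exp_add)
      also have "cmod \<dots> \<le> \<bar>z * (S 1 m \<omega> - L T \<omega>)\<bar> * 1"
        unfolding norm_mult by (intro mult_mono \<phi>1) (use iexp_minus_1_le[of "z * (S 1 m \<omega> - L T \<omega>)"] in auto)
      also have "\<dots> = \<bar>z\<bar> * \<bar>L T \<omega> - S 1 m \<omega>\<bar>" by (simp add: abs_mult abs_minus_commute)
      finally show "cmod (iexp (z * S 1 m \<omega>) * \<phi> (y \<omega>) - iexp (z * L T \<omega>) * \<phi> (y \<omega>)) \<le> \<bar>z\<bar> * \<bar>L T \<omega> - S 1 m \<omega>\<bar>" .
    qed
    also have "\<dots> = \<bar>z\<bar> * (LINT \<omega>|M. \<bar>L T \<omega> - S 1 m \<omega>\<bar>)" by simp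
    also have "\<dots> \<le> ?K"
      using expectation_block_sum_diff(2)[OF h, of m] unfolding mT S1 by (intro mult_left_mono) auto
    finally show ?thesis .
  qed
  have "(\<lambda>m. ?G (S 1 m)) \<longlonglongrightarrow> ?G (Y 1)"
  proof (rule integral_dominated_convergence[where w="\<lambda>_. 1"])
    show "AE \<omega> in M. (\<lambda>m. iexp (z * S 1 m \<omega>) * \<phi> (y \<omega>)) \<longlonglongrightarrow> iexp (z * Y 1 \<omega>) * \<phi> (y \<omega>)"
      using SY1 by eventually_elim (intro tendsto_intros)
  qed (auto simp: norm_mult \<phi>1)
  then have "(\<lambda>m. cmod (?G (S 1 m) - ?G (L T))) \<longlonglongrightarrow> cmod (?G (Y 1) - ?G (L T))"
    by (intro tendsto_intros)
  then have "cmod (?G (Y 1) - ?G (L T)) \<le> ?K"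
  proof (rule tendsto_upperbound)
    show "eventually (\<lambda>m. cmod (?G (S 1 m) - ?G (L T)) \<le> ?K) sequentially"
      using eventually_gt_at_top[of 0] by eventually_elim (rule bound)
  qed simp
  moreover have "?G (L T) = (CLINT \<omega>|M. iexp (z * L T \<omega>) * \<phi> (z * c powr (- N T \<omega>)))"
  proof (rule integral_cong_AE)
    show "AE \<omega> in M. iexp (z * L T \<omega>) * \<phi> (y \<omega>) = iexp (z * L T \<omega>) * \<phi> (z * c powr (- N T \<omega>))"
      using AE_N_0_L_0 by eventually_elim (simp add: y_def)
  qed measurable
  ultimately show ?thesis using \<phi>_eq by simp
qed

text \<open>This is what decomposition at the first jump predicts: X is 1 + X' at rate v, X'/c at
  rate u, and c^(-k) + X'/c at rate w. It is obtained here as the first-order term in T of the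
  renewal equation.\<close>

lemma char_limit_functional_equation:
  assumes X [measurable]: "X \<in> borel_measurable M"
    and lim: "AE \<omega> in M. ((\<lambda>t. stoch_integral c (\<lambda>s. N s \<omega>) (\<lambda>s. L s \<omega>) t) \<longlongrightarrow> X \<omega>) at_top"
  shows "(u + v + w - v * iexp z) * char (distr M borel X) z =
    (u + w * iexp (z / c ^ k)) * char (distr M borel X) (z / c)"
proof -
  define \<phi> where "\<phi> z = (CLINT \<omega>|M. iexp (z * X \<omega>))" for z
  have ch: "char (distr M borel X) = \<phi>"
    by (rule ext) (simp add: char_def \<phi>_def integral_distr)
  have \<phi>1: "cmod (\<phi> z) \<le> 1" for z
  proof -
    have "cmod (\<phi> z) \<le> (LINT \<omega>|M. cmod (iexp (z * X \<omega>)))"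
      unfolding \<phi>_def by (rule integral_norm_bound)
    then show ?thesis by (simp add: prob_space)
  qed
  have [measurable]: "\<phi> \<in> borel_measurable borel" unfolding \<phi>_def by measurable
  \<comment> \<open>\<open>n \<mapsto> \<alpha> + \<beta> (-1)^n\<close> agrees with \<open>n \<mapsto> \<phi> (z / c^n)\<close> at 0 and 1, and \<open>N T \<ge> 2\<close> has probability
    \<open>O(T\<^sup>2)\<close>; so the joint characteristic function at \<open>y = 0\<close> and \<open>y = pi\<close> suffices.\<close>
  define \<alpha> \<beta> where "\<alpha> = (\<phi> z + \<phi> (z / c)) / 2" and "\<beta> = (\<phi> z - \<phi> (z / c)) / 2"
  have \<alpha>1: "cmod \<alpha> \<le> 1" and \<beta>1: "cmod \<beta> \<le> 1"
    using norm_triangle_ineq[of "\<phi> z" "\<phi> (z / c)"] norm_triangle_ineq4[of "\<phi> z" "\<phi> (z / c)"] \<phi>1[of z] \<phi>1[of "z / c"]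
    by (simp_all add: \<alpha>_def \<beta>_def norm_divide)
  define A where "A y = u * (iexp y - 1) + v * (iexp z - 1) + w * (iexp (y + z / c ^ k) - 1)" for y
  \<comment> \<open>The first summand is the cost of replacing the integral by \<open>L T\<close>;
    the second comes from N T >= 2, where the integrands differ by at most |\<phi>| + |\<alpha>| +
    |\<beta>| <= 3.\<close>
  define K where "K = \<bar>z\<bar> * (ln c * (u + w) * (v + w / c ^ k)) + 3 * (u + w)\<^sup>2"
  have "cmod (\<alpha> * exp (of_real T * A 0) + \<beta> * exp (of_real T * A pi) - (\<alpha> + \<beta>)) \<le> K * T\<^sup>2" if T: "T > 0" for T
  proof -
    have NT [measurable]: "N T \<in> borel_measurable M" "L T \<in> borel_measurable M"
      using T by (auto intro: measurable_NL)
    let ?f = "\<lambda>\<omega>. iexp (z * L T \<omega>) * \<phi> (z * c powr (- N T \<omega>))"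
    let ?g = "\<lambda>\<omega>. \<alpha> * iexp (0 * N T \<omega> + z * L T \<omega>) + \<beta> * iexp (pi * N T \<omega> + z * L T \<omega>)"
    have intf: "integrable M ?f"
      by (rule integrable_const_bound[of _ 1]) (auto simp: norm_mult \<phi>1)
    have inte: "integrable M (\<lambda>\<omega>. iexp (y * N T \<omega> + z * L T \<omega>))" for y
      by (rule integrable_const_bound[of _ 1]) auto
    have intg: "integrable M ?g"
      by (intro Bochner_Integration.integrable_add integrable_mult_right inte)
    have "(CLINT \<omega>|M. ?g \<omega>) = \<alpha> * (CLINT \<omega>|M. iexp (0 * N T \<omega> + z * L T \<omega>)) + \<beta> * (CLINT \<omega>|M. iexp (pi * N T \<omega> + z * L T \<omega>))"
      by (subst Bochner_Integration.integral_add[OF integrable_mult_right[OF inte] integrable_mult_right[OF inte]]) simp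
    also have "\<dots> = \<alpha> * exp (of_real T * A 0) + \<beta> * exp (of_real T * A pi)"
      using T by (simp only: joint_char less_imp_le A_def)
    finally have g: "(CLINT \<omega>|M. ?g \<omega>) = \<alpha> * exp (of_real T * A 0) + \<beta> * exp (of_real T * A pi)" .
    let ?E = "{\<omega> \<in> space M. N T \<omega> \<ge> 2}"
    have "cmod ((CLINT \<omega>|M. ?f \<omega>) - (CLINT \<omega>|M. ?g \<omega>)) = cmod (CLINT \<omega>|M. ?f \<omega> - ?g \<omega>)"
      by (subst Bochner_Integration.integral_diff[OF intf intg]) simp
    also have "\<dots> \<le> (LINT \<omega>|M. cmod (?f \<omega> - ?g \<omega>))" by (rule integral_norm_bound)
    also have "\<dots> \<le> (LINT \<omega>|M. 3 * indicator ?E \<omega>)"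
    proof (rule integral_mono_AE)
      show "integrable M (\<lambda>\<omega>. cmod (?f \<omega> - ?g \<omega>))"
        by (intro integrable_norm Bochner_Integration.integrable_diff intf intg)
      show "integrable M (\<lambda>\<omega>. 3 * indicator ?E \<omega> :: real)"
        by (intro integrable_mult_right integrable_real_indicator) (auto simp: emeasure_eq_measure)
      show "AE \<omega> in M. cmod (?f \<omega> - ?g \<omega>) \<le> 3 * indicator ?E \<omega>"
        using AE_N_Nats[OF less_imp_le[OF T]] AE_space
      proof eventually_elim
        case (elim \<omega>)
        obtain n where n: "N T \<omega> = real n" using elim by (auto simp: Nats_def)
        have pin: "iexp (pi * N T \<omega> + z * L T \<omega>) = (-1) ^ n * iexp (z * L T \<omega>)"
        proof -
          have "iexp (pi * real n) = (exp (\<i> * pi)) ^ n" by (simp only: exp_of_nat_mult[symmetric] of_real_mult of_real_of_nat_eq mult_ac)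
          then have "iexp (pi * real n) = (-1) ^ n" by simp
          then show ?thesis unfolding n of_real_add ring_distribs exp_add by simp
        qed
        have fg: "?f \<omega> - ?g \<omega> = iexp (z * L T \<omega>) * (\<phi> (z * c powr (- real n)) - (\<alpha> + \<beta> * (-1) ^ n))"
          unfolding pin using n by (simp add: algebra_simps)
        consider "n = 0" | "n = 1" | "n \<ge> 2" by linarith
        then show ?case
        proof cases
          case 1
          then have "?f \<omega> - ?g \<omega> = 0" using c unfolding fg by (simp add: \<alpha>_def \<beta>_def field_simps)
          then show ?thesis by simp
        next
          case 2
          have "z * c powr (- real n) = z / c" using c 2 by (simp add: powr_minus divide_inverse)
          then have "?f \<omega> - ?g \<omega> = 0" using 2 c unfolding fg by (simp add: \<alpha>_def \<beta>_def field_simps)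
          then show ?thesis by simp
        next
          case 3
          have "cmod (?f \<omega> - ?g \<omega>) \<le> cmod (\<phi> (z * c powr (- real n))) + cmod (\<alpha> + \<beta> * (-1) ^ n)"
            unfolding fg norm_mult using norm_triangle_ineq4 by simp
          also have "cmod (\<alpha> + \<beta> * (-1) ^ n) \<le> cmod \<alpha> + cmod (\<beta> * (-1) ^ n)" by (rule norm_triangle_ineq)
          also have "cmod (\<beta> * (-1) ^ n) = cmod \<beta>" by (simp add: norm_mult norm_power)
          also have "cmod (\<phi> (z * c powr (- real n))) + (cmod \<alpha> + cmod \<beta>) \<le> 3"
            using \<phi>1[of "z * c powr (- real n)"] \<alpha>1 \<beta>1 by linarith
          finally show ?thesis using 3 n elim by (simp add: indicator_def)
        qed
      qed
    qed
    also have "\<dots> = 3 * prob ?E" by simp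
    also have "\<dots> \<le> 3 * (T * (u + w))\<^sup>2"
      using prob_N_ge_2[of T] T by simp
    finally have "cmod ((CLINT \<omega>|M. ?f \<omega>) - (CLINT \<omega>|M. ?g \<omega>)) \<le> 3 * (T * (u + w))\<^sup>2" .
    moreover have "cmod (\<phi> z - (CLINT \<omega>|M. ?f \<omega>)) \<le> \<bar>z\<bar> * (ln c * (u + w) * (v + w / c ^ k) * T\<^sup>2)"
      unfolding \<phi>_def by (rule char_limit_renewal[OF X lim T])
    moreover have \<alpha>\<beta>: "\<alpha> + \<beta> = \<phi> z" by (simp add: \<alpha>_def \<beta>_def field_simps)
    moreover have "cmod ((CLINT \<omega>|M. ?g \<omega>) - \<phi> z) \<le>
        cmod ((CLINT \<omega>|M. ?f \<omega>) - (CLINT \<omega>|M. ?g \<omega>)) + cmod (\<phi> z - (CLINT \<omega>|M. ?f \<omega>))"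
      using norm_triangle_ineq[of "(CLINT \<omega>|M. ?f \<omega>) - (CLINT \<omega>|M. ?g \<omega>)" "\<phi> z - (CLINT \<omega>|M. ?f \<omega>)"]
      by (simp add: norm_minus_commute)
    moreover have KT: "\<bar>z\<bar> * (ln c * (u + w) * (v + w / c ^ k) * T\<^sup>2) + 3 * (T * (u + w))\<^sup>2 = K * T\<^sup>2"
      unfolding K_def power_mult_distrib by (simp add: algebra_simps)
    ultimately show ?thesis
      unfolding g[symmetric] KT[symmetric] \<alpha>\<beta> by linarith
  qed
  then have "\<alpha> * A 0 + \<beta> * A pi = 0" by (rule deriv_zero_if_quadratic)
  moreover have "iexp (pi + z / c ^ k) = - iexp (z / c ^ k)"
    by (simp add: ring_distribs exp_add)
  ultimately have 0: "\<alpha> * (v * (iexp z - 1) + w * (iexp (z / c ^ k) - 1)) +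
     \<beta> * (- 2 * u + v * (iexp z - 1) + w * (- iexp (z / c ^ k) - 1)) = 0"
    by (simp add: A_def algebra_simps)
  have "(u + w * iexp (z / c ^ k)) * \<phi> (z / c) - (u + v + w - v * iexp z) * \<phi> z =
     \<alpha> * (v * (iexp z - 1) + w * (iexp (z / c ^ k) - 1)) +
     \<beta> * (- 2 * u + v * (iexp z - 1) + w * (- iexp (z / c ^ k) - 1))"
    unfolding \<alpha>_def \<beta>_def by (simp add: field_simps)
  then have "(u + v + w - v * iexp z) * \<phi> z = (u + w * iexp (z / c ^ k)) * \<phi> (z / c)"
    unfolding 0 by simp
  then show ?thesis unfolding ch by simp
qed

end

section \<open>The criterion\<close>

theorem theorem5p3:
  fixes M :: "'a measure"
    and N L :: "real \<Rightarrow> 'a \<Rightarrow> real"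
    and X :: "'a \<Rightarrow> real"
    and k :: nat
    and c p q r u v w :: real
  assumes "k \<ge> 1" and "c > 1"
    and "p \<ge> 0" "q \<ge> 0" "r \<ge> 0" and "p + q + r = 1"
    and "u \<ge> 0" "v \<ge> 0" "w \<ge> 0"
    and "p = u / (u + v + w)" "q = v / (u + v + w)" "r = w / (u + v + w)"
    and "compound_poisson_process M (jump_measure (int k) c u v w) (\<lambda>t \<omega>. (N t \<omega>, L t \<omega>))"
    and "X \<in> borel_measurable M"
    and "AE \<omega> in M.
           ((\<lambda>t. stoch_integral c (\<lambda>s. N s \<omega>) (\<lambda>s. L s \<omega>) t) \<longlongrightarrow> X \<omega>) at_top"
    and "0 < r" and "r < p"
  shows "infinitely_divisible (distr M borel X) \<longleftrightarrow>
           r \<le> p * q \<or> ((\<exists>l\<in>{1..k}. c ^ l = 2) \<and> r\<^sup>2 \<le> p\<^sup>2 * q)"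
proof -
  interpret jump_process M N L k c u v w
    by (rule jump_process.intro) (use assms in auto)
  \<comment> \<open>With a zero denominator p, q and r would all be 0, against p + q + r =
    1.\<close>
  have "u + v + w \<noteq> 0" using assms(6,10-12) by auto
  then have uvw: "u = p * (u + v + w)" "v = q * (u + v + w)" "w = r * (u + v + w)"
    and nz: "complex_of_real (u + v + w) \<noteq> 0"
    using assms(10-12) by (simp_all flip: of_real_add)
  note [measurable] = assms(14)
  have \<mu>: "real_distribution (distr M borel X)"
    by (intro real_distribution.intro real_distribution_axioms.intro prob_space_distr) auto
  have fe: "(1 - q * iexp z) * char (distr M borel X) z = (p + r * iexp (z / c ^ k)) * char (distr M borel X) (z / c)" for z
  proof -
    let ?s = "complex_of_real (u + v + w)"
    have scale: "complex_of_real u = p * ?s" "complex_of_real v = q * ?s" "complex_of_real w = r * ?s"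
      unfolding of_real_mult[symmetric] using uvw by simp_all
    have "?s * ((1 - q * iexp z) * char (distr M borel X) z) = (?s - v * iexp z) * char (distr M borel X) z"
      unfolding scale(2) by (simp only: ring_distribs mult_ac mult_1_left)
    also have "\<dots> = (u + w * iexp (z / c ^ k)) * char (distr M borel X) (z / c)"
      using char_limit_functional_equation[OF assms(14,15), of z] by simp
    also have "\<dots> = ?s * ((p + r * iexp (z / c ^ k)) * char (distr M borel X) (z / c))"
      unfolding scale(1,3) by (simp only: ring_distribs mult_ac)
    finally show ?thesis using nz by (simp only: mult_cancel_left) simp
  qed
  note hyps = \<mu> \<open>c > 1\<close> \<open>q \<ge> 0\<close> \<open>0 < r\<close> \<open>r < p\<close> \<open>p + q + r = 1\<close> fe
  show ?thesis
  proof
    assume "infinitely_divisible (distr M borel X)"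
    then show "r \<le> p * q \<or> ((\<exists>l\<in>{1..k}. c ^ l = 2) \<and> r\<^sup>2 \<le> p\<^sup>2 * q)"
      using not_infinitely_divisible[OF hyps] by (meson not_le)
  next
    assume "r \<le> p * q \<or> ((\<exists>l\<in>{1..k}. c ^ l = 2) \<and> r\<^sup>2 \<le> p\<^sup>2 * q)"
    then show "infinitely_divisible (distr M borel X)"
      using infinitely_divisible_if_le[OF hyps] infinitely_divisible_if_power_eq_2[OF hyps] by auto
  qed
qed

end
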